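(* Let $s\in(0,1)$ and let $K:\mathbb R^d\times\mathbb R^d\to\mathbb R$ be a (possibly sign-changing) measurable kernel such that for all $v\in\mathbb R^d$ and $r>0$ $$\int_{\mathbb R^d\setminus B_r(v)}|K(v,v')|\,dv'\le\Lambda r^{-2s},\qquad\int_{\mathbb R^d\setminus B_r(v)}|K(v',v)|\,dv'\le\Lambda r^{-2s},$$ and for all $v\in\mathbb R^d$ $$\left|PV\int_{\mathbb R^d}(K(v,v')-K(v',v))\,dv'\right|\le\Lambda.$$ If $s\ge1/2$, assume in addition that for all $R>0$ and $v\in\mathbb R^d$ $$\left|PV\int_{B_R(v)}(K(v,v')-K(v',v))(v-v')\,dv'\right|\le\Lambda(1+R^{1-2s}).$$ Then there exists a constant $C$ depending only on $s$, $d$ and $\Lambda$ such that for all $f,g\in H^s(\mathbb R^d)$ $$\mathcal E(f,g)\le C\|f\|_{H^s}\|g\|_{H^s}.$$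
   Context: $B_r(v)$ is the ball of radius $r$ centered at $v$ in $\mathbb R^d$. The bilinear form associated with $K$ is $$\mathcal E(\varphi,g)=\lim_{\varepsilon\to0}\iint_{|v-v'|>\varepsilon}(\varphi(v)-\varphi(v'))g(v)K(v,v')\,dv'\,dv,$$ for smooth $\varphi,g$, and is extended to $H^s(\mathbb R^d)\times H^s(\mathbb R^d)$ by density. The norm is $\|f\|_{H^s}^2=\|f\|_{L^2}^2+\iint_{\mathbb R^d\times\mathbb R^d}\frac{|f(v')-f(v)|^2}{|v-v'|^{d+2s}}\,dv\,dv'$.
   Formalization: Both principal values are assumed to be limits of the truncated integrals not only at every v but also as distributions in v; with pointwise limits alone the claim fails (e.g. d=1, s<1/2, a kernel whose truncations concentrate on a Cantor set of dimension 1-2s). *)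

theory Defs
  imports "HOL-Analysis.Analysis"
begin

fun C_k :: "nat \<Rightarrow> ('a::euclidean_space \<Rightarrow> real) \<Rightarrow> bool" where
  "C_k 0 f \<longleftrightarrow> continuous_on UNIV f"
| "C_k (Suc k) f \<longleftrightarrow> (\<forall>x. f differentiable (at x)) \<and>
     (\<forall>h. C_k k (\<lambda>x. frechet_derivative f (at x) h))"

definition test_function :: "('a::euclidean_space \<Rightarrow> real) \<Rightarrow> bool" where
  "test_function f \<longleftrightarrow> (\<forall>k. C_k k f) \<and> compact (closure {x. f x \<noteq> 0})"


definition gagliardo_integrand ::
  "real \<Rightarrow> ('a::euclidean_space \<Rightarrow> real) \<Rightarrow> 'a \<times> 'a \<Rightarrow> real" where
  "gagliardo_integrand s f = (\<lambda>(v, v'). \<bar>f v' - f v\<bar>\<^sup>2 / norm (v - v') powr (real DIM('a) + 2 * s))"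

definition Hs :: "real \<Rightarrow> ('a::euclidean_space \<Rightarrow> real) set" where
  "Hs s = {f. f \<in> borel_measurable lebesgue \<and> integrable lebesgue (\<lambda>v. \<bar>f v\<bar>\<^sup>2) \<and>
              integrable lebesgue (gagliardo_integrand s f)}"

definition Hs_norm :: "real \<Rightarrow> ('a::euclidean_space \<Rightarrow> real) \<Rightarrow> real" where
  "Hs_norm s f = sqrt ((LINT v|lebesgue. \<bar>f v\<bar>\<^sup>2) + (LINT z|lebesgue. gagliardo_integrand s f z))"


definition tail_bound :: "real \<Rightarrow> real \<Rightarrow> ('a::euclidean_space \<Rightarrow> 'a \<Rightarrow> real) \<Rightarrow> bool" where
  "tail_bound s \<Lambda> K \<longleftrightarrow> (\<forall>v. \<forall>r>0.
     set_integrable lebesgue (- ball v r) (K v) \<and>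
     (LINT v':- ball v r|lebesgue. \<bar>K v v'\<bar>) \<le> \<Lambda> * r powr (- 2 * s))"

definition truncated_integral ::
  "('a::euclidean_space \<Rightarrow> 'a set) \<Rightarrow> ('a \<Rightarrow> 'a \<Rightarrow> 'b::euclidean_space) \<Rightarrow> real \<Rightarrow> 'a \<Rightarrow> 'b" where
  "truncated_integral D h \<epsilon> v = (LINT v':D v - ball v \<epsilon>|lebesgue. h v v')"

(* P v = PV \<integral>_{D v} h v v' dv' for every v.  Besides the pointwise limit, the truncated integrals
   are required to converge to P as distributions in v.  This is what allows principal values to be
   used under the integral in v; it follows from the pointwise limit when the truncated integrals
   are locally dominated, but not in general: they may also have a singular part in the limit,
   carried by a null set, on which redefining the kernel hides it from the pointwise limit. *)
definition has_principal_value ::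
  "('a::euclidean_space \<Rightarrow> 'a set) \<Rightarrow> ('a \<Rightarrow> 'a \<Rightarrow> 'b::euclidean_space) \<Rightarrow> ('a \<Rightarrow> 'b) \<Rightarrow> bool" where
  "has_principal_value D h P \<longleftrightarrow>
     (\<forall>v. ((\<lambda>\<epsilon>. truncated_integral D h \<epsilon> v) \<longlongrightarrow> P v) (at_right 0)) \<and>
     (\<forall>\<psi>. test_function \<psi> \<longrightarrow>
        ((\<lambda>\<epsilon>. LINT v|lebesgue. \<psi> v *\<^sub>R truncated_integral D h \<epsilon> v)
           \<longlongrightarrow> (LINT v|lebesgue. \<psi> v *\<^sub>R P v)) (at_right 0))"


definition truncated_form ::
  "('a::euclidean_space \<Rightarrow> 'a \<Rightarrow> real) \<Rightarrow> real \<Rightarrow> ('a \<Rightarrow> real) \<Rightarrow> ('a \<Rightarrow> real) \<Rightarrow> real" where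
  "truncated_form K \<epsilon> \<phi> g =
     (LINT (v, v'):{(v, v'). norm (v - v') > \<epsilon>}|lebesgue. (\<phi> v - \<phi> v') * g v * K v v')"

definition smooth_form ::
  "('a::euclidean_space \<Rightarrow> 'a \<Rightarrow> real) \<Rightarrow> ('a \<Rightarrow> real) \<Rightarrow> ('a \<Rightarrow> real) \<Rightarrow> real" where
  "smooth_form K \<phi> g = Lim (at_right 0) (\<lambda>\<epsilon>. truncated_form K \<epsilon> \<phi> g)"

definition Hs_approx :: "real \<Rightarrow> (nat \<Rightarrow> 'a::euclidean_space \<Rightarrow> real) \<Rightarrow> ('a \<Rightarrow> real) \<Rightarrow> bool" where
  "Hs_approx s \<phi> f \<longleftrightarrow> (\<forall>n. test_function (\<phi> n)) \<and>
     (\<lambda>n. Hs_norm s (\<lambda>v. \<phi> n v - f v)) \<longlonglongrightarrow> 0"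

(* Extension by density: the common limit along all approximations by test functions. *)
definition form_value ::
  "real \<Rightarrow> ('a::euclidean_space \<Rightarrow> 'a \<Rightarrow> real) \<Rightarrow> ('a \<Rightarrow> real) \<Rightarrow> ('a \<Rightarrow> real) \<Rightarrow> real \<Rightarrow> bool" where
  "form_value s K f g e \<longleftrightarrow>
     (\<forall>\<phi> \<gamma>. Hs_approx s \<phi> f \<and> Hs_approx s \<gamma> g \<longrightarrow>
        (\<lambda>n. smooth_form K (\<phi> n) (\<gamma> n)) \<longlonglongrightarrow> e)"

definition form ::
  "real \<Rightarrow> ('a::euclidean_space \<Rightarrow> 'a \<Rightarrow> real) \<Rightarrow> ('a \<Rightarrow> real) \<Rightarrow> ('a \<Rightarrow> real) \<Rightarrow> real" where
  "form s K f g = (THE e. form_value s K f g e)"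

end

(*
  Averaging the integrand over the swap of the two variables splits the form into
  1/2 \<integral>\<integral> (f - f')(g - g') K  and the skew form  1/2 \<integral>\<integral> (f - f') g A  with A(v,v') = K(v,v') - K(v',v).
  The first is controlled by the tail bounds alone: over the dyadic annulus |v - v'| ~ R the
  increment f - f' is averaged against f(w) for w near v, and the square function
  sum_j R_j^(-2s) \<integral> R_j^(-d) \<integral>_{B(v,2R_j)} |f(w) - f(v)|^2 dw dv,  R_j = 2^(-j),  is at most a multiple of the
  Gagliardo seminorm.
  For the skew form, if f is smooth at scale R, Taylor expansion up to distance R (linear part: the
  first-moment cancellation) and the tail bound beyond R give the bound C R^(-2s) |f|_2 |g|_2; the principal value
  of A allows f and g to be exchanged.  Telescoping f and g along the mollifications at scales R_j and
  letting the operator act on the lower of the two frequencies, the interaction of scales i < j gains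
  2^(-s(j-i)), which is summable against the square functions.  Density of test functions in H^s then
  yields existence and uniqueness of the extension.
*)
theory Submission
  imports Defs
begin

section \<open>Test functions\<close>

text \<open>Cancellation aside, the kernel is known only through integrals over complements of
  balls. Estimates therefore bound the other factor by a function of \<open>v\<close> plus a
  function of \<open>v'\<close>, and then integrate out one variable against \<open>|K|\<close>.
  This is why smoothness is measured by local averages (\<open>osc\<close>) instead of Fourier
  analysis, and why products are split by a weighted AM-GM inequality with a free parameter
  \<open>t\<close>. The choice of \<open>t\<close> produces the gain between two frequencies. The
  resulting bounds are additive, \<open>|f|^2 + |g|^2\<close>; homogeneity of the bilinear form
  turns them into a product only at the end. Scales stop at 1 because for \<open>s >= 1/2\<close>
  the first-moment hypothesis has the homogeneous size \<open>R^(1-2s)\<close> only when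
  \<open>R <= 1\<close>; the lowest frequency is charged to the L2 norm. For \<open>s < 1/2\<close>
  the first moment converges absolutely. The kernel is merely Lebesgue measurable. A Borel
  representative inherits the tail bounds for almost every \<open>v\<close>, and principal values
  enter through their integrals against test functions, since pointwise limits alone do not pass to
  the double integrals.\<close>

lemma C_k_SucI:
  assumes "\<And>x. (f has_derivative D x) (at x)" "\<And>h. C_k k (\<lambda>x. D x h)"
  shows "C_k (Suc k) f"
proof -
  have "frechet_derivative f (at x) = D x" for x
    using frechet_derivative_at[OF assms(1)[of x]] by simp
  then show ?thesis
    using assms by (auto simp: differentiable_def)
qed

lemma C_k_SucE:
  assumes "C_k (Suc k) f"
  obtains D where "\<And>x. (f has_derivative D x) (at x)" "\<And>h. C_k k (\<lambda>x. D x h)"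
proof
  show "(f has_derivative frechet_derivative f (at x)) (at x)" for x
    using assms frechet_derivative_works by auto
  show "C_k k (\<lambda>x. frechet_derivative f (at x) h)" for h
    using assms by auto
qed

lemma C_k_pred: "C_k (Suc k) f \<Longrightarrow> C_k k f"
proof (induction k arbitrary: f)
  case 0
  then show ?case
    by (auto intro!: continuous_at_imp_continuous_on differentiable_imp_continuous_within)
next
  case (Suc k)
  then show ?case by auto
qed

lemma C_k_const [simp]: "C_k k (\<lambda>x. c)"
proof (induction k arbitrary: c)
  case (Suc k)
  then show ?case by (auto intro!: C_k_SucI[where D = "\<lambda>x h. 0"])
qed simp

lemma C_k_add: "C_k k f \<Longrightarrow> C_k k g \<Longrightarrow> C_k k (\<lambda>x. f x + g x)"
proof (induction k arbitrary: f g)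
  case (Suc k)
  from C_k_SucE[OF Suc.prems(1)] C_k_SucE[OF Suc.prems(2)] obtain F G where
    "\<And>x. (f has_derivative F x) (at x)" "\<And>h. C_k k (\<lambda>x. F x h)"
    "\<And>x. (g has_derivative G x) (at x)" "\<And>h. C_k k (\<lambda>x. G x h)" by metis
  then show ?case
    by (intro C_k_SucI[where D = "\<lambda>x h. F x h + G x h"])
       (auto intro!: has_derivative_add Suc.IH)
qed (auto intro: continuous_intros)

lemma C_k_mult: "C_k k f \<Longrightarrow> C_k k g \<Longrightarrow> C_k k (\<lambda>x. f x * g x)"
proof (induction k arbitrary: f g)
  case (Suc k)
  from C_k_SucE[OF Suc.prems(1)] C_k_SucE[OF Suc.prems(2)] obtain F G where
    *: "\<And>x. (f has_derivative F x) (at x)" "\<And>h. C_k k (\<lambda>x. F x h)"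
    "\<And>x. (g has_derivative G x) (at x)" "\<And>h. C_k k (\<lambda>x. G x h)" by metis
  show ?case
    by (rule C_k_SucI[where D = "\<lambda>x h. f x * G x h + F x h * g x"])
       (use * Suc.prems in \<open>auto intro!: has_derivative_mult C_k_add Suc.IH simp del: C_k.simps dest: C_k_pred\<close>)
qed (auto intro: continuous_intros)

lemma C_k_compose_affine:
  "C_k k f \<Longrightarrow> C_k k (\<lambda>x. f (a + c *\<^sub>R x))"
proof (induction k arbitrary: f)
  case 0
  then show ?case by (auto intro!: continuous_on_compose2[of UNIV f] continuous_intros)
next
  case (Suc k)
  from C_k_SucE[OF Suc.prems(1)] obtain F where
    *: "\<And>x. (f has_derivative F x) (at x)" "\<And>h. C_k k (\<lambda>x. F x h)" by metis
  show ?case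
  proof (rule C_k_SucI[where D = "\<lambda>x h. F (a + c *\<^sub>R x) (c *\<^sub>R h)"])
    show "((\<lambda>x. f (a + c *\<^sub>R x)) has_derivative (\<lambda>h. F (a + c *\<^sub>R x) (c *\<^sub>R h))) (at x)" for x
      by (rule has_derivative_compose[of "\<lambda>x. a + c *\<^sub>R x" "\<lambda>h. c *\<^sub>R h" x UNIV f, simplified])
         (auto intro!: derivative_eq_intros *)
    show "C_k k (\<lambda>x. F (a + c *\<^sub>R x) (c *\<^sub>R h))" for h
      using Suc.IH[OF *(2)] .
  qed
qed

lemma C_k_inner [simp]: "C_k k (\<lambda>x. x \<bullet> h)"
proof (cases k)
  case (Suc k)
  show ?thesis unfolding Suc
    by (rule C_k_SucI[where D = "\<lambda>x y. y \<bullet> h"]) (auto intro!: derivative_eq_intros)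
qed (auto intro!: continuous_intros)

section \<open>A smooth bump function and the algebra of test functions\<close>

definition bump_profile :: "nat \<Rightarrow> real \<Rightarrow> real" where
  "bump_profile n t = (if t \<le> 0 then 0 else (1 / t) ^ n * exp (- (1 / t)))"

lemma bump_profile_tendsto_0: "(bump_profile n \<longlongrightarrow> 0) (at_right 0)"
proof -
  have "((\<lambda>x::real. x ^ n / exp x) \<longlongrightarrow> 0) at_top"
    by (rule tendsto_power_div_exp_0)
  then have "((\<lambda>t::real. inverse t ^ n / exp (inverse t)) \<longlongrightarrow> 0) (at_right 0)"
    by (rule filterlim_compose[OF _ filterlim_inverse_at_top_right])
  then show ?thesis
    by (rule Lim_transform_eventually)
       (auto simp: bump_profile_def eventually_at_right_field exp_minus field_simps intro!: exI[of _ 1])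
qed

text \<open>The powers of \<open>1 / t\<close> close the family under differentiation: the
  derivative of \<open>exp(-1/t) / t^n\<close> is a combination of the members \<open>n + 1\<close>
  and \<open>n + 2\<close>. Only at \<open>t = 0\<close>, where all members vanish, is a limit
  needed.\<close>

lemma bump_profile_DERIV:
  "(bump_profile n has_field_derivative bump_profile (n + 2) t - real n * bump_profile (n + 1) t) (at t)"
proof -
  consider "t < 0" | "t > 0" | "t = 0" by linarith
  then show ?thesis
  proof cases
    case 1
    have "((\<lambda>t. 0) has_field_derivative 0) (at t)" by auto
    then have "(bump_profile n has_field_derivative 0) (at t)"
      by (rule DERIV_cong_ev[THEN iffD1, rotated 3, OF _ refl _ refl])
         (use 1 in \<open>auto simp: bump_profile_def eventually_nhds intro!: exI[of _ "{..<0}"]\<close>)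
    then show ?thesis using 1 by (simp add: bump_profile_def)
  next
    case 2
    have "((\<lambda>t. (1 / t) ^ n * exp (- (1 / t))) has_field_derivative
       (1 / t) ^ (n + 2) * exp (- (1 / t)) - real n * ((1 / t) ^ (n + 1) * exp (- (1 / t)))) (at t)"
    proof (cases n)
      case 0
      then show ?thesis
        using 2 by (auto intro!: derivative_eq_intros simp: field_simps power2_eq_square)
    next
      case (Suc m)
      have "t ^ Suc m \<noteq> 0" using 2 by simp
      then show ?thesis
        using 2 unfolding Suc
        by (cases m; use power_eq_if[of t "m - 1"] in
            \<open>auto intro!: derivative_eq_intros simp: field_simps power2_eq_square split: if_splits\<close>)
    qed
    then have "(bump_profile n has_field_derivative
       (1 / t) ^ (n + 2) * exp (- (1 / t)) - real n * ((1 / t) ^ (n + 1) * exp (- (1 / t)))) (at t)"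
      by (rule DERIV_cong_ev[THEN iffD1, rotated 3, OF _ refl _ refl])
         (use 2 in \<open>auto simp: bump_profile_def eventually_nhds intro!: exI[of _ "{0<..}"]\<close>)
    then show ?thesis using 2 by (simp add: bump_profile_def)
  next
    case 3
    have "((\<lambda>h. (bump_profile n (0 + h) - bump_profile n 0) / h) \<longlongrightarrow> 0) (at 0)"
    proof (rule filterlim_split_at)
      show "((\<lambda>h. (bump_profile n (0 + h) - bump_profile n 0) / h) \<longlongrightarrow> 0) (at_left 0)"
        by (rule tendsto_eventually)
           (auto simp: bump_profile_def eventually_at_left_field intro!: exI[of _ "-1"])
      \<comment> \<open>For \<open>h > 0\<close> the quotient is exactly the next member,
        \<open>bump_profile (Suc n) h\<close>, which tends to 0.\<close>
      show "((\<lambda>h. (bump_profile n (0 + h) - bump_profile n 0) / h) \<longlongrightarrow> 0) (at_right 0)"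
        by (rule Lim_transform_eventually[OF bump_profile_tendsto_0[of "Suc n"]])
           (auto simp: bump_profile_def eventually_at_right_field field_simps intro!: exI[of _ 1])
    qed
    then show ?thesis
      using 3 by (simp add: DERIV_def bump_profile_def)
  qed
qed

text \<open>Differentiation reproduces the family with larger \<open>n\<close>, times the linear
  function \<open>-2 (x \<bullet> h)\<close>; hence the induction on \<open>k\<close> keeps
  \<open>n\<close> arbitrary.\<close>

lemma C_k_bump: "C_k k (\<lambda>x::'a::euclidean_space. bump_profile n (1 - x \<bullet> x))"
proof (induction k arbitrary: n)
  case 0
  have "isCont (bump_profile n) t" for t
    using bump_profile_DERIV by (rule DERIV_isCont)
  then have "continuous_on UNIV (bump_profile n)"
    by (simp add: continuous_at_imp_continuous_on)
  then show ?case by (auto intro!: continuous_on_compose2[of UNIV "bump_profile n"] continuous_intros)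
next
  case (Suc k)
  let ?d = "\<lambda>x::'a. bump_profile (n + 2) (1 - x \<bullet> x) + (- real n) * bump_profile (n + 1) (1 - x \<bullet> x)"
  show ?case
  proof (rule C_k_SucI[where D = "\<lambda>x h. ?d x * ((-2) * (x \<bullet> h))"])
    show "((\<lambda>x. bump_profile n (1 - x \<bullet> x)) has_derivative (\<lambda>h. ?d x * ((-2) * (x \<bullet> h)))) (at x)" for x
      by (rule DERIV_compose_FDERIV[OF bump_profile_DERIV, THEN has_derivative_eq_rhs])
         (auto intro!: derivative_eq_intros simp: inner_commute algebra_simps)
    show "C_k k (\<lambda>x. ?d x * ((-2) * (x \<bullet> h)))" for h
      by (intro C_k_mult C_k_add C_k_const C_k_inner Suc.IH)
  qed
qed

lemma test_function_iff:
  fixes f :: "'a::euclidean_space \<Rightarrow> real"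
  shows "test_function f \<longleftrightarrow> (\<forall>k. C_k k f) \<and> (\<exists>B. \<forall>x. f x \<noteq> 0 \<longrightarrow> norm x \<le> B)"
  by (auto simp: test_function_def compact_closure bounded_iff)

lemma test_functionE:
  assumes "test_function f"
  obtains B where "B > 0" "\<And>x. norm x > B \<Longrightarrow> f x = 0"
proof -
  obtain B where "\<forall>x. f x \<noteq> 0 \<longrightarrow> norm x \<le> B"
    using assms by (auto simp: test_function_iff)
  then show ?thesis by (intro that[of "max B 1"]) fastforce+
qed

lemma test_function_zero [simp]: "test_function (\<lambda>x. 0)"
  by (auto simp: test_function_iff)

lemma test_function_add:
  assumes "test_function f" "test_function g" shows "test_function (\<lambda>x. f x + g x)"
proof -
  obtain A B where "\<And>x. norm x > A \<Longrightarrow> f x = 0" "\<And>x. norm x > B \<Longrightarrow> g x = 0"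
    using assms by (metis test_functionE)
  then have "\<forall>x. f x + g x \<noteq> 0 \<longrightarrow> norm x \<le> max A B"
    by (metis add.right_neutral linorder_not_le max.strict_boundedE)
  then show ?thesis using assms unfolding test_function_iff by (blast intro: C_k_add)
qed

lemma test_function_mult:
  assumes "test_function f" "test_function g" shows "test_function (\<lambda>x. f x * g x)"
proof -
  obtain A where "\<And>x. norm x > A \<Longrightarrow> f x = 0"
    using assms by (metis test_functionE)
  then have "\<forall>x. f x * g x \<noteq> 0 \<longrightarrow> norm x \<le> A"
    by (metis linorder_not_le mult_zero_left)
  then show ?thesis using assms unfolding test_function_iff by (blast intro: C_k_mult)
qed

lemma test_function_cmult:
  assumes "test_function f" shows "test_function (\<lambda>x. c * f x)"
proof -
  obtain A where "\<And>x. norm x > A \<Longrightarrow> f x = 0"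
    using assms by (metis test_functionE)
  then have "\<forall>x. c * f x \<noteq> 0 \<longrightarrow> norm x \<le> A"
    by (metis linorder_not_le mult_zero_right)
  moreover have "\<forall>k. C_k k (\<lambda>x. c * f x)"
    using assms by (auto simp: test_function_iff intro!: C_k_mult)
  ultimately show ?thesis unfolding test_function_iff by blast
qed

lemma test_function_minus: "test_function f \<Longrightarrow> test_function (\<lambda>x. - f x)"
  using test_function_cmult[of f "-1"] by simp

lemma test_function_diff:
  "test_function f \<Longrightarrow> test_function g \<Longrightarrow> test_function (\<lambda>x. f x - g x)"
  using test_function_add[of f "\<lambda>x. - g x"] test_function_minus[of g] by simp

section \<open>Gradients, Taylor bounds and a normalised mollifier\<close>

definition grad :: "('a::euclidean_space \<Rightarrow> real) \<Rightarrow> 'a \<Rightarrow> 'a \<Rightarrow> real" where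
  "grad f x h = frechet_derivative f (at x) h"

lemma test_function_has_derivative:
  assumes "test_function f" shows "(f has_derivative grad f x) (at x)"
proof -
  have "C_k (Suc 0) f" using assms by (auto simp: test_function_def)
  then show ?thesis unfolding grad_def using frechet_derivative_works by auto
qed

lemma grad_eqI: "(f has_derivative D) (at x) \<Longrightarrow> grad f x = D"
  unfolding grad_def using frechet_derivative_at by metis

lemma grad_eq_0_outside:
  assumes "\<And>x. norm x > A \<Longrightarrow> f x = 0" "norm x > A"
  shows "grad f x h = 0"
proof -
  have "(f has_derivative (\<lambda>h. 0)) (at x)"
    by (rule has_derivative_transform_within_open[OF has_derivative_const[of 0], of "{x. norm x > A}"])
       (use assms in \<open>auto intro!: open_Collect_less continuous_intros\<close>)
  then show ?thesis by (simp add: grad_eqI)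
qed

lemma test_function_grad:
  fixes f :: "'a::euclidean_space \<Rightarrow> real"
  assumes "test_function f" shows "test_function (\<lambda>x. grad f x h)"
proof -
  obtain A where A: "\<And>x. norm x > A \<Longrightarrow> f x = 0"
    using assms by (metis test_functionE)
  have *: "\<forall>x. grad f x h \<noteq> 0 \<longrightarrow> norm x \<le> A"
    using grad_eq_0_outside[OF A] by force
  have "\<forall>k. C_k (Suc k) f" using assms by (auto simp only: test_function_def)
  then have "\<forall>k. C_k k (\<lambda>x. grad f x h)" unfolding grad_def by auto
  then show ?thesis using * unfolding test_function_iff by blast
qed

lemma test_function_continuous: "test_function f \<Longrightarrow> continuous_on UNIV f"
  using C_k.simps(1) test_function_def by metis

lemma test_function_measurable: "test_function f \<Longrightarrow> f \<in> borel_measurable borel"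
  by (intro borel_measurable_continuous_onI test_function_continuous)

lemma test_function_bounded:
  assumes "test_function f" obtains B where "B > 0" "\<And>x. \<bar>f x\<bar> \<le> B"
proof -
  obtain A where A: "\<And>x. norm x > A \<Longrightarrow> f x = 0"
    using assms by (metis test_functionE)
  have "compact (f ` cball 0 A)"
    using assms by (intro compact_continuous_image compact_cball)
      (auto intro: continuous_on_subset[OF test_function_continuous])
  then obtain B where B: "\<And>x. x \<in> cball 0 A \<Longrightarrow> \<bar>f x\<bar> \<le> B"
    by (metis bounded_iff compact_imp_bounded image_eqI real_norm_def)
  have "\<bar>f x\<bar> \<le> max B 1" for x
    using B[of x] A[of x] by (cases "norm x > A") (auto simp: max_def)
  then show ?thesis by (intro that[of "max B 1"]) auto
qed

lemma grad_expand:
  fixes f :: "'a::euclidean_space \<Rightarrow> real"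
  assumes "test_function f" shows "grad f x h = (\<Sum>b\<in>Basis. (h \<bullet> b) * grad f x b)"
proof -
  have lin: "linear (grad f x)"
    using test_function_has_derivative[OF assms] has_derivative_linear by blast
  have "grad f x h = grad f x (\<Sum>b\<in>Basis. (h \<bullet> b) *\<^sub>R b)" by (simp add: euclidean_representation)
  also have "\<dots> = (\<Sum>b\<in>Basis. (h \<bullet> b) * grad f x b)"
    by (simp add: linear_sum[OF lin] linear_scale[OF lin])
  finally show ?thesis .
qed

text \<open>For a fixed direction the derivative is again a test function of the base point and
  hence bounded; the basis expansion adds up finitely many such bounds.\<close>

lemma test_function_grad_bounded:
  fixes f :: "'a::euclidean_space \<Rightarrow> real"
  assumes "test_function f" obtains L where "L > 0" "\<And>x h. \<bar>grad f x h\<bar> \<le> L * norm h"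
proof -
  have "\<exists>B. B > 0 \<and> (\<forall>x. \<bar>grad f x b\<bar> \<le> B)" for b
    using test_function_bounded[OF test_function_grad[OF assms, of b]] by metis
  then obtain B where B: "\<And>b. B b > 0" "\<And>b x. \<bar>grad f x b\<bar> \<le> B b" by metis
  have "\<bar>grad f x h\<bar> \<le> (\<Sum>b\<in>Basis. B b) * norm h" for x h
  proof -
    have "\<bar>grad f x h\<bar> \<le> (\<Sum>b\<in>Basis. \<bar>(h \<bullet> b) * grad f x b\<bar>)"
      unfolding grad_expand[OF assms, of x h] by (rule sum_abs)
    also have "\<dots> \<le> (\<Sum>b\<in>Basis. norm h * B b)"
      unfolding abs_mult by (intro sum_mono mult_mono B Basis_le_norm) auto
    finally show ?thesis by (simp add: sum_distrib_left mult.commute)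
  qed
  moreover have "(\<Sum>b\<in>(Basis::'a set). B b) > 0" using B by (intro sum_pos) auto
  ultimately show ?thesis using that by blast
qed

lemma test_function_mvt:
  fixes f :: "'a::euclidean_space \<Rightarrow> real"
  assumes "test_function f"
  obtains z where "z \<in> closed_segment x y" "f y - f x = grad f z (y - x)"
proof -
  let ?g = "\<lambda>t. f (x + t *\<^sub>R (y - x))"
  have "\<exists>t. 0 < t \<and> t < 1 \<and> ?g 1 - ?g 0 = (\<lambda>t h. grad f (x + t *\<^sub>R (y - x)) (h *\<^sub>R (y - x))) t (1 - 0)"
  proof (rule mvt[of 0 1 ?g "\<lambda>t h. grad f (x + t *\<^sub>R (y - x)) (h *\<^sub>R (y - x))"])
    have D: "(?g has_derivative (\<lambda>h. grad f (x + t *\<^sub>R (y - x)) (h *\<^sub>R (y - x)))) (at t)" for t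
      by (rule has_derivative_compose[of "\<lambda>t. x + t *\<^sub>R (y - x)" "\<lambda>h. h *\<^sub>R (y - x)" t UNIV f, simplified])
         (auto intro!: derivative_eq_intros test_function_has_derivative assms)
    then show "(?g has_derivative (\<lambda>h. grad f (x + t *\<^sub>R (y - x)) (h *\<^sub>R (y - x)))) (at t)" for t .
    show "continuous_on {0..1} ?g"
      using D by (intro continuous_at_imp_continuous_on ballI has_derivative_continuous)
  qed auto
  then obtain t where "0 < t" "t < 1" "f y - f x = grad f (x + t *\<^sub>R (y - x)) (y - x)" by auto
  then show ?thesis
    by (intro that[of "x + t *\<^sub>R (y - x)"]) (auto simp: closed_segment_def algebra_simps intro!: exI[of _ t])
qed

lemma test_function_Lipschitz:
  fixes f :: "'a::euclidean_space \<Rightarrow> real"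
  assumes "test_function f" obtains L where "L > 0" "\<And>x y. \<bar>f y - f x\<bar> \<le> L * norm (y - x)"
proof -
  obtain L where L: "L > 0" "\<And>x h. \<bar>grad f x h\<bar> \<le> L * norm h"
    using test_function_grad_bounded[OF assms] by metis
  show ?thesis
    using that[OF L(1)] test_function_mvt[OF assms] L(2) by metis
qed

text \<open>By the mean value theorem the remainder is a difference of gradients at \<open>x\<close>
  and at an intermediate point, applied to \<open>y - x\<close>. The partial derivatives are
  Lipschitz, which supplies the second factor of the distance.\<close>

lemma test_function_taylor:
  fixes f :: "'a::euclidean_space \<Rightarrow> real"
  assumes "test_function f"
  obtains L where "L > 0" "\<And>x y. \<bar>f y - f x - grad f x (y - x)\<bar> \<le> L * (norm (y - x))\<^sup>2"
proof -
  have "\<exists>B. B > 0 \<and> (\<forall>x y. \<bar>grad f y b - grad f x b\<bar> \<le> B * norm (y - x))" for b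
    using test_function_Lipschitz[OF test_function_grad[OF assms, of b]] by metis
  then obtain B where B: "\<And>b. B b > 0" "\<And>b x y. \<bar>grad f y b - grad f x b\<bar> \<le> B b * norm (y - x)"
    by metis
  have D: "\<bar>grad f z h - grad f x h\<bar> \<le> (\<Sum>b\<in>Basis. B b) * norm (z - x) * norm h" for x z h
  proof -
    have "\<bar>grad f z h - grad f x h\<bar> \<le> (\<Sum>b\<in>Basis. \<bar>(h \<bullet> b) * (grad f z b - grad f x b)\<bar>)"
      unfolding grad_expand[OF assms, of x h] grad_expand[OF assms, of z h]
      by (subst sum_subtractf[symmetric], subst right_diff_distrib[symmetric], rule sum_abs)
    also have "\<dots> \<le> (\<Sum>b\<in>Basis. norm h * (B b * norm (z - x)))"
      unfolding abs_mult by (intro sum_mono mult_mono B Basis_le_norm) auto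
    finally show ?thesis by (simp add: sum_distrib_left sum_distrib_right mult.commute mult.left_commute)
  qed
  have pos: "(\<Sum>b\<in>(Basis::'a set). B b) > 0" using B by (intro sum_pos) auto
  have "\<bar>f y - f x - grad f x (y - x)\<bar> \<le> (\<Sum>b\<in>Basis. B b) * (norm (y - x))\<^sup>2" for x y
  proof -
    obtain z where z: "z \<in> closed_segment x y" "f y - f x = grad f z (y - x)"
      by (rule test_function_mvt[OF assms])
    have "\<bar>f y - f x - grad f x (y - x)\<bar> \<le> (\<Sum>b\<in>Basis. B b) * norm (z - x) * norm (y - x)"
      using D z(2) by simp
    also have "\<dots> \<le> (\<Sum>b\<in>Basis. B b) * norm (y - x) * norm (y - x)"
      using segment_bound(1)[OF z(1)] pos by (intro mult_mono) auto
    finally show ?thesis by (simp add: power2_eq_square mult.assoc)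
  qed
  then show ?thesis using that pos by blast
qed

lemma test_function_integrable:
  fixes f :: "'a::euclidean_space \<Rightarrow> real"
  assumes "test_function f" shows "integrable lborel f"
proof -
  obtain A where A: "A > 0" "\<And>x. norm x > A \<Longrightarrow> f x = 0"
    using test_functionE[OF assms] by metis
  obtain B where B: "\<And>x. \<bar>f x\<bar> \<le> B" using test_function_bounded[OF assms] by metis
  have [measurable]: "f \<in> borel_measurable borel" by (rule test_function_measurable[OF assms])
  show ?thesis
  proof (rule Bochner_Integration.integrable_bound)
    show "integrable lborel (\<lambda>x::'a. indicator (cball 0 A) x * B :: real)"
      by (intro integrable_mult_left integrable_real_indicator)
         (use emeasure_lborel_cball_finite[of "0::'a" A] in \<open>auto simp: top.not_eq_extremum\<close>)
    have "\<bar>f x\<bar> \<le> indicator (cball 0 A) x * B" for x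
      using A(2)[of x] B[of x] by (cases "norm x > A") (auto simp: indicator_def)
    moreover have "B \<ge> 0" using B[of 0] by linarith
    ultimately show "AE x in lborel. norm (f x) \<le> norm (indicator (cball 0 A) x * B :: real)" by auto
  qed auto
qed

lemma ex_mollifier:
  "\<exists>\<rho>::'a::euclidean_space \<Rightarrow> real. test_function \<rho> \<and> (\<forall>x. \<rho> x \<ge> 0) \<and> (\<forall>x. norm x \<ge> 1 \<longrightarrow> \<rho> x = 0)
     \<and> integral\<^sup>L lborel \<rho> = 1"
proof -
  define b :: "'a \<Rightarrow> real" where "b x = bump_profile 0 (1 - x \<bullet> x)" for x
  have nn: "b x \<ge> 0" for x by (auto simp: b_def bump_profile_def)
  have out: "b x = 0" if "norm x \<ge> 1" for x
    using that power_mono[of 1 "norm x" 2] by (auto simp: b_def bump_profile_def dot_square_norm)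
  have test: "test_function b"
    unfolding test_function_iff using C_k_bump[of _ 0] out
    by (auto simp: b_def[abs_def] intro!: exI[of _ 1]) (meson linorder_le_cases)
  have [measurable]: "b \<in> borel_measurable borel" by (rule test_function_measurable[OF test])
  have int: "integrable lborel b" by (rule test_function_integrable[OF test])
  \<comment> \<open>The bump is strictly positive on the open unit ball, a set of positive measure,
    so its integral can be normalised to 1.\<close>
  have pos: "integral\<^sup>L lborel b > 0"
  proof -
    have "integral\<^sup>L lborel b \<noteq> 0"
    proof
      assume "integral\<^sup>L lborel b = 0"
      then have "AE x in lborel. b x = 0"
        using integral_nonneg_eq_0_iff_AE[OF int] nn by simp
      then have "AE x in lborel. x \<notin> ball (0::'a) 1"
      proof (rule eventually_mono)
        show "x \<notin> ball 0 1" if "b x = 0" for x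
          using that abs_square_less_1[of "norm x"]
          by (auto simp: b_def bump_profile_def dot_square_norm split: if_splits)
      qed
      then have "emeasure lborel (ball (0::'a) 1) = 0"
        by (subst (asm) AE_iff_measurable[OF _ refl]) (auto simp: ball_def)
      then show False using content_ball_pos[of 1 "0::'a"] by (simp add: measure_def)
    qed
    moreover have "integral\<^sup>L lborel b \<ge> 0" using nn by (intro Bochner_Integration.integral_nonneg)
    ultimately show ?thesis by linarith
  qed
  show ?thesis
    by (rule exI[of _ "\<lambda>x. (1 / integral\<^sup>L lborel b) * b x"])
       (use pos nn out test_function_cmult[OF test, of "1 / integral\<^sup>L lborel b"] in auto)
qed

section \<open>Integration preliminaries\<close>

text \<open>Estimates below are mostly carried out for \<open>nn_integral\<close>, where Tonelli and
  monotonicity need no integrability; this is the way back to Bochner integrals.\<close>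

lemma integrable_of_nn_integral_le:
  fixes f :: "'a \<Rightarrow> real"
  assumes "f \<in> borel_measurable M" "(\<integral>\<^sup>+x. ennreal \<bar>f x\<bar> \<partial>M) \<le> ennreal c" "c \<ge> 0"
  shows "integrable M f" "\<bar>integral\<^sup>L M f\<bar> \<le> c" "(\<integral>x. \<bar>f x\<bar> \<partial>M) \<le> c"
proof -
  show *: "integrable M f"
    using assms by (intro integrableI_bounded) (auto elim: le_less_trans)
  then have "ennreal (\<integral>x. \<bar>f x\<bar> \<partial>M) \<le> ennreal c"
    using assms by (subst nn_integral_eq_integral[symmetric]) auto
  then show **: "(\<integral>x. \<bar>f x\<bar> \<partial>M) \<le> c"
    using assms(3) by simp
  show "\<bar>integral\<^sup>L M f\<bar> \<le> c"
    using ** integral_abs_bound[of M f] by linarith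
qed

lemma abs_integral_le:
  fixes f :: "'a \<Rightarrow> real"
  assumes "integrable M f" "integrable M g" "\<And>x. \<bar>f x\<bar> \<le> g x"
  shows "\<bar>integral\<^sup>L M f\<bar> \<le> integral\<^sup>L M g"
proof -
  have "\<bar>integral\<^sup>L M f\<bar> \<le> (\<integral>x. \<bar>f x\<bar> \<partial>M)" by (rule integral_abs_bound)
  also have "\<dots> \<le> integral\<^sup>L M g" by (rule integral_mono) (use assms in auto)
  finally show ?thesis .
qed

lemma Cauchy_Schwarz_integral:
  fixes f g :: "'a \<Rightarrow> real"
  assumes [measurable]: "f \<in> borel_measurable M" "g \<in> borel_measurable M"
    and "integrable M (\<lambda>x. (f x)\<^sup>2)" "integrable M (\<lambda>x. (g x)\<^sup>2)"
  shows "integrable M (\<lambda>x. f x * g x)"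
    and "\<bar>\<integral>x. f x * g x \<partial>M\<bar> \<le> sqrt (\<integral>x. (f x)\<^sup>2 \<partial>M) * sqrt (\<integral>x. (g x)\<^sup>2 \<partial>M)"
proof -
  let ?F = "\<integral>x. (f x)\<^sup>2 \<partial>M" and ?G = "\<integral>x. (g x)\<^sup>2 \<partial>M"
  let ?N = "\<integral>\<^sup>+x. ennreal \<bar>f x * g x\<bar> \<partial>M"
  have [simp]: "?F \<ge> 0" "?G \<ge> 0" by auto
  have "(\<integral>\<^sup>+x. ennreal \<bar>f x\<bar> * ennreal \<bar>g x\<bar> \<partial>M)\<^sup>2
      \<le> (\<integral>\<^sup>+x. ennreal \<bar>f x\<bar> ^ 2 \<partial>M) * (\<integral>\<^sup>+x. ennreal \<bar>g x\<bar> ^ 2 \<partial>M)"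
    by (rule Cauchy_Schwarz_nn_integral) auto
  also have "\<dots> = ennreal (?F * ?G)"
    using assms(3,4) by (simp add: ennreal_power nn_integral_eq_integral ennreal_mult)
  finally have *: "?N\<^sup>2 \<le> ennreal (?F * ?G)"
    by (simp add: abs_mult ennreal_mult)
  have "?N\<^sup>2 < \<infinity>" using * by (rule le_less_trans) simp
  then have fin: "?N < \<infinity>" by (simp add: power_less_top_ennreal)
  then obtain n where n: "n \<ge> 0" "?N = ennreal n"
    by (cases ?N rule: ennreal_cases) auto
  have "n\<^sup>2 \<le> ?F * ?G"
    using * n by (simp add: ennreal_power)
  then have "n \<le> sqrt (?F * ?G)" by (rule real_le_rsqrt)
  then have "?N \<le> ennreal (sqrt ?F * sqrt ?G)"
    unfolding n(2) by (intro ennreal_leI) (simp add: real_sqrt_mult)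
  from integrable_of_nn_integral_le[OF _ this]
  show "integrable M (\<lambda>x. f x * g x)" "\<bar>\<integral>x. f x * g x \<partial>M\<bar> \<le> sqrt ?F * sqrt ?G"
    by auto
qed

lemma nn_integral_lborel_affine:
  fixes f :: "'a::euclidean_space \<Rightarrow> ennreal"
  assumes [measurable]: "f \<in> borel_measurable borel" and "c \<noteq> 0"
  shows "(\<integral>\<^sup>+x. f x \<partial>lborel) = \<bar>c\<bar> ^ DIM('a) * (\<integral>\<^sup>+x. f (t + c *\<^sub>R x) \<partial>lborel)"
  by (subst lborel_affine[OF assms(2), of t])
     (simp add: nn_integral_density nn_integral_distr nn_integral_cmult ennreal_power)

lemma integral_lborel_affine:
  fixes f :: "'a::euclidean_space \<Rightarrow> real"
  assumes [measurable]: "f \<in> borel_measurable borel" and "c \<noteq> 0"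
  shows "(\<integral>x. f x \<partial>lborel) = \<bar>c\<bar> ^ DIM('a) * (\<integral>x. f (t + c *\<^sub>R x) \<partial>lborel)"
  by (subst lborel_affine[OF assms(2), of t])
     (simp add: integral_density integral_distr)

lemma integrable_lborel_affine:
  fixes f :: "'a::euclidean_space \<Rightarrow> real"
  assumes "integrable lborel f" "c \<noteq> 0"
  shows "integrable lborel (\<lambda>x. f (t + c *\<^sub>R x))"
proof -
  have [measurable]: "f \<in> borel_measurable borel" using assms(1) by auto
  have "ennreal (\<bar>c\<bar> ^ DIM('a)) * (\<integral>\<^sup>+x. ennreal (norm (f (t + c *\<^sub>R x))) \<partial>lborel) < \<infinity>"
    using assms(1) nn_integral_lborel_affine[symmetric, of "\<lambda>x. ennreal (norm (f x))" c t] assms(2)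
    by (simp add: integrable_iff_bounded ennreal_power)
  then show ?thesis
    using assms(2) by (auto simp: integrable_iff_bounded ennreal_mult_less_top ennreal_power)
qed

lemma content_ball_unit_pos: "measure lborel (ball (0::'a::euclidean_space) 1) > 0"
  by (rule content_ball_pos) simp

lemma nn_integral_ball_indicator:
  fixes v :: "'a::euclidean_space"
  assumes "r \<ge> 0"
  shows "(\<integral>\<^sup>+w. indicator (ball v r) w \<partial>lborel)
    = ennreal (r ^ DIM('a) * measure lborel (ball (0::'a::euclidean_space) 1))"
  using emeasure_lborel_ball_finite[of v r] content_ball_conv_unit_ball[OF assms, of v]
  by (simp add: emeasure_eq_ennreal_measure)

lemma integral_ball_indicator:
  fixes v :: "'a::euclidean_space"
  assumes "r \<ge> 0"
  shows "integrable lborel (indicator (ball v r) :: _ \<Rightarrow> real)"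
    "(\<integral>w. indicator (ball v r) w \<partial>lborel) = r ^ DIM('a) * measure lborel (ball (0::'a::euclidean_space) 1)"
  using emeasure_lborel_ball_finite[of v r] content_ball_conv_unit_ball[OF assms, of v]
  by (auto intro!: integrable_real_indicator)

section \<open>Convolution and mollification\<close>

definition conv :: "('a::euclidean_space \<Rightarrow> real) \<Rightarrow> ('a \<Rightarrow> real) \<Rightarrow> 'a \<Rightarrow> real" where
  "conv \<rho> f v = (LINT w|lborel. \<rho> (v - w) * f w)"

lemma conv_integrable:
  fixes f :: "'a::euclidean_space \<Rightarrow> real"
  assumes "test_function \<rho>" "integrable lborel f"
  shows "integrable lborel (\<lambda>w. \<rho> (v - w) * f w)"
proof -
  obtain B where B: "\<And>x. \<bar>\<rho> x\<bar> \<le> B" using test_function_bounded[OF assms(1)] by metis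
  have [measurable]: "\<rho> \<in> borel_measurable borel" "f \<in> borel_measurable borel"
    using assms test_function_measurable by auto
  show ?thesis
    by (rule Bochner_Integration.integrable_bound[where f = "\<lambda>w. B * f w"])
       (use assms B in \<open>auto simp: abs_mult intro!: mult_mono order_trans[OF B]\<close>)
qed

text \<open>The Taylor remainder of \<open>\<rho>\<close> is quadratic uniformly in the base point,
  so integrating it against an integrable \<open>f\<close> leaves a quadratic remainder. No theorem
  on differentiation under the integral is involved.\<close>

lemma conv_has_derivative:
  fixes f :: "'a::euclidean_space \<Rightarrow> real"
  assumes \<rho>: "test_function \<rho>" and f: "integrable lborel f"
  shows "(conv \<rho> f has_derivative (\<lambda>h. conv (\<lambda>x. grad \<rho> x h) f v)) (at v)"
proof -
  let ?D = "\<lambda>h. conv (\<lambda>x. grad \<rho> x h) f v"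
  obtain T where T: "T > 0" "\<And>x y. \<bar>\<rho> y - \<rho> x - grad \<rho> x (y - x)\<bar> \<le> T * (norm (y - x))\<^sup>2"
    using test_function_taylor[OF \<rho>] by metis
  have lin: "linear (grad \<rho> x)" for x
    using test_function_has_derivative[OF \<rho>] has_derivative_linear by blast
  have int: "integrable lborel (\<lambda>w. \<rho> (v - w) * f w)" for v
    by (rule conv_integrable[OF \<rho> f])
  have intD: "integrable lborel (\<lambda>w. grad \<rho> (v - w) h * f w)" for h
    by (rule conv_integrable[OF test_function_grad[OF \<rho>] f])
  have "linear ?D"
    by (rule linearI)
       (use intD in \<open>auto simp: conv_def linear_add[OF lin] linear_scale[OF lin] algebra_simps\<close>)
  then have bl: "bounded_linear ?D" by (simp add: linear_conv_bounded_linear)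
  let ?C = "T * (\<integral>w. \<bar>f w\<bar> \<partial>lborel)"
  have est: "\<bar>conv \<rho> f y - conv \<rho> f v - ?D (y - v)\<bar> \<le> ?C * (norm (y - v))\<^sup>2" for y
  proof -
    have "conv \<rho> f y - conv \<rho> f v - ?D (y - v)
      = (LINT w|lborel. (\<rho> (y - w) - \<rho> (v - w) - grad \<rho> (v - w) (y - v)) * f w)"
      unfolding conv_def using int intD by (simp add: left_diff_distrib)
    also have "\<bar>\<dots>\<bar> \<le> (LINT w|lborel. T * (norm (y - v))\<^sup>2 * \<bar>f w\<bar>)"
    proof (rule abs_integral_le)
      show "integrable lborel (\<lambda>w. (\<rho> (y - w) - \<rho> (v - w) - grad \<rho> (v - w) (y - v)) * f w)"
        using int intD by (simp add: left_diff_distrib)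
      show "integrable lborel (\<lambda>w. T * (norm (y - v))\<^sup>2 * \<bar>f w\<bar>)"
        using f by simp
      show "\<bar>(\<rho> (y - w) - \<rho> (v - w) - grad \<rho> (v - w) (y - v)) * f w\<bar>
          \<le> T * (norm (y - v))\<^sup>2 * \<bar>f w\<bar>" for w
        using T(2)[of "y - w" "v - w"] by (auto simp: abs_mult intro!: mult_right_mono)
    qed
    finally show ?thesis by (simp add: mult_ac)
  qed
  have C: "?C \<ge> 0" using T(1) by (auto intro!: mult_nonneg_nonneg)
  have "((\<lambda>y. norm (conv \<rho> f y - conv \<rho> f v - ?D (y - v)) / norm (y - v)) \<longlongrightarrow> 0) (at v)"
  proof (rule tendsto_sandwich[where f = "\<lambda>y. 0" and h = "\<lambda>y. ?C * norm (y - v)"])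
    show "\<forall>\<^sub>F y in at v. norm (conv \<rho> f y - conv \<rho> f v - ?D (y - v)) / norm (y - v) \<le> ?C * norm (y - v)"
      using est by (auto simp: eventually_at_filter divide_simps power2_eq_square mult.assoc)
    show "((\<lambda>y. ?C * norm (y - v)) \<longlongrightarrow> 0) (at v)"
      by (auto intro!: tendsto_eq_intros)
  qed auto
  then show ?thesis using bl by (simp add: has_derivative_iff_norm)
qed

lemma conv_C_k:
  fixes f :: "'a::euclidean_space \<Rightarrow> real"
  assumes "test_function \<rho>" "integrable lborel f"
  shows "C_k k (conv \<rho> f)"
  using assms(1)
proof (induction k arbitrary: \<rho>)
  case 0
  then have "(conv \<rho> f has_derivative (\<lambda>h. conv (\<lambda>x. grad \<rho> x h) f v)) (at v)" for v
    using conv_has_derivative assms(2) by blast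
  then show ?case
    by (auto intro!: continuous_at_imp_continuous_on has_derivative_continuous)
next
  case (Suc k)
  show ?case
    by (rule C_k_SucI[where D = "\<lambda>v h. conv (\<lambda>x. grad \<rho> x h) f v"])
       (use Suc assms(2) in \<open>auto intro!: conv_has_derivative Suc.IH test_function_grad\<close>)
qed

lemma test_function_conv:
  fixes f :: "'a::euclidean_space \<Rightarrow> real"
  assumes \<rho>: "test_function \<rho>" and f: "integrable lborel f" and B: "\<And>x. norm x > B \<Longrightarrow> f x = 0"
  shows "test_function (conv \<rho> f)"
proof -
  obtain A where A: "\<And>x. norm x > A \<Longrightarrow> \<rho> x = 0" using test_functionE[OF \<rho>] by metis
  have "norm v \<le> A + B" if "conv \<rho> f v \<noteq> 0" for v
  proof (rule ccontr)
    assume "\<not> ?thesis"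
    then have "\<rho> (v - w) * f w = 0" for w
      using A[of "v - w"] B[of w] norm_triangle_ineq[of "v - w" w] by fastforce
    then have "(\<lambda>w. \<rho> (v - w) * f w) = (\<lambda>w. 0)" by (rule ext)
    then have "conv \<rho> f v = 0" by (simp add: conv_def)
    with that show False by simp
  qed
  then show ?thesis unfolding test_function_iff using conv_C_k[OF \<rho> f] by blast
qed

lemma grad_conv:
  assumes "test_function \<rho>" "integrable lborel f"
  shows "grad (conv \<rho> f) v h = conv (\<lambda>x. grad \<rho> x h) f v"
  using grad_eqI[OF conv_has_derivative[OF assms]] by simp

lemma integral_reflect_shift:
  fixes f :: "'a::euclidean_space \<Rightarrow> real"
  assumes "f \<in> borel_measurable borel"
  shows "(\<integral>w. f (v - w) \<partial>lborel) = integral\<^sup>L lborel f"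
  using integral_lborel_affine[OF assms, of "-1" v] by simp

text \<open>Convolution with the indicator of a large ball is locally constant.\<close>

lemma integral_grad_eq_0:
  fixes \<rho> :: "'a::euclidean_space \<Rightarrow> real"
  assumes \<rho>: "test_function \<rho>"
  shows "(\<integral>x. grad \<rho> x h \<partial>lborel) = 0"
proof -
  obtain A where A: "A > 0" "\<And>x. norm x > A \<Longrightarrow> \<rho> x = 0" using test_functionE[OF \<rho>] by metis
  obtain A' where A': "A' > 0" "\<And>x. norm x > A' \<Longrightarrow> grad \<rho> x h = 0"
    using test_functionE[OF test_function_grad[OF \<rho>]] by metis
  \<comment> \<open>The radius lets the ball contain the support of \<open>\<rho> (v - w)\<close> in
    \<open>w\<close> for every \<open>v\<close> in the unit ball, as well as that of the derivative
    at \<open>v = 0\<close>.\<close>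
  define f :: "'a \<Rightarrow> real" where "f = indicator (ball 0 (A + A' + 1))"
  have int: "integrable lborel f" unfolding f_def using A A' by (intro integral_ball_indicator) auto
  have [measurable]: "\<rho> \<in> borel_measurable borel" "(\<lambda>x. grad \<rho> x h) \<in> borel_measurable borel"
    by (auto intro!: test_function_measurable test_function_grad \<rho>)
  have "conv \<rho> f v = integral\<^sup>L lborel \<rho>" if "v \<in> ball 0 1" for v
  proof -
    have "\<rho> (v - w) * f w = \<rho> (v - w)" for w
      using A A'(1) that norm_triangle_ineq[of "w - v" v]
      by (cases "norm (v - w) > A") (auto simp: f_def indicator_def norm_minus_commute)
    then have "(\<lambda>w. \<rho> (v - w) * f w) = (\<lambda>w. \<rho> (v - w))" by (rule ext)
    then show ?thesis by (simp add: conv_def integral_reflect_shift)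
  qed
  then have "(conv \<rho> f has_derivative (\<lambda>h. 0)) (at 0)"
    by (intro has_derivative_transform_within_open[OF has_derivative_const[of "integral\<^sup>L lborel \<rho>"], of "ball 0 1"]) auto
  then have "conv (\<lambda>x. grad \<rho> x h) f 0 = 0"
    using grad_eqI grad_conv[OF \<rho> int] by metis
  moreover have "(\<lambda>w. grad \<rho> (0 - w) h * f w) = (\<lambda>w. grad \<rho> (0 - w) h)"
  proof
    show "grad \<rho> (0 - w) h * f w = grad \<rho> (0 - w) h" for w
      using A' A(1) by (cases "norm w > A'") (auto simp: f_def indicator_def)
  qed
  ultimately show ?thesis
    using integral_reflect_shift[of "\<lambda>x. grad \<rho> x h" 0] by (simp add: conv_def)
qed

text \<open>Dilation that preserves the integral. The summand 0 puts the argument into the affine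
  shape of \<open>C_k_compose_affine\<close>.\<close>

definition scaled :: "('a::euclidean_space \<Rightarrow> real) \<Rightarrow> real \<Rightarrow> 'a \<Rightarrow> real" where
  "scaled \<rho> r x = (1 / r ^ DIM('a)) * \<rho> (0 + (1 / r) *\<^sub>R x)"

lemma test_function_scaled:
  fixes \<rho> :: "'a::euclidean_space \<Rightarrow> real"
  assumes "test_function \<rho>" "r > 0" shows "test_function (scaled \<rho> r)"
proof -
  obtain A where A: "\<And>x. norm x > A \<Longrightarrow> \<rho> x = 0" using test_functionE[OF assms(1)] by metis
  have "norm x \<le> r * A" if "scaled \<rho> r x \<noteq> 0" for x
  proof (rule ccontr)
    assume "\<not> ?thesis"
    then have "norm ((1 / r) *\<^sub>R x) > A" using assms(2) by (simp add: field_simps)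
    with A that show False by (simp add: scaled_def)
  qed
  moreover have "C_k k (scaled \<rho> r)" for k
    unfolding scaled_def[abs_def] using assms(1)
    by (intro C_k_mult C_k_const C_k_compose_affine) (auto simp: test_function_def)
  ultimately show ?thesis unfolding test_function_iff by blast
qed

lemma grad_scaled:
  fixes \<rho> :: "'a::euclidean_space \<Rightarrow> real"
  assumes "test_function \<rho>"
  shows "grad (scaled \<rho> r) x h = (1 / r ^ DIM('a)) * grad \<rho> ((1 / r) *\<^sub>R x) ((1 / r) *\<^sub>R h)"
proof -
  have "((\<lambda>x. \<rho> (0 + (1 / r) *\<^sub>R x)) has_derivative (\<lambda>h. grad \<rho> (0 + (1 / r) *\<^sub>R x) ((1 / r) *\<^sub>R h))) (at x)"
    by (rule has_derivative_compose[OF _ test_function_has_derivative[OF assms]])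
       (auto intro!: derivative_eq_intros)
  from has_derivative_mult_right[OF this, of "1 / r ^ DIM('a)"]
  have "(scaled \<rho> r has_derivative (\<lambda>h. (1 / r ^ DIM('a)) * grad \<rho> ((1 / r) *\<^sub>R x) ((1 / r) *\<^sub>R h))) (at x)"
    by (simp add: scaled_def[abs_def])
  from grad_eqI[OF this] show ?thesis by simp
qed

lemma integral_scaled:
  fixes \<rho> :: "'a::euclidean_space \<Rightarrow> real"
  assumes "test_function \<rho>" "r > 0"
  shows "integral\<^sup>L lborel (scaled \<rho> r) = integral\<^sup>L lborel \<rho>"
proof -
  have [measurable]: "\<rho> \<in> borel_measurable borel" by (rule test_function_measurable[OF assms(1)])
  show ?thesis
    using integral_lborel_affine[of "scaled \<rho> r" r 0] assms(2)
    by (simp add: scaled_def[abs_def])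
qed

locale mollifier =
  fixes \<rho> :: "'a::euclidean_space \<Rightarrow> real"
  assumes test: "test_function \<rho>" and nonneg: "\<rho> x \<ge> 0"
    and support: "norm x \<ge> 1 \<Longrightarrow> \<rho> x = 0" and integral_1: "integral\<^sup>L lborel \<rho> = 1"
begin

definition mollify :: "real \<Rightarrow> ('a \<Rightarrow> real) \<Rightarrow> 'a \<Rightarrow> real" where
  "mollify r f = conv (scaled \<rho> r) f"

lemma test_function_mollify:
  assumes "r > 0" "test_function f" shows "test_function (mollify r f)"
proof -
  obtain B where "\<And>x. norm x > B \<Longrightarrow> f x = 0" using test_functionE[OF assms(2)] by metis
  then show ?thesis
    unfolding mollify_def
    by (intro test_function_conv test_function_scaled test assms test_function_integrable)
qed

lemma scaled_support: "r > 0 \<Longrightarrow> norm x \<ge> r \<Longrightarrow> scaled \<rho> r x = 0"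
  using support[of "(1 / r) *\<^sub>R x"] by (auto simp: scaled_def)

lemma integral_scaled_shift: "r > 0 \<Longrightarrow> (\<integral>w. scaled \<rho> r (v - w) \<partial>lborel) = 1"
  by (subst integral_reflect_shift)
     (auto simp: integral_scaled test integral_1 test_function_scaled intro!: test_function_measurable)

end

text \<open>The constant \<open>c\<close> is \<open>f v\<close> for the oscillation at scale \<open>R\<close>, and \<open>0\<close> for the lowest frequency.\<close>

definition osc :: "real \<Rightarrow> real \<Rightarrow> ('a::euclidean_space \<Rightarrow> real) \<Rightarrow> 'a \<Rightarrow> real" where
  "osc R c f v = (LINT w|lborel. indicator (ball v (2 * R)) w * (f w - c)\<^sup>2) / R ^ DIM('a)"

lemma osc_nonneg [simp]: "R \<ge> 0 \<Longrightarrow> osc R c f v \<ge> 0"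
  by (auto simp: osc_def intro!: Bochner_Integration.integral_nonneg divide_nonneg_nonneg)

lemma integrable_osc_integrand:
  fixes f :: "'a::euclidean_space \<Rightarrow> real"
  assumes "test_function f"
  shows "integrable lborel (\<lambda>w. indicator (ball v r) w * (f w - c)\<^sup>2)"
proof -
  obtain B where B: "B > 0" "\<And>x. \<bar>f x\<bar> \<le> B" using test_function_bounded[OF assms] by metis
  have [measurable]: "f \<in> borel_measurable borel" by (rule test_function_measurable[OF assms])
  have "\<bar>f w - c\<bar> \<le> \<bar>B + \<bar>c\<bar>\<bar>" for w using B(2)[of w] by linarith
  then have le: "(f w - c)\<^sup>2 \<le> (B + \<bar>c\<bar>)\<^sup>2" for w by (simp add: abs_le_square_iff)
  have "emeasure lborel (ball v r) < \<infinity>" by (rule emeasure_lborel_ball_finite)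
  then have "integrable lborel (\<lambda>w. indicator (ball v r) w * (B + \<bar>c\<bar>)\<^sup>2)"
    by (intro integrable_mult_left integrable_real_indicator) auto
  then show ?thesis
    by (rule Bochner_Integration.integrable_bound) (use le in \<open>auto simp: indicator_def\<close>)
qed

text \<open>Cauchy-Schwarz on the ball of radius \<open>2 R\<close>: a kernel of height
  \<open>B / R^d\<close> has L2 norm \<open>B R^(-d/2)\<close> times the root of
  \<open>2^d |B_1|\<close>, and the L2 norm of \<open>f - c\<close> on the ball is
  \<open>R^(d/2)\<close> times the root of the oscillation.\<close>

lemma integral_kernel_le_osc:
  fixes f \<kappa> :: "'a::euclidean_space \<Rightarrow> real"
  assumes f: "test_function f" and R: "R > 0" and [measurable]: "\<kappa> \<in> borel_measurable borel"
    and B: "B \<ge> 0" "\<And>w. \<bar>\<kappa> w\<bar> \<le> B / R ^ DIM('a) * indicator (ball v (2 * R)) w"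
  shows "\<bar>LINT w|lborel. \<kappa> w * (f w - c)\<bar>
    \<le> B * sqrt (2 ^ DIM('a) * measure lborel (ball (0::'a) 1)) * sqrt (osc R c f v)"
proof -
  let ?i = "\<lambda>w. indicator (ball v (2 * R)) w :: real"
  let ?M = "measure lborel (ball (0::'a) 1)"
  have [measurable]: "f \<in> borel_measurable borel" by (rule test_function_measurable[OF f])
  have eq: "\<kappa> w * (f w - c) = \<kappa> w * (?i w * (f w - c))" for w
    using B(2)[of w] by (auto simp: indicator_def)
  have sq: "(?i w * (f w - c))\<^sup>2 = ?i w * (f w - c)\<^sup>2" for w by (auto simp: indicator_def)
  have \<kappa>2: "(\<kappa> w)\<^sup>2 \<le> ?i w * (B / R ^ DIM('a))\<^sup>2" for w
    using power_mono[OF B(2)[of w] abs_ge_zero, of 2] by (auto simp: indicator_def)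
  have int1: "integrable lborel (\<lambda>w. ?i w * (B / R ^ DIM('a))\<^sup>2)"
    using integral_ball_indicator(1)[of "2 * R" v] R by (intro integrable_mult_left) auto
  have int: "integrable lborel (\<lambda>w. (\<kappa> w)\<^sup>2)"
    by (rule Bochner_Integration.integrable_bound[OF int1]) (use \<kappa>2 in auto)
  have "\<bar>LINT w|lborel. \<kappa> w * (f w - c)\<bar> = \<bar>LINT w|lborel. \<kappa> w * (?i w * (f w - c))\<bar>"
    by (rule arg_cong[where f = abs], rule Bochner_Integration.integral_cong[OF refl eq])
  also have "\<dots> \<le> sqrt (LINT w|lborel. (\<kappa> w)\<^sup>2) * sqrt (LINT w|lborel. (?i w * (f w - c))\<^sup>2)"
  proof (rule Cauchy_Schwarz_integral)
    show "(\<lambda>w. ?i w * (f w - c)) \<in> borel_measurable lborel"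
      by (intro borel_measurable_times borel_measurable_indicator borel_measurable_diff) auto
  qed (use int integrable_osc_integrand[OF f] in \<open>auto simp: sq\<close>)
  also have "(LINT w|lborel. (?i w * (f w - c))\<^sup>2) = R ^ DIM('a) * osc R c f v"
    using R by (simp add: osc_def sq)
  also have "(LINT w|lborel. (\<kappa> w)\<^sup>2) \<le> (LINT w|lborel. ?i w * (B / R ^ DIM('a))\<^sup>2)"
    by (rule integral_mono[OF int int1 \<kappa>2])
  also have "(LINT w|lborel. ?i w * (B / R ^ DIM('a))\<^sup>2) = (2 * R) ^ DIM('a) * ?M * (B / R ^ DIM('a))\<^sup>2"
    using integral_ball_indicator(2)[of "2 * R" v] R by simp
  also have "sqrt \<dots> * sqrt (R ^ DIM('a) * osc R c f v)
      = B * sqrt (2 ^ DIM('a) * ?M) * sqrt (osc R c f v)"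
    using R B(1) unfolding real_sqrt_mult[symmetric]
    by (intro real_sqrt_unique)
       (auto simp: power_mult_distrib field_simps power2_eq_square)
  finally show ?thesis using R by (simp add: mult_right_mono)
qed

text \<open>The range of \<open>r\<close> admits two neighbouring dyadic scales, so that both
  mollifications in a dyadic difference are controlled by the oscillation at one \<open>R\<close>.
  The constant depends on \<open>\<rho>\<close> alone, which keeps the final constant independent of
  the kernel.\<close>

definition mollify_const :: "('a::euclidean_space \<Rightarrow> real) \<Rightarrow> real \<Rightarrow> bool" where
  "mollify_const \<rho> C \<longleftrightarrow> C > 0 \<and> (\<forall>R>0. \<forall>r\<in>{R/2..R}. \<forall>f c v. test_function f \<longrightarrow>
     \<bar>conv (scaled \<rho> r) f v - c\<bar> \<le> C * sqrt (osc R c f v) \<and>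
     (\<forall>h. \<bar>grad (conv (scaled \<rho> r) f) v h\<bar> \<le> C * (norm h / R) * sqrt (osc R c f v)) \<and>
     (\<forall>v'. norm (v' - v) < R \<longrightarrow> \<bar>conv (scaled \<rho> r) f v' - conv (scaled \<rho> r) f v -
        grad (conv (scaled \<rho> r) f) v (v' - v)\<bar> \<le> C * (norm (v' - v) / R)\<^sup>2 * sqrt (osc R c f v)))"

context mollifier
begin

text \<open>Subtracting a constant from \<open>f\<close> shifts the mollification by that constant
  and leaves its derivative and Taylor remainder unchanged. Each quantity is then an integral of
  \<open>f - c\<close> against a kernel supported within \<open>2 R\<close> of \<open>v\<close>, to
  which \<open>integral_kernel_le_osc\<close> applies.\<close>

lemma ex_mollify_const: "\<exists>C. mollify_const \<rho> C"
proof -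
  let ?d = "DIM('a)"
  obtain B where B: "B > 0" "\<And>x. \<bar>\<rho> x\<bar> \<le> B" using test_function_bounded[OF test] by metis
  obtain L where L: "L > 0" "\<And>x h. \<bar>grad \<rho> x h\<bar> \<le> L * norm h"
    using test_function_grad_bounded[OF test] by metis
  obtain T where T: "T > 0" "\<And>x y. \<bar>\<rho> y - \<rho> x - grad \<rho> x (y - x)\<bar> \<le> T * (norm (y - x))\<^sup>2"
    using test_function_taylor[OF test] by metis
  have grad0: "grad \<rho> x h = 0" if "norm x > 1" for x h
    by (rule grad_eq_0_outside[OF support that]) simp
  let ?q = "sqrt (2 ^ ?d * measure lborel (ball (0::'a) 1))"
  \<comment> \<open>From \<open>r >= R / 2\<close>: the normalisation \<open>1 / r^d\<close> costs
    \<open>2^d\<close>, and each of at most two factors \<open>1 / r\<close> costs 2.\<close>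
  define N where "N = 4 * 2 ^ ?d * (B + L + T)"
  have q: "?q > 0" using content_ball_unit_pos[where 'a='a] by simp
  have N: "N > 0" using B(1) L(1) T(1) by (simp add: N_def)
  have "mollify_const \<rho> (N * ?q)"
    unfolding mollify_const_def
  proof (intro conjI allI ballI impI)
    show "N * ?q > 0" using N q by simp
    fix R r :: real and f :: "'a \<Rightarrow> real" and c :: real and v :: 'a
    assume R: "0 < R" and rR: "r \<in> {R/2..R}" and f: "test_function f"
    then have r: "r > 0" "r \<le> R" "R \<le> 2 * r" by auto
    have fi: "integrable lborel f" by (rule test_function_integrable[OF f])
    have sc: "test_function (scaled \<rho> r)" by (rule test_function_scaled[OF test r(1)])
    note meas = test_function_measurable[OF sc] test_function_measurable[OF test_function_grad[OF sc]]
    have rd: "1 / r ^ ?d \<le> 2 ^ ?d / R ^ ?d"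
      using power_mono[OF r(3), of ?d] R r by (simp add: field_simps)
    have inv: "1 / r \<le> 2 / R" using r R by (simp add: field_simps)
    have isc: "integrable lborel (\<lambda>w. scaled \<rho> r (v - w))" for v
      using integrable_lborel_affine[OF test_function_integrable[OF sc], of "-1" v] by simp
    have igr: "integrable lborel (\<lambda>w. grad (scaled \<rho> r) (v - w) h)" for v h
      using integrable_lborel_affine[OF test_function_integrable[OF test_function_grad[OF sc]], of "-1" v] by simp
    have zgr: "(\<integral>w. grad (scaled \<rho> r) (v - w) h \<partial>lborel) = 0" for v h
      using integral_reflect_shift[OF meas(2)] integral_grad_eq_0[OF sc] by simp
    have i1: "integrable lborel (\<lambda>w. scaled \<rho> r (v - w) * f w)" for v
      by (rule conv_integrable[OF sc fi])
    have i2: "integrable lborel (\<lambda>w. grad (scaled \<rho> r) (v - w) h * f w)" for v h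
      by (rule conv_integrable[OF test_function_grad[OF sc] fi])
    have m1 [measurable]: "(\<lambda>w. scaled \<rho> r (v - w)) \<in> borel_measurable borel" for v
      using borel_measurable_integrable[OF isc] by simp
    have m2 [measurable]: "(\<lambda>w. grad (scaled \<rho> r) (v - w) h) \<in> borel_measurable borel" for v h
      using borel_measurable_integrable[OF igr] by simp
    have mono: "N' * ?q * sqrt (osc R c f v) \<le> N'' * ?q * sqrt (osc R c f v)" if "N' \<le> N''" for N' N''
      using that R q by (intro mult_right_mono) (auto intro: order_less_imp_le)
    \<comment> \<open>The kernel has integral 1. For the gradient and the Taylor remainder below,
      the kernel has integral 0, so there \<open>c\<close> can be inserted without changing the
      integral.\<close>
    have "conv (scaled \<rho> r) f v - c = (LINT w|lborel. scaled \<rho> r (v - w) * (f w - c))"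
      using i1 isc r(1) by (simp add: conv_def right_diff_distrib integral_scaled_shift)
    moreover have "\<bar>scaled \<rho> r (v - w)\<bar> \<le> (2 ^ ?d * B) / R ^ ?d * indicator (ball v (2 * R)) w" for w
    proof (cases "w \<in> ball v (2 * R)")
      case False
      then have "norm (v - w) \<ge> r" using r by (simp add: dist_norm)
      then show ?thesis using scaled_support[OF r(1)] R B(1) by simp
    next
      case True
      have "\<bar>scaled \<rho> r (v - w)\<bar> = (1 / r ^ ?d) * \<bar>\<rho> ((1 / r) *\<^sub>R (v - w))\<bar>"
        using r(1) by (simp add: scaled_def abs_mult)
      also have "\<dots> \<le> (2 ^ ?d / R ^ ?d) * B"
        by (intro mult_mono rd B) (use R B in auto)
      finally show ?thesis using True by simp
    qed
    ultimately have "\<bar>conv (scaled \<rho> r) f v - c\<bar> \<le> (2 ^ ?d * B) * ?q * sqrt (osc R c f v)"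
      using integral_kernel_le_osc[OF f R m1, of "2 ^ ?d * B" v v c] B(1) by simp
    also have "\<dots> \<le> N * ?q * sqrt (osc R c f v)"
      by (rule mono) (use B(1) L(1) T(1) in \<open>auto simp: N_def\<close>)
    finally show "\<bar>conv (scaled \<rho> r) f v - c\<bar> \<le> N * ?q * sqrt (osc R c f v)" .

    have gr: "\<bar>grad (scaled \<rho> r) (v - w) h\<bar>
      \<le> (2 ^ ?d * (2 * L) * (norm h / R)) / R ^ ?d * indicator (ball v (2 * R)) w" for w h
    proof (cases "w \<in> ball v (2 * R)")
      case False
      then have "norm (v - w) > r" using r by (simp add: dist_norm)
      then have "norm ((1 / r) *\<^sub>R (v - w)) > 1" using r(1) by (simp only: norm_scaleR) (simp add: field_simps)
      then show ?thesis using False by (simp add: grad_scaled[OF test] grad0)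
    next
      case True
      have "\<bar>grad (scaled \<rho> r) (v - w) h\<bar>
          = (1 / r ^ ?d) * \<bar>grad \<rho> ((1 / r) *\<^sub>R (v - w)) ((1 / r) *\<^sub>R h)\<bar>"
        using r(1) by (simp add: grad_scaled[OF test] abs_mult)
      also have "\<dots> \<le> (2 ^ ?d / R ^ ?d) * (L * ((2 / R) * norm h))"
      proof (intro mult_mono rd order_trans[OF L(2)])
        show "norm ((1 / r) *\<^sub>R h) \<le> 2 / R * norm h"
          using mult_right_mono[OF inv norm_ge_zero[of h]] r(1) by simp
      qed (use R L in auto)
      finally show ?thesis using True by (simp add: field_simps)
    qed
    show "\<bar>grad (conv (scaled \<rho> r) f) v h\<bar> \<le> N * ?q * (norm h / R) * sqrt (osc R c f v)" for h
    proof -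
      have "grad (conv (scaled \<rho> r) f) v h = (LINT w|lborel. grad (scaled \<rho> r) (v - w) h * (f w - c))"
        unfolding grad_conv[OF sc fi] using i2 igr zgr by (simp add: conv_def right_diff_distrib)
      then have "\<bar>grad (conv (scaled \<rho> r) f) v h\<bar>
          \<le> (2 ^ ?d * (2 * L) * (norm h / R)) * ?q * sqrt (osc R c f v)"
        using integral_kernel_le_osc[OF f R m2, of "2 ^ ?d * (2 * L) * (norm h / R)" v h v c] gr L(1) R by simp
      also have "\<dots> \<le> (N * (norm h / R)) * ?q * sqrt (osc R c f v)"
        by (rule mono, rule mult_right_mono) (use B(1) L(1) T(1) R in \<open>auto simp: N_def\<close>)
      finally show ?thesis by (simp add: mult_ac)
    qed
    show "\<bar>conv (scaled \<rho> r) f v' - conv (scaled \<rho> r) f v - grad (conv (scaled \<rho> r) f) v (v' - v)\<bar>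
        \<le> N * ?q * (norm (v' - v) / R)\<^sup>2 * sqrt (osc R c f v)" if v': "norm (v' - v) < R" for v'
    proof -
      let ?k = "\<lambda>w. scaled \<rho> r (v' - w) - scaled \<rho> r (v - w) - grad (scaled \<rho> r) (v - w) (v' - v)"
      have "\<bar>?k w\<bar> \<le> (2 ^ ?d * (4 * T) * (norm (v' - v) / R)\<^sup>2) / R ^ ?d * indicator (ball v (2 * R)) w" for w
      proof (cases "w \<in> ball v (2 * R)")
        \<comment> \<open>Since \<open>v'\<close> is within \<open>R\<close> of \<open>v\<close>,
          both translates of the kernel vanish at a point \<open>w\<close> at distance at least
          \<open>2 R\<close> from \<open>v\<close>; the gradient term vanishes by
          \<open>gr\<close>.\<close>
        case False
        then have "norm (v - w) \<ge> 2 * R" by (simp add: dist_norm)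
        moreover from this have "norm (v' - w) \<ge> r"
          using norm_triangle_ineq4[of "v' - w" "v' - v"] v' r by simp
        ultimately show ?thesis using False scaled_support[OF r(1)] gr[of w "v' - v"] r by simp
      next
        case True
        have lin: "(1 / r) *\<^sub>R (v' - w) - (1 / r) *\<^sub>R (v - w) = (1 / r) *\<^sub>R (v' - v)"
          by (simp add: algebra_simps)
        have "\<bar>?k w\<bar> = (1 / r ^ ?d) * \<bar>\<rho> ((1 / r) *\<^sub>R (v' - w)) - \<rho> ((1 / r) *\<^sub>R (v - w))
            - grad \<rho> ((1 / r) *\<^sub>R (v - w)) ((1 / r) *\<^sub>R (v' - w) - (1 / r) *\<^sub>R (v - w))\<bar>"
          unfolding lin using r(1)
          by (simp add: grad_scaled[OF test] scaled_def flip: abs_mult right_diff_distrib diff_divide_distrib)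
        also have "\<dots> \<le> (2 ^ ?d / R ^ ?d) * (T * ((2 / R) * norm (v' - v))\<^sup>2)"
        proof (intro mult_mono rd order_trans[OF T(2)] power_mono)
          show "norm ((1 / r) *\<^sub>R (v' - w) - (1 / r) *\<^sub>R (v - w)) \<le> 2 / R * norm (v' - v)"
            unfolding lin using mult_right_mono[OF inv norm_ge_zero[of "v' - v"]] r(1) by simp
        qed (use R T in auto)
        finally show ?thesis using True by (simp add: field_simps power2_eq_square)
      qed
      moreover have "conv (scaled \<rho> r) f v' - conv (scaled \<rho> r) f v - grad (conv (scaled \<rho> r) f) v (v' - v)
          = (LINT w|lborel. ?k w * (f w - c))"
        unfolding grad_conv[OF sc fi] using i1 i2 isc igr zgr r(1)
        by (simp add: conv_def right_diff_distrib left_diff_distrib integral_scaled_shift)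
      moreover have "?k \<in> borel_measurable borel" by measurable
      ultimately have "\<bar>conv (scaled \<rho> r) f v' - conv (scaled \<rho> r) f v - grad (conv (scaled \<rho> r) f) v (v' - v)\<bar>
          \<le> (2 ^ ?d * (4 * T) * (norm (v' - v) / R)\<^sup>2) * ?q * sqrt (osc R c f v)"
        using integral_kernel_le_osc[OF f R, of ?k "2 ^ ?d * (4 * T) * (norm (v' - v) / R)\<^sup>2" v c] T(1) R
        by simp
      also have "\<dots> \<le> (N * (norm (v' - v) / R)\<^sup>2) * ?q * sqrt (osc R c f v)"
        by (rule mono, rule mult_right_mono) (use B(1) L(1) T(1) R in \<open>auto simp: N_def\<close>)
      finally show ?thesis by (simp add: mult_ac)
    qed
  qed
  then show ?thesis by blast
qed

end

section \<open>Double integrals\<close>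

definition gap :: "'a::euclidean_space \<times> 'a \<Rightarrow> real" where
  "gap z = norm (fst z - snd z)"

lemma gap_measurable [measurable]: "gap \<in> borel_measurable borel"
  unfolding gap_def by (intro borel_measurable_continuous_onI continuous_intros)

lemma gap_Pair: "gap (v, v') = norm (v - v')"
  by (simp add: gap_def)

lemma gap_nonneg [simp]: "gap z \<ge> 0"
  by (simp add: gap_def)

lemma gap_swap [simp]: "gap (prod.swap z) = gap z"
  by (simp add: gap_def norm_minus_commute)

lemma measurable_fst_borel [measurable]: "fst \<in> borel_measurable borel"
  and measurable_snd_borel [measurable]: "snd \<in> borel_measurable borel"
  and measurable_swap_borel [measurable]: "prod.swap \<in> borel_measurable (borel :: ('a::euclidean_space \<times> 'a) measure)"
  by (auto intro!: borel_measurable_continuous_onI continuous_intros continuous_on_swap)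

lemma distr_lborel_swap:
  "distr lborel borel prod.swap = (lborel :: ('a::euclidean_space \<times> 'a) measure)"
proof -
  have "(\<lambda>(x, y). (y, x)) = (prod.swap :: 'a \<times> 'a \<Rightarrow> _)" by auto
  moreover have "distr lborel lborel (\<lambda>(x, y). (y, x)) = (lborel :: ('a \<times> 'a) measure)"
    using lborel_pair.distr_pair_swap[where 'a='a and 'b='a] by (simp add: lborel_prod)
  ultimately show ?thesis by (metis distr_cong sets_lborel)
qed

lemma nn_integral_swap:
  fixes f :: "'a::euclidean_space \<times> 'a \<Rightarrow> ennreal"
  assumes [measurable]: "f \<in> borel_measurable borel"
  shows "(\<integral>\<^sup>+z. f (prod.swap z) \<partial>lborel) = (\<integral>\<^sup>+z. f z \<partial>lborel)"
  by (subst (2) distr_lborel_swap[symmetric]) (simp add: nn_integral_distr)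

lemma integral_swap:
  fixes f :: "'a::euclidean_space \<times> 'a \<Rightarrow> real"
  assumes [measurable]: "f \<in> borel_measurable borel"
  shows "(\<integral>z. f (prod.swap z) \<partial>lborel) = (\<integral>z. f z \<partial>lborel)"
  by (subst (2) distr_lborel_swap[symmetric]) (simp add: integral_distr)

lemma nn_integral_Fubini:
  fixes f :: "'a::euclidean_space \<times> 'a \<Rightarrow> ennreal"
  assumes "f \<in> borel_measurable borel"
  shows "(\<integral>\<^sup>+z. f z \<partial>lborel) = (\<integral>\<^sup>+x. \<integral>\<^sup>+y. f (x, y) \<partial>lborel \<partial>lborel)"
proof -
  have "f \<in> borel_measurable (lborel \<Otimes>\<^sub>M lborel)" using assms by (simp add: lborel_prod)
  from lborel.nn_integral_fst[OF this] show ?thesis by (simp add: lborel_prod)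
qed

text \<open>One half of the Schur test. The row bound is assumed only almost everywhere, because
  that is all a Borel representative of the kernel provides.\<close>

lemma nn_integral_weight_fst:
  fixes W :: "'a::euclidean_space \<times> 'a \<Rightarrow> ennreal"
  assumes [measurable]: "W \<in> borel_measurable borel" "h \<in> borel_measurable borel"
    and "AE x in lborel. (\<integral>\<^sup>+y. W (x, y) \<partial>lborel) \<le> c"
  shows "(\<integral>\<^sup>+z. h (fst z) * W z \<partial>lborel) \<le> c * (\<integral>\<^sup>+x. h x \<partial>lborel)"
proof -
  have [measurable]: "(\<lambda>y. W (x, y)) \<in> borel_measurable borel" for x
    by measurable
  have "(\<integral>\<^sup>+z. h (fst z) * W z \<partial>lborel) = (\<integral>\<^sup>+x. \<integral>\<^sup>+y. h x * W (x, y) \<partial>lborel \<partial>lborel)"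
    by (subst nn_integral_Fubini) auto
  also have "\<dots> = (\<integral>\<^sup>+x. h x * (\<integral>\<^sup>+y. W (x, y) \<partial>lborel) \<partial>lborel)"
    by (simp add: nn_integral_cmult)
  also have "\<dots> \<le> (\<integral>\<^sup>+x. c * h x \<partial>lborel)"
    by (rule nn_integral_mono_AE) (use assms(3) in \<open>auto elim!: eventually_mono simp: mult.commute[of c] intro!: mult_left_mono\<close>)
  also have "\<dots> = c * (\<integral>\<^sup>+x. h x \<partial>lborel)" by (simp add: nn_integral_cmult)
  finally show ?thesis .
qed

lemma nn_integral_weight_snd:
  fixes W :: "'a::euclidean_space \<times> 'a \<Rightarrow> ennreal"
  assumes [measurable]: "W \<in> borel_measurable borel" "h \<in> borel_measurable borel"
    and "AE x in lborel. (\<integral>\<^sup>+y. W (y, x) \<partial>lborel) \<le> c"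
  shows "(\<integral>\<^sup>+z. h (snd z) * W z \<partial>lborel) \<le> c * (\<integral>\<^sup>+x. h x \<partial>lborel)"
proof -
  have "(\<integral>\<^sup>+z. h (snd z) * W z \<partial>lborel) = (\<integral>\<^sup>+z. h (fst z) * W (prod.swap z) \<partial>lborel)"
    by (subst nn_integral_swap[symmetric]) auto
  also have "\<dots> \<le> c * (\<integral>\<^sup>+x. h x \<partial>lborel)"
    by (rule nn_integral_weight_fst[where W = "\<lambda>z. W (prod.swap z)"]) (use assms(3) in auto)
  finally show ?thesis .
qed

section \<open>Dyadic decomposition with respect to the distance of the two points\<close>

lemma nn_integral_cover_le:
  fixes W :: "'b \<Rightarrow> ennreal" and A :: "nat \<Rightarrow> real set"
  assumes [measurable]: "W \<in> borel_measurable M" "\<And>j. A j \<in> sets borel" "\<delta> \<in> borel_measurable M"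
    and cover: "S \<subseteq> (\<Union>j. A j)"
    and bound: "\<And>N. (\<Sum>j<N. \<integral>\<^sup>+x. indicator (A j) (\<delta> x :: real) * W x \<partial>M) \<le> B"
  shows "(\<integral>\<^sup>+x. indicator S (\<delta> x) * W x \<partial>M) \<le> B"
proof -
  have "indicator S t * w \<le> (\<Sum>j. indicator (A j) t * w)" for t and w :: ennreal
  proof (cases "t \<in> S")
    case True
    then obtain j where j: "t \<in> A j" using cover by auto
    have "w \<le> (\<Sum>i\<in>{j}. indicator (A i) t * w)" using j by simp
    also have "\<dots> \<le> (\<Sum>j. indicator (A j) t * w)"
      by (rule sum_le_suminf) auto
    finally show ?thesis using True by simp
  qed simp
  then have "(\<integral>\<^sup>+x. indicator S (\<delta> x) * W x \<partial>M) \<le> (\<integral>\<^sup>+x. (\<Sum>j. indicator (A j) (\<delta> x) * W x) \<partial>M)"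
    by (intro nn_integral_mono)
  also have "\<dots> = (\<Sum>j. \<integral>\<^sup>+x. indicator (A j) (\<delta> x) * W x \<partial>M)"
    by (intro nn_integral_suminf) measurable
  also have "\<dots> \<le> B"
    by (intro suminf_le_const bound) auto
  finally show ?thesis .
qed

lemma nn_integral_cover_geometric:
  fixes W :: "'b \<Rightarrow> ennreal" and A :: "nat \<Rightarrow> real set"
  assumes [measurable]: "W \<in> borel_measurable M" "\<And>j. A j \<in> sets borel" "\<delta> \<in> borel_measurable M"
    and cover: "S \<subseteq> (\<Union>j. A j)"
    and bound: "\<And>j. (\<integral>\<^sup>+x. indicator (A j) (\<delta> x :: real) * W x \<partial>M) \<le> ennreal (c * q ^ j)"
    and c: "c \<ge> 0" and q: "0 \<le> q" "q < 1"
  shows "(\<integral>\<^sup>+x. indicator S (\<delta> x) * W x \<partial>M) \<le> ennreal (c / (1 - q))"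
proof (rule nn_integral_cover_le[OF assms(1-4)])
  fix N
  have "(\<Sum>j<N. \<integral>\<^sup>+x. indicator (A j) (\<delta> x) * W x \<partial>M) \<le> (\<Sum>j<N. ennreal (c * q ^ j))"
    by (intro sum_mono bound)
  also have "\<dots> = ennreal (\<Sum>j<N. c * q ^ j)"
    using c q by (intro sum_ennreal) auto
  also have "\<dots> \<le> ennreal (c / (1 - q))"
  proof (rule ennreal_leI)
    have "(\<Sum>j<N. c * q ^ j) = c * ((1 - q ^ N) / (1 - q))"
      using q by (simp add: sum_distrib_left[symmetric] sum_gp_strict)
    also have "\<dots> \<le> c * (1 / (1 - q))"
      using c q by (intro mult_left_mono divide_right_mono) auto
    finally show "(\<Sum>j<N. c * q ^ j) \<le> c / (1 - q)" by simp
  qed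
  finally show "(\<Sum>j<N. \<integral>\<^sup>+x. indicator (A j) (\<delta> x) * W x \<partial>M) \<le> ennreal (c / (1 - q))" .
qed

lemma dyadic_cover_inside:
  "{0<..<R::real} \<subseteq> (\<Union>j::nat. {R / 2 ^ Suc j..<R / 2 ^ j})"
proof
  fix x assume x: "x \<in> {0<..<R}"
  obtain n :: nat where "R / x < 2 ^ n" using real_arch_pow[of 2 "R / x"] by auto
  then have ex: "R / 2 ^ n \<le> x" using x by (simp add: field_simps)
  define j where "j = (LEAST n. R / 2 ^ n \<le> x)"
  have j: "R / 2 ^ j \<le> x" unfolding j_def by (rule LeastI[of "\<lambda>n. R / 2 ^ n \<le> x", OF ex])
  with x have "j \<noteq> 0" by (intro notI) auto
  then obtain i where i: "j = Suc i" by (cases j) auto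
  have "\<not> R / 2 ^ i \<le> x" using not_less_Least[of i "\<lambda>n. R / 2 ^ n \<le> x"] i j_def by auto
  then show "x \<in> (\<Union>j::nat. {R / 2 ^ Suc j..<R / 2 ^ j})" using j i by auto
qed

lemma dyadic_cover_outside:
  assumes "(R::real) > 0"
  shows "{R..} \<subseteq> (\<Union>j::nat. {R * 2 ^ j..<R * 2 ^ Suc j})"
proof
  fix x assume x: "x \<in> {R..}"
  obtain n :: nat where "x / R < 2 ^ n" using real_arch_pow[of 2 "x / R"] by auto
  then have ex: "x < R * 2 ^ n" using assms by (simp add: field_simps)
  define j where "j = (LEAST n. x < R * 2 ^ n)"
  have j: "x < R * 2 ^ j" unfolding j_def by (rule LeastI[of "\<lambda>n. x < R * 2 ^ n", OF ex])
  with x have "j \<noteq> 0" by (intro notI) auto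
  then obtain i where i: "j = Suc i" by (cases j) auto
  have "\<not> x < R * 2 ^ i" using not_less_Least[of i "\<lambda>n. x < R * 2 ^ n"] i j_def by auto
  then show "x \<in> (\<Union>j::nat. {R * 2 ^ j..<R * 2 ^ Suc j})" using j i by (auto intro!: exI[of _ i])
qed

section \<open>Kernels with a tail bound\<close>

text \<open>Unlike \<open>tail_bound\<close>, this holds for almost every \<open>v\<close>, with a
  null set that may depend on \<open>R\<close>, and is therefore stable under changing the kernel on
  a null set of pairs.\<close>

definition ktail :: "real \<Rightarrow> real \<Rightarrow> ('a::euclidean_space \<times> 'a \<Rightarrow> real) \<Rightarrow> bool" where
  "ktail s L k \<longleftrightarrow> (\<forall>R>0. AE v in lborel.
     (\<integral>\<^sup>+v'. indicator {R..} (gap (v, v')) * ennreal \<bar>k (v, v')\<bar> \<partial>lborel) \<le> ennreal (L * R powr (- 2 * s)))"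

text \<open>Sum over the annuli \<open>R / 2^(j+1) <= |v - v'| < R / 2^j\<close>: each contributes
  at most \<open>(R / 2^j)^p\<close> times the tail \<open>L (R / 2^(j+1))^(-2s)\<close>, which is
  \<open>L R^(p-2s) 2^(2s)\<close> times the \<open>j\<close>-th power of
  \<open>2^(2s-p)\<close>.\<close>

definition moment_const :: "real \<Rightarrow> real \<Rightarrow> real" where
  "moment_const s p = 2 powr (2 * s) / (1 - 2 powr (2 * s - p))"

lemma moment_const_pos: "p > 2 * s \<Longrightarrow> moment_const s p > 0"
  by (auto simp: moment_const_def intro!: divide_pos_pos) (metis powr_less_one diff_less_0_iff_less one_less_numeral_iff semiring_norm(76))

lemma ktail_moment:
  fixes k :: "'a::euclidean_space \<times> 'a \<Rightarrow> real"
  assumes [measurable]: "k \<in> borel_measurable borel" and tail: "ktail s L k"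
    and L: "L \<ge> 0" and R: "R > 0" and p: "p > 2 * s" "p > 0"
  shows "AE v in lborel. (\<integral>\<^sup>+v'. indicator {0<..<R} (gap (v, v')) *
     (ennreal (gap (v, v') powr p) * ennreal \<bar>k (v, v')\<bar>) \<partial>lborel)
    \<le> ennreal (moment_const s p * L * R powr (p - 2 * s))"
proof -
  \<comment> \<open>The exceptional set of the tail bound depends on the radius; only countably many
    radii occur, so their null sets are united.\<close>
  have "AE v in lborel. \<forall>j::nat. (\<integral>\<^sup>+v'. indicator {R / 2 ^ Suc j..} (gap (v, v')) * ennreal \<bar>k (v, v')\<bar> \<partial>lborel)
      \<le> ennreal (L * (R / 2 ^ Suc j) powr (- 2 * s))"
    using tail R unfolding ktail_def AE_all_countable by simp
  then show ?thesis
  proof (rule eventually_mono)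
    fix v :: 'a
    assume *: "\<forall>j::nat. (\<integral>\<^sup>+v'. indicator {R / 2 ^ Suc j..} (gap (v, v')) * ennreal \<bar>k (v, v')\<bar> \<partial>lborel)
      \<le> ennreal (L * (R / 2 ^ Suc j) powr (- 2 * s))"
    let ?c = "L * R powr (p - 2 * s) * 2 powr (2 * s)" and ?q = "2 powr (2 * s - p) :: real"
    have "(\<integral>\<^sup>+v'. indicator {0<..<R} (gap (v, v')) *
        (ennreal (gap (v, v') powr p) * ennreal \<bar>k (v, v')\<bar>) \<partial>lborel) \<le> ennreal (?c / (1 - ?q))"
    proof (rule nn_integral_cover_geometric[where A = "\<lambda>j. {R / 2 ^ Suc j..<R / 2 ^ j}"])
      show "{0<..<R} \<subseteq> (\<Union>j. {R / 2 ^ Suc j..<R / 2 ^ j})" by (rule dyadic_cover_inside)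
      show "?q < 1" using p by (intro powr_less_one) auto
      fix j :: nat
      have "(\<integral>\<^sup>+v'. indicator {R / 2 ^ Suc j..<R / 2 ^ j} (gap (v, v')) *
          (ennreal (gap (v, v') powr p) * ennreal \<bar>k (v, v')\<bar>) \<partial>lborel)
        \<le> (\<integral>\<^sup>+v'. ennreal ((R / 2 ^ j) powr p) *
            (indicator {R / 2 ^ Suc j..} (gap (v, v')) * ennreal \<bar>k (v, v')\<bar>) \<partial>lborel)"
        using p by (intro nn_integral_mono) (auto simp: indicator_def intro!: mult_right_mono ennreal_leI powr_mono2)
      also have "\<dots> \<le> ennreal ((R / 2 ^ j) powr p) * ennreal (L * (R / 2 ^ Suc j) powr (- 2 * s))"
        by (subst nn_integral_cmult) (use * in \<open>auto intro!: mult_left_mono\<close>)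
      also have "\<dots> = ennreal (?c * ?q ^ j)"
      proof -
        have q: "?q ^ j = 2 powr ((2 * s - p) * j)"
          by (simp add: powr_powr flip: powr_realpow)
        have "(R / 2 ^ j) powr p * (L * (R / 2 ^ Suc j) powr (- 2 * s)) = ?c * ?q ^ j"
          unfolding q using R
          by (simp add: powr_divide powr_powr powr_mult powr_minus powr_diff powr_add field_simps flip: powr_realpow)
        then show ?thesis using L by (simp flip: ennreal_mult')
      qed
      finally show "(\<integral>\<^sup>+v'. indicator {R / 2 ^ Suc j..<R / 2 ^ j} (gap (v, v')) *
          (ennreal (gap (v, v') powr p) * ennreal \<bar>k (v, v')\<bar>) \<partial>lborel) \<le> ennreal (?c * ?q ^ j)" .
    qed (use L in auto)
    then show "(\<integral>\<^sup>+v'. indicator {0<..<R} (gap (v, v')) *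
        (ennreal (gap (v, v') powr p) * ennreal \<bar>k (v, v')\<bar>) \<partial>lborel)
        \<le> ennreal (moment_const s p * L * R powr (p - 2 * s))"
      by (simp add: moment_const_def mult_ac)
  qed
qed

text \<open>On the diagonal \<open>0 powr\<close> anything is 0, in agreement with division by zero
  in \<open>gagliardo_integrand\<close>.\<close>

definition gkernel :: "real \<Rightarrow> 'a::euclidean_space \<times> 'a \<Rightarrow> real" where
  "gkernel s z = gap z powr (- (real DIM('a) + 2 * s))"

lemma gkernel_measurable [measurable]: "gkernel s \<in> borel_measurable borel"
  unfolding gkernel_def[abs_def] by measurable

lemma gkernel_nonneg [simp]: "gkernel s z \<ge> 0"
  by (simp add: gkernel_def)

lemma gkernel_swap [simp]: "gkernel s (prod.swap z) = gkernel s z"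
  by (simp add: gkernel_def)

text \<open>Sum over the shells \<open>R 2^j <= |v - v'| < R 2^(j+1)\<close>: the ball of radius
  \<open>R 2^(j+1)\<close> has volume \<open>2^d (R 2^j)^d |B_1|\<close>, and the kernel is at most
  \<open>(R 2^j)^(-d-2s)\<close> there. Thus the Gagliardo kernel satisfies a tail bound itself, and
  the lemmas for \<open>K\<close> also give the finiteness of the norm.\<close>

definition gtail_const :: "'a::euclidean_space itself \<Rightarrow> real \<Rightarrow> real" where
  "gtail_const _ s = 2 ^ DIM('a) * measure lborel (ball (0::'a) 1) / (1 - 2 powr (- 2 * s))"

lemma gtail_const_pos: "s > 0 \<Longrightarrow> gtail_const TYPE('a::euclidean_space) s > 0"
  using content_ball_unit_pos[where 'a='a] powr_less_one[of 2 "- 2 * s"]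
  by (auto simp: gtail_const_def intro!: divide_pos_pos)

lemma ktail_gkernel:
  assumes s: "s > 0"
  shows "ktail s (gtail_const TYPE('a::euclidean_space) s) (gkernel s :: 'a \<times> 'a \<Rightarrow> real)"
  unfolding ktail_def
proof (intro allI impI AE_I2)
  fix R :: real and v :: 'a assume R: "R > 0"
  let ?M = "measure lborel (ball (0::'a) 1)" and ?d = "DIM('a)"
  let ?c = "2 ^ ?d * ?M * R powr (- 2 * s)" and ?q = "2 powr (- 2 * s) :: real"
  have "(\<integral>\<^sup>+v'. indicator {R..} (gap (v, v')) * ennreal \<bar>gkernel s (v, v')\<bar> \<partial>lborel) \<le> ennreal (?c / (1 - ?q))"
  proof (rule nn_integral_cover_geometric[where A = "\<lambda>j. {R * 2 ^ j..<R * 2 ^ Suc j}"])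
    show "{R..} \<subseteq> (\<Union>j. {R * 2 ^ j..<R * 2 ^ Suc j})" by (rule dyadic_cover_outside[OF R])
    show "?q < 1" using s by (intro powr_less_one) auto
    fix j :: nat
    let ?e = "(R * 2 ^ j) powr (- (real ?d + 2 * s))"
    have "(\<integral>\<^sup>+v'. indicator {R * 2 ^ j..<R * 2 ^ Suc j} (gap (v, v')) * ennreal \<bar>gkernel s (v, v')\<bar> \<partial>lborel)
      \<le> (\<integral>\<^sup>+v'. ennreal ?e * indicator (ball v (R * 2 ^ Suc j)) v' \<partial>lborel)"
      using R s by (intro nn_integral_mono)
        (auto simp: indicator_def gkernel_def gap_def dist_norm intro!: ennreal_leI powr_mono2')
    also have "\<dots> = ennreal ?e * ennreal ((R * 2 ^ Suc j) ^ ?d * ?M)"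
      using R by (subst nn_integral_cmult) (auto simp: nn_integral_ball_indicator simp del: nn_integral_indicator intro!: borel_measurable_indicator)
    also have "\<dots> = ennreal (?c * ?q ^ j)"
    proof -
      have q: "?q ^ j = 2 powr (- 2 * s * j)" by (simp add: powr_powr flip: powr_realpow)
      have "?e * (R * 2 ^ j) ^ ?d = (R * 2 ^ j) powr (- 2 * s)"
        using R by (simp add: powr_add[symmetric] flip: powr_realpow)
      also have "\<dots> = R powr (- 2 * s) * ?q ^ j"
        unfolding q using R by (simp add: powr_mult powr_powr mult_ac flip: powr_realpow)
      finally have "?e * ((R * 2 ^ Suc j) ^ ?d * ?M) = ?c * ?q ^ j"
        by (simp add: power_mult_distrib mult_ac)
      then show ?thesis by (metis ennreal_mult' powr_ge_zero)
    qed
    finally show "(\<integral>\<^sup>+v'. indicator {R * 2 ^ j..<R * 2 ^ Suc j} (gap (v, v')) * ennreal \<bar>gkernel s (v, v')\<bar> \<partial>lborel)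
      \<le> ennreal (?c * ?q ^ j)" .
  qed (use content_ball_unit_pos[where 'a='a] in auto)
  then show "(\<integral>\<^sup>+v'. indicator {R..} (gap (v, v')) * ennreal \<bar>gkernel s (v, v')\<bar> \<partial>lborel)
      \<le> ennreal (gtail_const TYPE('a) s * R powr (- 2 * s))"
    by (simp add: gtail_const_def mult_ac)
qed

text \<open>Both halves of the Schur test: the tail bound integrates out the second variable, the
  swapped one the first.\<close>

lemma ktail_far:
  fixes k :: "'a::euclidean_space \<times> 'a \<Rightarrow> real"
  assumes [measurable]: "k \<in> borel_measurable borel" "h \<in> borel_measurable borel"
    and tail: "ktail s L k" "ktail s L (\<lambda>z. k (prod.swap z))" and R: "R > 0" and L: "L \<ge> 0"
  shows "(\<integral>\<^sup>+z. h (fst z) * (indicator {R..} (gap z) * ennreal \<bar>k z\<bar>) \<partial>lborel)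
      \<le> ennreal (L * R powr (- 2 * s)) * (\<integral>\<^sup>+v. h v \<partial>lborel)"
    and "(\<integral>\<^sup>+z. h (snd z) * (indicator {R..} (gap z) * ennreal \<bar>k z\<bar>) \<partial>lborel)
      \<le> ennreal (L * R powr (- 2 * s)) * (\<integral>\<^sup>+v. h v \<partial>lborel)"
proof -
  have 1: "AE v in lborel. (\<integral>\<^sup>+v'. indicator {R..} (gap (v, v')) * ennreal \<bar>k (v, v')\<bar> \<partial>lborel)
      \<le> ennreal (L * R powr (- 2 * s))"
    using tail(1) R unfolding ktail_def by simp
  have 2: "AE v in lborel. (\<integral>\<^sup>+v'. indicator {R..} (gap (v', v)) * ennreal \<bar>k (v', v)\<bar> \<partial>lborel)
      \<le> ennreal (L * R powr (- 2 * s))"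
    using tail(2) R unfolding ktail_def by (simp add: gap_def norm_minus_commute)
  show "(\<integral>\<^sup>+z. h (fst z) * (indicator {R..} (gap z) * ennreal \<bar>k z\<bar>) \<partial>lborel)
      \<le> ennreal (L * R powr (- 2 * s)) * (\<integral>\<^sup>+v. h v \<partial>lborel)"
    by (rule nn_integral_weight_fst) (use 1 in auto)
  show "(\<integral>\<^sup>+z. h (snd z) * (indicator {R..} (gap z) * ennreal \<bar>k z\<bar>) \<partial>lborel)
      \<le> ennreal (L * R powr (- 2 * s)) * (\<integral>\<^sup>+v. h v \<partial>lborel)"
    by (rule nn_integral_weight_snd) (use 2 in auto)
qed

lemma ktail_near:
  fixes k :: "'a::euclidean_space \<times> 'a \<Rightarrow> real"
  assumes [measurable]: "k \<in> borel_measurable borel" "h \<in> borel_measurable borel"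
    and tail: "ktail s L k" "ktail s L (\<lambda>z. k (prod.swap z))" and R: "R > 0" and L: "L \<ge> 0"
    and p: "p > 2 * s" "p > 0"
  shows "(\<integral>\<^sup>+z. h (fst z) * (indicator {0<..<R} (gap z) * (ennreal (gap z powr p) * ennreal \<bar>k z\<bar>)) \<partial>lborel)
      \<le> ennreal (moment_const s p * L * R powr (p - 2 * s)) * (\<integral>\<^sup>+v. h v \<partial>lborel)"
    and "(\<integral>\<^sup>+z. h (snd z) * (indicator {0<..<R} (gap z) * (ennreal (gap z powr p) * ennreal \<bar>k z\<bar>)) \<partial>lborel)
      \<le> ennreal (moment_const s p * L * R powr (p - 2 * s)) * (\<integral>\<^sup>+v. h v \<partial>lborel)"
proof -
  have [measurable]: "(\<lambda>z. k (prod.swap z)) \<in> borel_measurable borel" by measurable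
  have 1: "AE v in lborel. (\<integral>\<^sup>+v'. indicator {0<..<R} (gap (v, v')) * (ennreal (gap (v, v') powr p) * ennreal \<bar>k (v, v')\<bar>) \<partial>lborel)
      \<le> ennreal (moment_const s p * L * R powr (p - 2 * s))"
    by (rule ktail_moment) (use assms in auto)
  have 2: "AE v in lborel. (\<integral>\<^sup>+v'. indicator {0<..<R} (gap (v', v)) * (ennreal (gap (v', v) powr p) * ennreal \<bar>k (v', v)\<bar>) \<partial>lborel)
      \<le> ennreal (moment_const s p * L * R powr (p - 2 * s))"
    using ktail_moment[of "\<lambda>z. k (prod.swap z)" s L R p] assms by (simp add: gap_def norm_minus_commute)
  show "(\<integral>\<^sup>+z. h (fst z) * (indicator {0<..<R} (gap z) * (ennreal (gap z powr p) * ennreal \<bar>k z\<bar>)) \<partial>lborel)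
      \<le> ennreal (moment_const s p * L * R powr (p - 2 * s)) * (\<integral>\<^sup>+v. h v \<partial>lborel)"
    by (rule nn_integral_weight_fst) (use 1 in auto)
  show "(\<integral>\<^sup>+z. h (snd z) * (indicator {0<..<R} (gap z) * (ennreal (gap z powr p) * ennreal \<bar>k z\<bar>)) \<partial>lborel)
      \<le> ennreal (moment_const s p * L * R powr (p - 2 * s)) * (\<integral>\<^sup>+v. h v \<partial>lborel)"
    by (rule nn_integral_weight_snd) (use 2 in auto)
qed

section \<open>The Sobolev--Slobodeckij norm\<close>

definition sqdiff :: "('a::euclidean_space \<Rightarrow> real) \<Rightarrow> 'a \<times> 'a \<Rightarrow> real" where
  "sqdiff f z = (f (snd z) - f (fst z))\<^sup>2"

lemma sqdiff_nonneg [simp]: "sqdiff f z \<ge> 0"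
  by (simp add: sqdiff_def)

lemma sqdiff_measurable [measurable (raw)]:
  assumes [measurable]: "f \<in> borel_measurable borel"
  shows "sqdiff f \<in> borel_measurable borel"
  unfolding sqdiff_def[abs_def] by measurable

lemma sqdiff_le: "sqdiff f z \<le> 2 * (f (fst z))\<^sup>2 + 2 * (f (snd z))\<^sup>2"
  using zero_le_power2[of "f (snd z) + f (fst z)"] by (simp add: sqdiff_def power2_eq_square algebra_simps)

lemma sqdiff_eq_0: "gap z = 0 \<Longrightarrow> sqdiff f z = 0"
  by (simp add: gap_def sqdiff_def)

definition gag :: "real \<Rightarrow> ('a::euclidean_space \<Rightarrow> real) \<Rightarrow> real" where
  "gag s f = (LINT z|lborel. sqdiff f z * gkernel s z)"

definition l2sq :: "('a::euclidean_space \<Rightarrow> real) \<Rightarrow> real" where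
  "l2sq f = (LINT v|lborel. (f v)\<^sup>2)"

definition hs2 :: "real \<Rightarrow> ('a::euclidean_space \<Rightarrow> real) \<Rightarrow> real" where
  "hs2 s f = l2sq f + gag s f"

definition borel_Hs :: "real \<Rightarrow> ('a::euclidean_space \<Rightarrow> real) \<Rightarrow> bool" where
  "borel_Hs s f \<longleftrightarrow> f \<in> borel_measurable borel \<and> integrable lborel (\<lambda>v. (f v)\<^sup>2) \<and>
     integrable lborel (\<lambda>z. sqdiff f z * gkernel s z)"

lemma gag_nonneg [simp]: "gag s f \<ge> 0"
  and l2sq_nonneg [simp]: "l2sq f \<ge> 0"
  and hs2_nonneg [simp]: "hs2 s f \<ge> 0"
  by (auto simp: gag_def l2sq_def hs2_def intro!: Bochner_Integration.integral_nonneg add_nonneg_nonneg)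

lemma nn_l2sq:
  assumes "integrable lborel (\<lambda>v. (f v)\<^sup>2)"
  shows "(\<integral>\<^sup>+v. ennreal ((f v)\<^sup>2) \<partial>lborel) = ennreal (l2sq f)"
  unfolding l2sq_def by (rule nn_integral_eq_integral[OF assms]) simp

lemma test_function_square_integrable:
  "test_function f \<Longrightarrow> integrable lborel (\<lambda>v. (f v)\<^sup>2)"
  using test_function_integrable[OF test_function_mult[of f f]] by (simp add: power2_eq_square)

text \<open>Near the diagonal the Lipschitz bound gives the square of the distance, a convergent
  moment since \<open>2 > 2 * s\<close>; away from it the increment is bounded by the two values and
  the kernel by its tail.\<close>

lemma borel_Hs_test:
  fixes f :: "'a::euclidean_space \<Rightarrow> real"
  assumes f: "test_function f" and s: "0 < s" "s < 1"
  shows "borel_Hs s f"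
proof -
  have [measurable]: "f \<in> borel_measurable borel" by (rule test_function_measurable[OF f])
  obtain A where A: "\<And>x. norm x > A \<Longrightarrow> f x = 0" using test_functionE[OF f] by metis
  obtain C where C: "C > 0" "\<And>x y. \<bar>f y - f x\<bar> \<le> C * norm (y - x)" using test_function_Lipschitz[OF f] by metis
  have i2: "integrable lborel (\<lambda>v. (f v)\<^sup>2)" by (rule test_function_square_integrable[OF f])
  let ?i = "indicator (cball 0 A) :: 'a \<Rightarrow> ennreal"
  have [measurable]: "?i \<in> borel_measurable borel" by (intro borel_measurable_indicator) auto
  let ?L = "gtail_const TYPE('a) s"
  have L: "?L \<ge> 0" using gtail_const_pos[OF s(1), where 'a='a] by simp
  have t: "ktail s ?L (gkernel s :: 'a \<times> 'a \<Rightarrow> real)" "ktail s ?L (\<lambda>z::'a \<times> 'a. gkernel s (prod.swap z))"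
    using ktail_gkernel[OF s(1)] by simp_all
  let ?n = "\<lambda>z::'a \<times> 'a. indicator {0<..<1} (gap z) * (ennreal (gap z powr 2) * ennreal \<bar>gkernel s z\<bar>) :: ennreal"
  let ?f = "\<lambda>z::'a \<times> 'a. indicator {1..} (gap z) * ennreal \<bar>gkernel s z\<bar> :: ennreal"
  let ?h = "\<lambda>v. ennreal (2 * (f v)\<^sup>2)"
  have le: "ennreal (norm (sqdiff f z * gkernel s z)) \<le>
     ennreal (C\<^sup>2) * (?i (fst z) * ?n z + ?i (snd z) * ?n z) + (?h (fst z) * ?f z + ?h (snd z) * ?f z)" for z
  proof -
    consider "gap z = 0" | "gap z \<ge> 1" | "0 < gap z" "gap z < 1" using gap_nonneg[of z] by linarith
    then show ?thesis
    proof cases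
      case 1 then show ?thesis by (simp add: sqdiff_eq_0)
    next
      case 2
      have "ennreal (norm (sqdiff f z * gkernel s z)) \<le> ennreal (2 * (f (fst z))\<^sup>2 + 2 * (f (snd z))\<^sup>2) * ennreal (gkernel s z)"
        using sqdiff_le[of f z] by (subst ennreal_mult[symmetric]) (auto intro!: ennreal_leI mult_right_mono)
      then show ?thesis using 2 by (simp add: distrib_right)
    next
      case 3
      show ?thesis
      \<comment> \<open>The Lipschitz bound alone is not integrable at infinity. The integrand
        vanishes unless one of the two points lies in the support ball, and the indicator of that
        ball is the integrable weight.\<close>
      proof (cases "norm (fst z) > A \<and> norm (snd z) > A")
        case True then show ?thesis using A by (simp add: sqdiff_def)
      next
        case False
        have "sqdiff f z \<le> (C * gap z)\<^sup>2"
          unfolding sqdiff_def gap_def using C(2)[of "snd z" "fst z"]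
          by (subst abs_le_square_iff[symmetric]) (auto simp: norm_minus_commute)
        then have "ennreal (norm (sqdiff f z * gkernel s z)) \<le> ennreal (C\<^sup>2) * ?n z"
          using 3 by (auto simp: power_mult_distrib mult.assoc[symmetric] simp flip: ennreal_mult intro!: ennreal_leI mult_right_mono)
        also have "\<dots> \<le> ennreal (C\<^sup>2) * (?i (fst z) * ?n z + ?i (snd z) * ?n z)"
          using False by (intro mult_left_mono) (auto simp: indicator_def)
        also have "\<dots> \<le> \<dots> + (?h (fst z) * ?f z + ?h (snd z) * ?f z)" by simp
        finally show ?thesis .
      qed
    qed
  qed
  have fin: "(\<integral>\<^sup>+v. ?i v \<partial>lborel) < \<infinity>" "(\<integral>\<^sup>+v. ?h v \<partial>lborel) < \<infinity>"
    using emeasure_lborel_cball_finite[of "0::'a" A] nn_integral_eq_integral[OF integrable_mult_right[OF i2, of 2]]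
    by auto
  have "(\<integral>\<^sup>+z. ennreal (norm (sqdiff f z * gkernel s z)) \<partial>lborel) \<le>
    ennreal (C\<^sup>2) * ((\<integral>\<^sup>+z. ?i (fst z) * ?n z \<partial>lborel) + (\<integral>\<^sup>+z. ?i (snd z) * ?n z \<partial>lborel))
     + ((\<integral>\<^sup>+z. ?h (fst z) * ?f z \<partial>lborel) + (\<integral>\<^sup>+z. ?h (snd z) * ?f z \<partial>lborel))"
    by (rule order_trans[OF nn_integral_mono[OF le]]) (simp add: nn_integral_add nn_integral_cmult)
  also have "\<dots> < \<infinity>"
    using ktail_near[OF _ _ t _ L, of ?i 1 2] ktail_far[OF _ _ t _ L, of ?h 1] s fin
    by (auto simp: ennreal_mult_less_top elim!: le_less_trans)
  finally have "integrable lborel (\<lambda>z. sqdiff f z * gkernel s z)"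
    by (intro integrableI_bounded) auto
  then show ?thesis using i2 by (simp add: borel_Hs_def)
qed

section \<open>The dyadic square function and the part of the form without cancellation\<close>

definition oscint :: "real \<Rightarrow> ('a::euclidean_space \<Rightarrow> real) \<Rightarrow> real" where
  "oscint R f = (LINT z|lborel. indicator {..<2 * R} (gap z) * sqdiff f z) / R ^ DIM('a)"

lemma ennreal_weight_le:
  fixes k x a b :: real
  assumes "x \<le> a + b" "0 \<le> a" "0 \<le> b"
  shows "ennreal (\<bar>k\<bar> * x) \<le> (ennreal a + ennreal b) * ennreal \<bar>k\<bar>"
proof -
  have "ennreal (\<bar>k\<bar> * x) \<le> ennreal ((a + b) * \<bar>k\<bar>)"
    using mult_right_mono[OF assms(1) abs_ge_zero[of k]] by (intro ennreal_leI) (simp add: mult.commute)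
  also have "\<dots> = (ennreal a + ennreal b) * ennreal \<bar>k\<bar>"
    using assms by (simp add: ennreal_mult)
  finally show ?thesis .
qed

lemma indicator_ball_eq: "indicator (ball v r) w = (indicator {..<r} (norm (v - w)) :: 'b::zero_neq_one)"
  by (auto simp: indicator_def dist_norm)

lemma osc_measurable [measurable (raw)]:
  assumes [measurable]: "f \<in> borel_measurable borel" "c \<in> borel_measurable borel"
  shows "(\<lambda>v. osc R (c v) f v) \<in> borel_measurable borel"
  unfolding osc_def indicator_ball_eq by measurable

text \<open>Within distance \<open>r\<close> the Gagliardo kernel is at least
  \<open>r^(-d-2s)\<close>, so it dominates the constant weight.\<close>

lemma integrable_near_sqdiff:
  assumes f: "borel_Hs s f" and s: "s > 0"
  shows "integrable lborel (\<lambda>z. indicator {..<r} (gap z) * sqdiff f z)"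
proof -
  have [measurable]: "f \<in> borel_measurable borel" using f by (simp add: borel_Hs_def)
  have "integrable lborel (\<lambda>z. r powr (real DIM('a) + 2 * s) * (sqdiff f z * gkernel s z))"
    using f by (intro integrable_mult_right) (simp add: borel_Hs_def)
  then show ?thesis
  proof (rule Bochner_Integration.integrable_bound)
    have "indicator {..<r} (gap z) * sqdiff f z \<le> r powr (real DIM('a) + 2 * s) * (sqdiff f z * gkernel s z)" for z
    proof (cases "0 < gap z \<and> gap z < r")
      case True
      then have "gap z powr (real DIM('a) + 2 * s) \<le> r powr (real DIM('a) + 2 * s)"
        using s by (intro powr_mono2) auto
      then have "1 \<le> r powr (real DIM('a) + 2 * s) * gkernel s z"
        unfolding gkernel_def powr_minus using True by (simp add: field_simps)
      from mult_left_mono[OF this sqdiff_nonneg[of f z]] show ?thesis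
        using True by (simp add: mult_ac)
    next
      case False
      then have "gap z = 0 \<or> gap z \<ge> r" using gap_nonneg[of z] by linarith
      then show ?thesis by (auto simp: sqdiff_eq_0)
    qed
    then show "AE z in lborel. norm (indicator {..<r} (gap z) * sqdiff f z)
        \<le> norm (r powr (real DIM('a) + 2 * s) * (sqdiff f z * gkernel s z))"
      by (auto simp: abs_mult)
  qed measurable
qed

lemma nn_integral_osc:
  fixes f :: "'a::euclidean_space \<Rightarrow> real" and s :: real
  assumes f: "test_function f" and s: "0 < s" "s < 1" and R: "R > 0"
  shows "(\<integral>\<^sup>+v. ennreal (osc R (f v) f v) \<partial>lborel) = ennreal (oscint R f)"
proof -
  let ?d = "DIM('a)"
  have [measurable]: "f \<in> borel_measurable borel" by (rule test_function_measurable[OF f])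
  have "(\<integral>\<^sup>+v. ennreal (osc R (f v) f v) \<partial>lborel)
    = (\<integral>\<^sup>+v. \<integral>\<^sup>+w. ennreal (indicator {..<2 * R} (gap (v, w)) * sqdiff f (v, w) / R ^ ?d) \<partial>lborel \<partial>lborel)"
  proof (intro nn_integral_cong)
    fix v
    have i: "integrable lborel (\<lambda>w. indicator {..<2 * R} (gap (v, w)) * sqdiff f (v, w))"
      using integrable_osc_integrand[OF f, of v "2 * R" "f v"]
      by (simp add: indicator_ball_eq gap_Pair sqdiff_def)
    show "ennreal (osc R (f v) f v) = (\<integral>\<^sup>+w. ennreal (indicator {..<2 * R} (gap (v, w)) * sqdiff f (v, w) / R ^ ?d) \<partial>lborel)"
      using R by (subst nn_integral_eq_integral) (use i in \<open>auto simp: osc_def indicator_ball_eq gap_Pair sqdiff_def\<close>)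
  qed
  also have "\<dots> = (\<integral>\<^sup>+z. ennreal (indicator {..<2 * R} (gap z) * sqdiff f z / R ^ ?d) \<partial>lborel)"
    by (subst nn_integral_Fubini) auto
  also have "\<dots> = ennreal (oscint R f)"
    using R integrable_near_sqdiff[OF borel_Hs_test[OF f s] s(1), of "2 * R"]
    by (subst nn_integral_eq_integral) (auto simp: oscint_def)
  finally show ?thesis .
qed

lemma oscint_nonneg [simp]: "R \<ge> 0 \<Longrightarrow> oscint R f \<ge> 0"
  by (auto simp: oscint_def intro!: divide_nonneg_nonneg Bochner_Integration.integral_nonneg)

text \<open>With \<open>p = d + 2 s\<close>, scale \<open>j\<close> carries the weight
  \<open>2^(2sj) 2^(jd) = 2^(pj)\<close> and contributes only if \<open>2^j < 2 / |v - v'|\<close>.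
  The truncated geometric series is at most \<open>2^p / (2^p - 1)\<close> times
  \<open>(2 / |v - v'|)^p\<close>, that is, \<open>2^p\<close> times the Gagliardo kernel.\<close>

definition square_fun_const :: "'a::euclidean_space itself \<Rightarrow> real \<Rightarrow> real" where
  "square_fun_const _ s = (let p = real DIM('a) + 2 * s in 2 powr p / (2 powr p - 1) * 2 powr p)"

lemma square_fun_const_pos: "s > 0 \<Longrightarrow> square_fun_const TYPE('a::euclidean_space) s > 0"
  by (simp add: square_fun_const_def Let_def)

text \<open>A geometric series with ratio above 1 is comparable to its last term, and the last
  admissible power \<open>q^j = (2^j)^p\<close> lies below \<open>x^p\<close>.\<close>

lemma geometric_sum_restricted:
  fixes q x p :: real
  assumes q: "q = 2 powr p" "p > 0" and x: "x > 0"
  shows "(\<Sum>j<N. q ^ j * indicator {..<x} (2 ^ j)) \<le> q / (q - 1) * x powr p"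
proof (induction N)
  case 0
  have "q > 1" using q by simp
  then show ?case using x by simp
next
  case (Suc N)
  have q1: "q > 1" using q by simp
  show ?case
  proof (cases "2 ^ N < x")
    case True
    have "(\<Sum>j<Suc N. q ^ j * indicator {..<x} (2 ^ j)) \<le> (\<Sum>j<Suc N. q ^ j)"
      using q1 by (intro sum_mono) (auto simp: indicator_def)
    also have "\<dots> = (q ^ Suc N - 1) / (q - 1)"
      using q1 geometric_sum[of q "Suc N"] by simp
    also have "\<dots> \<le> q / (q - 1) * q ^ N"
      using q1 by (simp add: divide_right_mono)
    also have "q ^ N = (2 ^ N) powr p"
      unfolding q by (simp add: powr_powr mult.commute flip: powr_realpow)
    also have "q / (q - 1) * (2 ^ N) powr p \<le> q / (q - 1) * x powr p"
      using True q(2) q1 by (intro mult_left_mono powr_mono2) auto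
    finally show ?thesis .
  next
    case False
    then show ?thesis using Suc by simp
  qed
qed

text \<open>The Littlewood--Paley square function, in physical space: for fixed distance of the two
  points the scales contributing to the sum form a geometric series.\<close>

lemma sum_oscint_le:
  fixes f :: "'a::euclidean_space \<Rightarrow> real"
  assumes f: "borel_Hs s f" and s: "s > 0"
  shows "(\<Sum>j<N. 2 powr (2 * s * real j) * oscint (1 / 2 ^ j) f) \<le> square_fun_const TYPE('a) s * gag s f"
proof -
  let ?d = "DIM('a)" and ?p = "real DIM('a) + 2 * s"
  have "(\<Sum>j<N. 2 powr (2 * s * real j) * oscint (1 / 2 ^ j) f)
    = (\<Sum>j<N. (LINT z|lborel. (2 powr ?p) ^ j * (indicator {..<2 * (1 / 2 ^ j)} (gap z) * sqdiff f z)))"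
  proof (intro sum.cong refl)
    fix j
    have "2 powr (2 * s * real j) * (2 ^ j) ^ ?d = (2 powr ?p) ^ j"
    proof -
      have "((2::real) ^ j) ^ ?d = 2 powr (real j * real ?d)"
        using powr_realpow[of 2 "j * ?d"] by (simp add: power_mult)
      then show ?thesis
        by (simp add: powr_powr powr_add[symmetric] algebra_simps flip: powr_realpow)
    qed
    then show "2 powr (2 * s * real j) * oscint (1 / 2 ^ j) f
        = (LINT z|lborel. (2 powr ?p) ^ j * (indicator {..<2 * (1 / 2 ^ j)} (gap z) * sqdiff f z))"
      by (simp add: oscint_def power_divide power_mult mult.commute)
  qed
  also have "\<dots> = (LINT z|lborel. (\<Sum>j<N. (2 powr ?p) ^ j * (indicator {..<2 * (1 / 2 ^ j)} (gap z) * sqdiff f z)))"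
    using integrable_near_sqdiff[OF f s] by (intro Bochner_Integration.integral_sum[symmetric] integrable_mult_right) auto
  also have "\<dots> \<le> (LINT z|lborel. square_fun_const TYPE('a) s * (sqdiff f z * gkernel s z))"
  proof (rule integral_mono)
    show "integrable lborel (\<lambda>z. \<Sum>j<N. (2 powr ?p) ^ j * (indicator {..<2 * (1 / 2 ^ j)} (gap z) * sqdiff f z))"
      using integrable_near_sqdiff[OF f s] by (intro Bochner_Integration.integrable_sum integrable_mult_right) auto
    show "integrable lborel (\<lambda>z. square_fun_const TYPE('a) s * (sqdiff f z * gkernel s z))"
      using f by (intro integrable_mult_right) (simp add: borel_Hs_def)
    fix z :: "'a \<times> 'a"
    show "(\<Sum>j<N. (2 powr ?p) ^ j * (indicator {..<2 * (1 / 2 ^ j)} (gap z) * sqdiff f z))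
        \<le> square_fun_const TYPE('a) s * (sqdiff f z * gkernel s z)"
    proof (cases "gap z = 0")
      case False
      then have g: "gap z > 0" using gap_nonneg[of z] by linarith
      have "indicator {..<2 * (1 / 2 ^ j)} (gap z) = (indicator {..<2 / gap z} (2 ^ j) :: real)" for j
        using g by (auto simp: indicator_def field_simps)
      then have "(\<Sum>j<N. (2 powr ?p) ^ j * (indicator {..<2 * (1 / 2 ^ j)} (gap z) * sqdiff f z))
        = (\<Sum>j<N. (2 powr ?p) ^ j * indicator {..<2 / gap z} (2 ^ j)) * sqdiff f z"
        by (simp only: sum_distrib_right mult.assoc)
      also have "\<dots> \<le> 2 powr ?p / (2 powr ?p - 1) * (2 / gap z) powr ?p * sqdiff f z"
        using g s by (intro mult_right_mono geometric_sum_restricted) auto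
      also have "\<dots> = square_fun_const TYPE('a) s * (sqdiff f z * gkernel s z)"
      proof -
        have "(2 / gap z) powr ?p = 2 powr ?p * gkernel s z"
          unfolding gkernel_def powr_minus_divide powr_divide by simp
        then show ?thesis by (simp add: square_fun_const_def Let_def mult_ac)
      qed
      finally show ?thesis .
    qed (simp add: sqdiff_eq_0)
  qed
  also have "\<dots> = square_fun_const TYPE('a) s * gag s f" by (simp add: gag_def)
  finally show ?thesis .
qed

lemma oscint_le:
  fixes f :: "'a::euclidean_space \<Rightarrow> real"
  assumes f: "borel_Hs s f" and s: "s > 0"
  shows "2 powr (2 * s * real j) * oscint (1 / 2 ^ j) f \<le> square_fun_const TYPE('a) s * gag s f"
proof -
  have "2 powr (2 * s * real j) * oscint (1 / 2 ^ j) f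
    \<le> (\<Sum>i<Suc j. 2 powr (2 * s * real i) * oscint (1 / 2 ^ i) f)"
    by (rule member_le_sum) auto
  with sum_oscint_le[OF f s, of "Suc j"] show ?thesis by linarith
qed

text \<open>With \<open>c = 0\<close> the oscillation is a local average of \<open>f^2\<close>;
  after interchanging the variables each point is counted with the volume of a ball of radius
  \<open>2 R\<close>, divided by \<open>R^d\<close>.\<close>

lemma nn_integral_osc_0:
  fixes f :: "'a::euclidean_space \<Rightarrow> real"
  assumes f: "test_function f" and R: "R > 0"
  shows "(\<integral>\<^sup>+v. ennreal (osc R 0 f v) \<partial>lborel)
    = ennreal (2 ^ DIM('a) * measure lborel (ball (0::'a) 1) * l2sq f)"
proof -
  let ?d = "DIM('a)" and ?M = "measure lborel (ball (0::'a) 1)"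
  have [measurable]: "f \<in> borel_measurable borel" by (rule test_function_measurable[OF f])
  have "(\<integral>\<^sup>+v. ennreal (osc R 0 f v) \<partial>lborel)
    = (\<integral>\<^sup>+v. \<integral>\<^sup>+w. ennreal (1 / R ^ ?d) * (ennreal ((f w)\<^sup>2) * indicator {..<2 * R} (gap (v, w))) \<partial>lborel \<partial>lborel)"
  proof (intro nn_integral_cong)
    fix v
    have i: "integrable lborel (\<lambda>w. indicator {..<2 * R} (gap (v, w)) * (f w)\<^sup>2)"
      using integrable_osc_integrand[OF f, of v "2 * R" 0]
      by (simp add: indicator_ball_eq gap_Pair)
    have "ennreal (osc R 0 f v) = (\<integral>\<^sup>+w. ennreal (indicator {..<2 * R} (gap (v, w)) * (f w)\<^sup>2 / R ^ ?d) \<partial>lborel)"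
      using R by (subst nn_integral_eq_integral) (use i in \<open>auto simp: osc_def indicator_ball_eq gap_Pair\<close>)
    also have "\<dots> = (\<integral>\<^sup>+w. ennreal (1 / R ^ ?d) * (ennreal ((f w)\<^sup>2) * indicator {..<2 * R} (gap (v, w))) \<partial>lborel)"
      using R by (intro nn_integral_cong) (auto simp: indicator_def simp flip: ennreal_mult)
    finally show "ennreal (osc R 0 f v) = \<dots>" .
  qed
  also have "\<dots> = (\<integral>\<^sup>+z. ennreal (1 / R ^ ?d) * (ennreal ((f (snd z))\<^sup>2) * indicator {..<2 * R} (gap z)) \<partial>lborel)"
    by (subst nn_integral_Fubini) auto
  also have "\<dots> = (\<integral>\<^sup>+z. ennreal (1 / R ^ ?d) * (ennreal ((f (fst z))\<^sup>2) * indicator {..<2 * R} (gap z)) \<partial>lborel)"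
    by (subst nn_integral_swap[symmetric]) auto
  also have "\<dots> = (\<integral>\<^sup>+v. \<integral>\<^sup>+w. ennreal (1 / R ^ ?d) * (ennreal ((f v)\<^sup>2) * indicator {..<2 * R} (gap (v, w))) \<partial>lborel \<partial>lborel)"
    by (subst nn_integral_Fubini) auto
  also have "\<dots> = (\<integral>\<^sup>+v. ennreal (1 / R ^ ?d) * (ennreal ((f v)\<^sup>2) * (\<integral>\<^sup>+w. indicator (ball v (2 * R)) w \<partial>lborel)) \<partial>lborel)"
    unfolding indicator_ball_eq gap_Pair by (intro nn_integral_cong) (simp add: nn_integral_cmult)
  also have "\<dots> = (\<integral>\<^sup>+v. ennreal (2 ^ ?d * ?M) * ennreal ((f v)\<^sup>2) \<partial>lborel)"
    using R by (intro nn_integral_cong)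
      (auto simp: nn_integral_ball_indicator power_mult_distrib simp flip: ennreal_mult simp del: nn_integral_indicator)
  also have "\<dots> = ennreal (2 ^ ?d * ?M * l2sq f)"
    by (simp add: nn_integral_cmult nn_l2sq[OF test_function_square_integrable[OF f]] ennreal_mult)
  finally show ?thesis .
qed

text \<open>Every \<open>w\<close> in the ball of radius \<open>R\<close> about \<open>v\<close>
  lies in both balls of radius \<open>2 R\<close>; compare \<open>f v\<close> and
  \<open>f v'\<close> with \<open>f w\<close> and average over these \<open>w\<close>. The gain is
  that each term on the right depends on one endpoint only, so that integrated bounds on the kernel
  suffice.\<close>

lemma sqdiff_le_osc:
  fixes f :: "'a::euclidean_space \<Rightarrow> real"
  assumes f: "test_function f" and R: "R > 0" and g: "gap z < R"
  shows "sqdiff f z \<le> 2 / measure lborel (ball (0::'a) 1) *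
    (osc R (f (fst z)) f (fst z) + osc R (f (snd z)) f (snd z))"
proof -
  let ?M = "measure lborel (ball (0::'a) 1)" and ?d = "DIM('a)"
  obtain v v' where z: "z = (v, v')" by (cases z)
  have M: "?M > 0" by (rule content_ball_unit_pos)
  have "R ^ ?d * ?M * sqdiff f z = (LINT w|lborel. indicator (ball v R) w * sqdiff f z)"
    using integral_ball_indicator(2)[of R v] R by simp
  also have "\<dots> \<le> (LINT w|lborel. 2 * (indicator (ball v (2 * R)) w * (f w - f v)\<^sup>2)
      + 2 * (indicator (ball v' (2 * R)) w * (f w - f v')\<^sup>2))"
  proof (rule integral_mono)
    show "integrable lborel (\<lambda>w. indicator (ball v R) w * sqdiff f z)"
      using integral_ball_indicator(1)[of R v] R by (intro integrable_mult_left) auto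
    show "integrable lborel (\<lambda>w. 2 * (indicator (ball v (2 * R)) w * (f w - f v)\<^sup>2)
      + 2 * (indicator (ball v' (2 * R)) w * (f w - f v')\<^sup>2))"
      by (intro Bochner_Integration.integrable_add integrable_mult_right integrable_osc_integrand f)
    fix w
    have "sqdiff f z \<le> 2 * (f w - f v)\<^sup>2 + 2 * (f w - f v')\<^sup>2"
      using zero_le_power2[of "(f w - f v) + (f w - f v')"]
      by (simp add: sqdiff_def z power2_eq_square algebra_simps)
    moreover have "w \<in> ball v' (2 * R)" if "w \<in> ball v R"
      using that g R dist_triangle[of v' w v] by (simp add: z gap_Pair dist_norm norm_minus_commute)
    ultimately show "indicator (ball v R) w * sqdiff f z \<le> 2 * (indicator (ball v (2 * R)) w * (f w - f v)\<^sup>2)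
      + 2 * (indicator (ball v' (2 * R)) w * (f w - f v')\<^sup>2)"
      using R by (auto simp: indicator_def)
  qed
  also have "\<dots> = 2 * (R ^ ?d * osc R (f v) f v) + 2 * (R ^ ?d * osc R (f v') f v')"
    using R by (subst Bochner_Integration.integral_add)
      (auto simp: osc_def intro!: integrable_mult_right integrable_osc_integrand[OF f])
  finally have "R ^ ?d * (?M * sqdiff f z) \<le> R ^ ?d * (2 * (osc R (f v) f v + osc R (f v') f v'))"
    by (simp add: algebra_simps)
  then have "?M * sqdiff f z \<le> 2 * (osc R (f v) f v + osc R (f v') f v')"
    using R by simp
  then show ?thesis using M by (simp add: z field_simps)
qed

text \<open>The first 4 is the factor 2 of \<open>sqdiff_le_osc\<close> for each of the two
  endpoints. The power \<open>2 powr (2 * s)\<close> appears because the tail of the annulus at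
  scale \<open>j\<close> starts at its inner radius \<open>2^(-j-1)\<close>. The last 4 belongs to
  distances at least 1, where \<open>sqdiff_le\<close> is used.\<close>

definition sym_const :: "'a::euclidean_space itself \<Rightarrow> real \<Rightarrow> real" where
  "sym_const _ s = 4 / measure lborel (ball (0::'a) 1) * 2 powr (2 * s) * square_fun_const TYPE('a) s + 4"

lemma sym_const_pos: "s > 0 \<Longrightarrow> sym_const TYPE('a::euclidean_space) s > 0"
  using square_fun_const_pos[of s, where 'a='a] content_ball_unit_pos[where 'a='a]
  by (auto simp: sym_const_def intro!: add_nonneg_pos mult_nonneg_nonneg divide_nonneg_nonneg)

text \<open>On the annulus \<open>|v - v'| ~ 2^(-j)\<close> the increment is replaced by
  oscillations at scale \<open>2^(-j)\<close>; the tail bound then produces exactly the weight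
  \<open>2^(2sj)\<close> of the square function.\<close>

lemma kernel_sqdiff_le:
  fixes f :: "'a::euclidean_space \<Rightarrow> real"
  assumes [measurable]: "k \<in> borel_measurable borel"
    and tail: "ktail s L k" "ktail s L (\<lambda>z. k (prod.swap z))"
    and f: "test_function f" and s: "0 < s" "s < 1" and L: "L \<ge> 0"
  shows "(\<integral>\<^sup>+z. ennreal (\<bar>k z\<bar> * sqdiff f z) \<partial>lborel) \<le> ennreal (sym_const TYPE('a) s * L * hs2 s f)"
proof -
  let ?M = "measure lborel (ball (0::'a) 1)" and ?W = "\<lambda>z. ennreal (\<bar>k z\<bar> * sqdiff f z)"
  let ?c = "4 / ?M * 2 powr (2 * s)" and ?S = "square_fun_const TYPE('a) s"
  have [measurable]: "f \<in> borel_measurable borel" by (rule test_function_measurable[OF f])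
  have M: "?M > 0" by (rule content_ball_unit_pos)
  have fH: "borel_Hs s f" by (rule borel_Hs_test[OF f s])
  have "(\<integral>\<^sup>+z. indicator {0<..<1} (gap z) * ?W z \<partial>lborel) \<le> ennreal (?c * L * (?S * gag s f))"
  proof (rule nn_integral_cover_le[where A = "\<lambda>j. {1 / 2 ^ Suc j..<1 / 2 ^ j}"])
    show "{0<..<1::real} \<subseteq> (\<Union>j. {1 / 2 ^ Suc j..<1 / 2 ^ j})" by (rule dyadic_cover_inside)
    fix N
    have piece: "(\<integral>\<^sup>+z. indicator {1 / 2 ^ Suc j..<1 / 2 ^ j} (gap z) * ?W z \<partial>lborel)
        \<le> ennreal (?c * L * (2 powr (2 * s * real j) * oscint (1 / 2 ^ j) f))" for j
    proof -
      let ?R = "1 / 2 ^ j :: real" and ?r = "1 / 2 ^ Suc j :: real"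
      let ?h = "\<lambda>v. ennreal (2 / ?M * osc ?R (f v) f v)"
      let ?w = "\<lambda>z. indicator {?r..} (gap z) * ennreal \<bar>k z\<bar> :: ennreal"
      have [measurable]: "(\<lambda>v. osc ?R (f v) f v) \<in> borel_measurable borel" by measurable
      have "indicator {?r..<?R} (gap z) * ?W z \<le> ?h (fst z) * ?w z + ?h (snd z) * ?w z" for z
      proof (cases "gap z \<in> {?r..<?R}")
        case True
        have "?W z \<le> (?h (fst z) + ?h (snd z)) * ennreal \<bar>k z\<bar>"
          using sqdiff_le_osc[OF f _, of ?R z] True M by (intro ennreal_weight_le) (auto simp: distrib_left)
        then show ?thesis using True by (simp add: distrib_right)
      qed simp
      then have "(\<integral>\<^sup>+z. indicator {?r..<?R} (gap z) * ?W z \<partial>lborel)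
        \<le> (\<integral>\<^sup>+z. ?h (fst z) * ?w z \<partial>lborel) + (\<integral>\<^sup>+z. ?h (snd z) * ?w z \<partial>lborel)"
        by (subst nn_integral_add[symmetric]) (auto intro!: nn_integral_mono)
      also have "\<dots> \<le> ennreal (L * ?r powr (- 2 * s)) * (\<integral>\<^sup>+v. ?h v \<partial>lborel)
          + ennreal (L * ?r powr (- 2 * s)) * (\<integral>\<^sup>+v. ?h v \<partial>lborel)"
        by (intro add_mono ktail_far) (use tail L in auto)
      also have "(\<integral>\<^sup>+v. ?h v \<partial>lborel) = ennreal (2 / ?M * oscint ?R f)"
        using M nn_integral_osc[OF f s, of ?R]
        by (simp add: ennreal_mult nn_integral_cmult del: times_divide_eq_left)
      also have "ennreal (L * ?r powr (- 2 * s)) * ennreal (2 / ?M * oscint ?R f)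
          + ennreal (L * ?r powr (- 2 * s)) * ennreal (2 / ?M * oscint ?R f)
          = ennreal (2 * (L * ?r powr (- 2 * s) * (2 / ?M * oscint ?R f)))"
        using L M by (simp flip: ennreal_mult ennreal_plus)
      also have "?r powr (- 2 * s) = 2 powr (2 * s) * 2 powr (2 * s * real j)"
        by (simp add: powr_divide powr_minus powr_mult powr_powr mult_ac flip: powr_realpow)
      finally show ?thesis by (simp add: mult_ac)
    qed
    have "(\<Sum>j<N. \<integral>\<^sup>+z. indicator {1 / 2 ^ Suc j..<1 / 2 ^ j} (gap z) * ?W z \<partial>lborel)
      \<le> (\<Sum>j<N. ennreal (?c * L * (2 powr (2 * s * real j) * oscint (1 / 2 ^ j) f)))"
      by (intro sum_mono piece)
    also have "\<dots> = ennreal (?c * L * (\<Sum>j<N. 2 powr (2 * s * real j) * oscint (1 / 2 ^ j) f))"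
      unfolding sum_distrib_left using M L by (intro sum_ennreal) auto
    also have "\<dots> \<le> ennreal (?c * L * (?S * gag s f))"
      using sum_oscint_le[OF fH s(1)] M L by (intro ennreal_leI mult_left_mono) auto
    finally show "(\<Sum>j<N. \<integral>\<^sup>+z. indicator {1 / 2 ^ Suc j..<1 / 2 ^ j} (gap z) * ?W z \<partial>lborel)
      \<le> ennreal (?c * L * (?S * gag s f))" .
  qed measurable
  moreover have "(\<integral>\<^sup>+z. indicator {1..} (gap z) * ?W z \<partial>lborel) \<le> ennreal (4 * L * l2sq f)"
  proof -
    let ?h = "\<lambda>v. ennreal (2 * (f v)\<^sup>2)"
    let ?w = "\<lambda>z. indicator {1..} (gap z) * ennreal \<bar>k z\<bar> :: ennreal"
    have "indicator {1..} (gap z) * ?W z \<le> ?h (fst z) * ?w z + ?h (snd z) * ?w z" for z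
    proof (cases "gap z \<ge> 1")
      case True
      have "?W z \<le> (?h (fst z) + ?h (snd z)) * ennreal \<bar>k z\<bar>"
        using sqdiff_le[of f z] by (intro ennreal_weight_le) auto
      then show ?thesis using True by (simp add: distrib_right)
    qed simp
    then have "(\<integral>\<^sup>+z. indicator {1..} (gap z) * ?W z \<partial>lborel)
      \<le> (\<integral>\<^sup>+z. ?h (fst z) * ?w z \<partial>lborel) + (\<integral>\<^sup>+z. ?h (snd z) * ?w z \<partial>lborel)"
      by (subst nn_integral_add[symmetric]) (auto intro!: nn_integral_mono)
    also have "\<dots> \<le> ennreal (L * 1 powr (- 2 * s)) * (\<integral>\<^sup>+v. ?h v \<partial>lborel)
        + ennreal (L * 1 powr (- 2 * s)) * (\<integral>\<^sup>+v. ?h v \<partial>lborel)"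
      by (intro add_mono ktail_far) (use tail L in auto)
    also have "(\<integral>\<^sup>+v. ?h v \<partial>lborel) = ennreal (2 * l2sq f)"
      by (simp add: ennreal_mult nn_integral_cmult nn_l2sq[OF test_function_square_integrable[OF f]])
    finally show ?thesis using L by (simp add: mult.assoc flip: ennreal_mult ennreal_plus)
  qed
  \<comment> \<open>The kernel is arbitrary on the diagonal, but \<open>sqdiff\<close> vanishes
    there.\<close>
  moreover have "(\<integral>\<^sup>+z. ?W z \<partial>lborel) = (\<integral>\<^sup>+z. indicator {0<..<1} (gap z) * ?W z \<partial>lborel)
      + (\<integral>\<^sup>+z. indicator {1..} (gap z) * ?W z \<partial>lborel)"
  proof (subst nn_integral_add[symmetric])
    have "?W z = indicator {0<..<1} (gap z) * ?W z + indicator {1..} (gap z) * ?W z" for z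
      using gap_nonneg[of z] by (cases "gap z = 0") (auto simp: sqdiff_eq_0 indicator_def simp del: gap_nonneg)
    then show "(\<integral>\<^sup>+z. ?W z \<partial>lborel) = (\<integral>\<^sup>+z. indicator {0<..<1} (gap z) * ?W z + indicator {1..} (gap z) * ?W z \<partial>lborel)"
      by (rule nn_integral_cong)
  qed measurable
  ultimately have "(\<integral>\<^sup>+z. ?W z \<partial>lborel) \<le> ennreal (?c * L * (?S * gag s f)) + ennreal (4 * L * l2sq f)"
    by (simp add: add_mono)
  also have "\<dots> = ennreal (?c * L * (?S * gag s f) + 4 * L * l2sq f)"
    using M L square_fun_const_pos[OF s(1), where 'a='a] gag_nonneg[of s f] l2sq_nonneg[of f]
    by (intro ennreal_plus[symmetric]) (simp_all del: times_divide_eq_left add: zero_le_divide_iff)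
  also have "\<dots> \<le> ennreal (sym_const TYPE('a) s * L * hs2 s f)"
  proof (rule ennreal_leI)
    have "0 \<le> ?c * ?S * L * l2sq f" "0 \<le> 4 * L * gag s f"
      using M L square_fun_const_pos[OF s(1), where 'a='a] by auto
    moreover have "sym_const TYPE('a) s * L * hs2 s f =
       ?c * L * (?S * gag s f) + 4 * L * l2sq f + (?c * ?S * L * l2sq f + 4 * L * gag s f)"
      by (simp add: sym_const_def hs2_def algebra_simps add_divide_distrib)
    ultimately show "?c * L * (?S * gag s f) + 4 * L * l2sq f \<le> sym_const TYPE('a) s * L * hs2 s f"
      by linarith
  qed
  finally show ?thesis .
qed

section \<open>The skew-symmetric part\<close>

text \<open>Dominated convergence, with \<open>\<epsilon>\<close> written as the inverse of a
  parameter tending to infinity. At each point the truncation is eventually inactive.\<close>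

lemma integral_truncated_tendsto:
  fixes F :: "'a::euclidean_space \<times> 'a \<Rightarrow> real"
  assumes int: "integrable lborel (\<lambda>z. indicator {0<..} (gap z) * F z)"
    and [measurable]: "F \<in> borel_measurable borel"
  shows "((\<lambda>\<epsilon>. LINT z|lborel. indicator {\<epsilon><..} (gap z) * F z)
    \<longlongrightarrow> (LINT z|lborel. indicator {0<..} (gap z) * F z)) (at_right 0)"
  unfolding filterlim_at_right_to_top
proof (rule integral_dominated_convergence_at_top[where w = "\<lambda>z. \<bar>indicator {0<..} (gap z) * F z\<bar>"])
  show "integrable lborel (\<lambda>z. \<bar>indicator {0<..} (gap z) * F z\<bar>)" using int by (rule integrable_abs)
  show "\<forall>\<^sub>F x in at_top. AE z in lborel. norm (indicator {inverse x<..} (gap z) * F z) \<le> \<bar>indicator {0<..} (gap z) * F z\<bar>"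
    using eventually_gt_at_top[of 0]
  proof eventually_elim
    case (elim x)
    then have "inverse x > 0" by simp
    then show ?case by (intro AE_I2) (auto simp: indicator_def simp del: inverse_positive_iff_positive intro: less_trans)
  qed
  show "AE z in lborel. ((\<lambda>x. indicator {inverse x<..} (gap z) * F z) \<longlongrightarrow> indicator {0<..} (gap z) * F z) at_top"
  proof (rule AE_I2)
    fix z :: "'a \<times> 'a"
    have "\<forall>\<^sub>F x in at_top. indicator {inverse x<..} (gap z) * F z = indicator {0<..} (gap z) * F z"
    proof (cases "gap z = 0")
      case True
      show ?thesis using eventually_gt_at_top[of 0]
        by eventually_elim (auto simp: True indicator_def)
    next
      case False
      then have g: "gap z > 0" using gap_nonneg[of z] by linarith
      show ?thesis using eventually_gt_at_top[of "1 / gap z"] eventually_gt_at_top[of 0]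
        by eventually_elim (use g in \<open>auto simp: indicator_def field_simps\<close>)
    qed
    then show "((\<lambda>x. indicator {inverse x<..} (gap z) * F z) \<longlongrightarrow> indicator {0<..} (gap z) * F z) at_top"
      by (rule tendsto_eventually)
  qed
qed (use int in auto)

text \<open>Used in place of Cauchy-Schwarz: the bound separates the two functions, and
  \<open>t\<close> stays free to balance two frequencies or to tend to 0.\<close>

lemma amgm_weighted:
  fixes x y t :: real
  assumes "t > 0" shows "\<bar>x\<bar> * \<bar>y\<bar> \<le> t * x\<^sup>2 + y\<^sup>2 / t"
proof -
  have "0 \<le> (sqrt t * \<bar>x\<bar> - \<bar>y\<bar> / sqrt t)\<^sup>2" by simp
  also have "\<dots> = t * x\<^sup>2 + y\<^sup>2 / t - 2 * (\<bar>x\<bar> * \<bar>y\<bar>)"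
    using assms by (simp add: power2_diff power_mult_distrib power_divide)
  finally show ?thesis using mult_nonneg_nonneg[OF abs_ge_zero abs_ge_zero, of x y] by linarith
qed

lemma abs_truncation_mono:
  fixes x y :: real
  assumes "0 < \<epsilon>" shows "\<bar>indicator {\<epsilon><..} x * y\<bar> \<le> \<bar>indicator {0<..} x * y\<bar>"
  using assms by (auto simp: indicator_def)

text \<open>The summands come from the second moment of the Taylor remainder, from one first moment
  per coordinate, and from the region beyond distance \<open>R\<close>.\<close>

definition scale_const :: "'a::euclidean_space itself \<Rightarrow> real \<Rightarrow> real" where
  "scale_const _ s = moment_const s 2 + real DIM('a) + 4"

lemma scale_const_pos: "s < 1 \<Longrightarrow> scale_const TYPE('a::euclidean_space) s > 0"
  using moment_const_pos[of s 2] by (auto simp: scale_const_def intro!: add_pos_pos add_pos_nonneg)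

lemma integrable_kernel_far:
  fixes k :: "'a::euclidean_space \<times> 'a \<Rightarrow> real"
  assumes [measurable]: "k \<in> borel_measurable borel"
    and tail: "ktail s L k" "ktail s L (\<lambda>z. k (prod.swap z))" and L: "L \<ge> 0"
    and [measurable]: "G \<in> borel_measurable borel" and h: "integrable lborel h"
    and le: "\<And>z. \<bar>G z\<bar> \<le> \<bar>h (fst z)\<bar> + \<bar>h (snd z)\<bar>" and \<epsilon>: "\<epsilon> > 0"
    and J: "J \<in> sets borel" "J \<subseteq> {\<epsilon>..}"
  shows "integrable lborel (\<lambda>z. indicator J (gap z) * (G z * k z))"
proof (rule integrableI_bounded)
  have [measurable]: "h \<in> borel_measurable borel" "J \<in> sets borel" using h J by auto
  show "(\<lambda>z. indicator J (gap z) * (G z * k z)) \<in> borel_measurable lborel" by measurable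
  let ?h = "\<lambda>v. ennreal \<bar>h v\<bar>"
  let ?w = "\<lambda>z. indicator {\<epsilon>..} (gap z) * ennreal \<bar>k z\<bar> :: ennreal"
  have "(\<integral>\<^sup>+z. ennreal (norm (indicator J (gap z) * (G z * k z))) \<partial>lborel)
     \<le> (\<integral>\<^sup>+z. ?h (fst z) * ?w z + ?h (snd z) * ?w z \<partial>lborel)"
  proof (rule nn_integral_mono)
    fix z
    have "ennreal (\<bar>k z\<bar> * \<bar>G z\<bar>) \<le> (?h (fst z) + ?h (snd z)) * ennreal \<bar>k z\<bar>"
      by (rule ennreal_weight_le[OF le]) auto
    then show "ennreal (norm (indicator J (gap z) * (G z * k z))) \<le> ?h (fst z) * ?w z + ?h (snd z) * ?w z"
      using J(2) by (cases "gap z \<in> J") (auto simp: abs_mult distrib_right mult.commute[of "\<bar>k z\<bar>"] subset_eq)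
  qed
  also have "\<dots> = (\<integral>\<^sup>+z. ?h (fst z) * ?w z \<partial>lborel) + (\<integral>\<^sup>+z. ?h (snd z) * ?w z \<partial>lborel)"
    by (rule nn_integral_add) measurable
  also have "\<dots> < \<infinity>"
    using ktail_far(1)[OF _ _ tail \<epsilon> L, of ?h] ktail_far(2)[OF _ _ tail \<epsilon> L, of ?h] h
    by (auto simp: ennreal_mult_less_top integrable_iff_bounded elim!: le_less_trans)
  finally show "(\<integral>\<^sup>+z. ennreal (norm (indicator J (gap z) * (G z * k z))) \<partial>lborel) < \<infinity>" .
qed

text \<open>The cancellation hypotheses appear as limits of truncated double integrals tested
  against \<open>\<psi>\<close>, the only shape in which they are applied. Restricted to
  \<open>R <= 1\<close>, the first moment has the scale-invariant bound \<open>R^(1-2s)\<close> for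
  all \<open>s\<close>.\<close>

locale skew_kernel =
  fixes A :: "'a::euclidean_space \<times> 'a \<Rightarrow> real" and s L :: real
  assumes A_measurable [measurable]: "A \<in> borel_measurable borel"
    and A_swap: "A (prod.swap z) = - A z"
    and s: "0 < s" "s < 1" and L: "L \<ge> 0"
    and tail: "ktail s L A"
    and pv0: "test_function \<psi> \<Longrightarrow> \<exists>l.
      ((\<lambda>\<epsilon>. LINT z|lborel. indicator {\<epsilon><..} (gap z) * (\<psi> (fst z) * A z)) \<longlongrightarrow> l) (at_right 0) \<and>
      \<bar>l\<bar> \<le> L * (LINT v|lborel. \<bar>\<psi> v\<bar>)"
    and pv1: "0 < R \<Longrightarrow> R \<le> 1 \<Longrightarrow> test_function \<psi> \<Longrightarrow> b \<in> Basis \<Longrightarrow> \<exists>l.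
      ((\<lambda>\<epsilon>. LINT z|lborel. indicator {\<epsilon><..<R} (gap z) * (\<psi> (fst z) * (((fst z - snd z) \<bullet> b) * A z)))
        \<longlongrightarrow> l) (at_right 0) \<and> \<bar>l\<bar> \<le> L * R powr (1 - 2 * s) * (LINT v|lborel. \<bar>\<psi> v\<bar>)"
begin

lemma tail_swap: "ktail s L (\<lambda>z. A (prod.swap z))"
  using tail by (simp add: ktail_def A_swap)

definition skew_trunc :: "real \<Rightarrow> ('a \<Rightarrow> real) \<Rightarrow> ('a \<Rightarrow> real) \<Rightarrow> real" where
  "skew_trunc \<epsilon> \<phi> g =
     (LINT z|lborel. indicator {\<epsilon><..} (gap z) * ((\<phi> (fst z) - \<phi> (snd z)) * g (fst z) * A z))"

definition skew_form :: "('a \<Rightarrow> real) \<Rightarrow> ('a \<Rightarrow> real) \<Rightarrow> real" where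
  "skew_form \<phi> g = Lim (at_right 0) (\<lambda>\<epsilon>. skew_trunc \<epsilon> \<phi> g)"

lemma integrable_far:
  assumes "G \<in> borel_measurable borel" "integrable lborel h"
    and le: "\<And>z. \<bar>G z\<bar> \<le> \<bar>h (fst z)\<bar>" and "\<epsilon> > 0"
    and "J \<in> sets borel" "J \<subseteq> {\<epsilon>..}"
  shows "integrable lborel (\<lambda>z. indicator J (gap z) * (G z * A z))"
proof (rule integrable_kernel_far[OF A_measurable tail tail_swap L assms(1,2) _ assms(4-6)])
  show "\<bar>G z\<bar> \<le> \<bar>h (fst z)\<bar> + \<bar>h (snd z)\<bar>" for z using le[of z] by linarith
qed

lemma integrable_far_test:
  assumes \<phi>: "test_function \<phi>" and g: "test_function g" and \<epsilon>: "\<epsilon> > 0"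
    and J: "J \<in> sets borel" "J \<subseteq> {\<epsilon>..}"
  shows "integrable lborel (\<lambda>z. indicator J (gap z) * ((\<phi> (fst z) * g (fst z)) * A z))"
    and "integrable lborel (\<lambda>z. indicator J (gap z) * ((\<phi> (snd z) * g (fst z)) * A z))"
    and "integrable lborel (\<lambda>z. indicator J (gap z) * ((\<phi> (fst z) - \<phi> (snd z)) * g (fst z) * A z))"
proof -
  have [measurable]: "\<phi> \<in> borel_measurable borel" "g \<in> borel_measurable borel"
    using \<phi> g test_function_measurable by auto
  obtain B where B: "B > 0" "\<And>x. \<bar>\<phi> x\<bar> \<le> B" using test_function_bounded[OF \<phi>] by metis
  have h: "integrable lborel (\<lambda>v. B * g v)"
    using test_function_integrable[OF g] by (intro integrable_mult_right)
  have le: "\<bar>\<phi> x * g y\<bar> \<le> \<bar>B * g y\<bar>" for x y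
    using B by (auto simp: abs_mult intro!: mult_right_mono)
  show 1: "integrable lborel (\<lambda>z. indicator J (gap z) * ((\<phi> (fst z) * g (fst z)) * A z))"
    by (rule integrable_far[OF _ h _ \<epsilon> J]) (use le in auto)
  show 2: "integrable lborel (\<lambda>z. indicator J (gap z) * ((\<phi> (snd z) * g (fst z)) * A z))"
    by (rule integrable_far[OF _ h _ \<epsilon> J]) (use le in auto)
  show "integrable lborel (\<lambda>z. indicator J (gap z) * ((\<phi> (fst z) - \<phi> (snd z)) * g (fst z) * A z))"
    using Bochner_Integration.integrable_diff[OF 1 2] by (simp add: algebra_simps)
qed

text \<open>Up to distance \<open>R\<close> the increment of \<open>\<phi>\<close> is replaced by its Taylor expansion, whose linear
  part is controlled by the first-moment cancellation; beyond \<open>R\<close> the tail bound suffices.\<close>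

lemma skew_form_scale:
  fixes m :: "'a \<Rightarrow> real"
  assumes \<phi>: "test_function \<phi>" and g: "test_function g" and R: "0 < R" "R \<le> 1"
    and [measurable]: "m \<in> borel_measurable borel"
    and m0: "\<And>v. \<bar>\<phi> v\<bar> \<le> m v"
    and m1: "\<And>v b. b \<in> Basis \<Longrightarrow> \<bar>grad \<phi> v b\<bar> \<le> m v / R"
    and m2: "\<And>v v'. norm (v' - v) < R \<Longrightarrow> \<bar>\<phi> v' - \<phi> v - grad \<phi> v (v' - v)\<bar> \<le> m v * (norm (v' - v) / R)\<^sup>2"
    and X: "(\<integral>\<^sup>+v. ennreal ((m v)\<^sup>2) \<partial>lborel) \<le> ennreal X" "X \<ge> 0"
    and Y: "l2sq g \<le> Y" and t: "t > 0"
  shows "\<exists>l. ((\<lambda>\<epsilon>. skew_trunc \<epsilon> \<phi> g) \<longlongrightarrow> l) (at_right 0) \<and>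
    \<bar>l\<bar> \<le> scale_const TYPE('a) s * L * R powr (- 2 * s) * (t * X + Y / t)"
proof -
  have [measurable]: "\<phi> \<in> borel_measurable borel" "g \<in> borel_measurable borel"
      "(\<lambda>x. grad \<phi> x b) \<in> borel_measurable borel" for b
    using \<phi> g test_function_measurable test_function_grad by auto
  \<comment> \<open>A common majorant for \<open>m |g|\<close> and for the products
    \<open>\<phi> g\<close> at equal or different points; all parts of the form are estimated by its
    integral, which is at most \<open>H\<close>.\<close>
  define h where "h v = t * (m v)\<^sup>2 + (g v)\<^sup>2 / t" for v
  have [measurable]: "h \<in> borel_measurable borel" unfolding h_def by measurable
  have h0: "h v \<ge> 0" for v using t by (simp add: h_def)
  have mh: "m v * \<bar>g v\<bar> \<le> h v" for v
    using amgm_weighted[OF t, of "m v" "g v"] m0[of v] by (simp add: h_def)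
  have \<phi>h: "\<bar>\<phi> v\<bar> * \<bar>g w\<bar> \<le> h v + h w" for v w
  proof -
    have "\<bar>\<phi> v\<bar> * \<bar>g w\<bar> \<le> t * (\<phi> v)\<^sup>2 + (g w)\<^sup>2 / t" by (rule amgm_weighted[OF t])
    also have "\<dots> \<le> t * (m v)\<^sup>2 + (g w)\<^sup>2 / t"
      using t m0[of v] by (intro add_mono mult_left_mono) (auto simp: abs_le_square_iff[symmetric])
    also have "\<dots> \<le> h v + h w" using t by (simp add: h_def)
    finally show ?thesis .
  qed
  define H where "H = t * X + Y / t"
  have Y0: "Y \<ge> 0" using l2sq_nonneg[of g] Y by linarith
  have H0: "H \<ge> 0" using t X Y0 by (simp add: H_def)
  have hH: "(\<integral>\<^sup>+v. ennreal (h v) \<partial>lborel) \<le> ennreal H"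
  proof -
    have "(\<integral>\<^sup>+v. ennreal (h v) \<partial>lborel)
      = (\<integral>\<^sup>+v. ennreal t * ennreal ((m v)\<^sup>2) + ennreal (1 / t) * ennreal ((g v)\<^sup>2) \<partial>lborel)"
      using t by (intro nn_integral_cong) (simp add: h_def flip: ennreal_mult ennreal_plus)
    also have "\<dots> = ennreal t * (\<integral>\<^sup>+v. ennreal ((m v)\<^sup>2) \<partial>lborel) + ennreal (1 / t) * (\<integral>\<^sup>+v. ennreal ((g v)\<^sup>2) \<partial>lborel)"
      by (simp add: nn_integral_add nn_integral_cmult)
    also have "\<dots> \<le> ennreal t * ennreal X + ennreal (1 / t) * ennreal Y"
      using X Y by (intro add_mono mult_left_mono)
        (auto simp: nn_l2sq[OF test_function_square_integrable[OF g]] intro: ennreal_leI)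
    also have "\<dots> = ennreal H"
      using t X Y0 by (simp add: H_def flip: ennreal_mult ennreal_plus)
    finally show ?thesis .
  qed
  let ?rem = "\<lambda>z. \<phi> (fst z) - \<phi> (snd z) - (\<Sum>b\<in>Basis. ((fst z - snd z) \<bullet> b) * grad \<phi> (fst z) b)"
  let ?F1 = "\<lambda>z. indicator {..<R} (gap z) * (?rem z * g (fst z) * A z)"
  let ?F3 = "\<lambda>z. indicator {R..} (gap z) * ((\<phi> (fst z) - \<phi> (snd z)) * g (fst z) * A z)"
  let ?F2 = "\<lambda>\<epsilon> b z. indicator {\<epsilon><..<R} (gap z) * ((grad \<phi> (fst z) b * g (fst z)) * (((fst z - snd z) \<bullet> b) * A z))"
  have rem: "\<bar>?rem z\<bar> \<le> m (fst z) * (gap z / R)\<^sup>2" if "gap z < R" for z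
  proof -
    have "?rem z = - (\<phi> (snd z) - \<phi> (fst z) - grad \<phi> (fst z) (snd z - fst z))"
      unfolding grad_expand[OF \<phi>, of "fst z" "snd z - fst z"]
      by (simp add: sum_negf[symmetric] inner_diff_left algebra_simps sum_subtractf)
    then show ?thesis using m2[of "snd z" "fst z"] that by (simp add: gap_def norm_minus_commute)
  qed
  \<comment> \<open>The remainder is of second order and \<open>2 > 2 * s\<close>, so the moment
    converges absolutely and equals \<open>R^(2-2s)\<close> up to a constant; the factor
    \<open>1 / R^2\<close> from \<open>m2\<close> turns this into \<open>R^(-2s)\<close>.\<close>
  have I1: "integrable lborel (\<lambda>z. indicator {0<..} (gap z) * ?F1 z)"
    and B1: "\<bar>LINT z|lborel. indicator {0<..} (gap z) * ?F1 z\<bar> \<le> moment_const s 2 * L * R powr (- 2 * s) * H"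
  proof -
    have "(\<integral>\<^sup>+z. ennreal \<bar>indicator {0<..} (gap z) * ?F1 z\<bar> \<partial>lborel)
      \<le> (\<integral>\<^sup>+z. ennreal (h (fst z) / R\<^sup>2) * (indicator {0<..<R} (gap z) * (ennreal (gap z powr 2) * ennreal \<bar>A z\<bar>)) \<partial>lborel)"
    proof (rule nn_integral_mono)
      fix z
      show "ennreal \<bar>indicator {0<..} (gap z) * ?F1 z\<bar>
        \<le> ennreal (h (fst z) / R\<^sup>2) * (indicator {0<..<R} (gap z) * (ennreal (gap z powr 2) * ennreal \<bar>A z\<bar>))"
      proof (cases "0 < gap z \<and> gap z < R")
        case True
        have "\<bar>?rem z * g (fst z) * A z\<bar> \<le> m (fst z) * (gap z / R)\<^sup>2 * \<bar>g (fst z)\<bar> * \<bar>A z\<bar>"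
          unfolding abs_mult using rem[of z] True by (intro mult_right_mono) auto
        also have "\<dots> = (m (fst z) * \<bar>g (fst z)\<bar>) * ((gap z / R)\<^sup>2 * \<bar>A z\<bar>)" by (simp add: mult_ac)
        also have "\<dots> \<le> h (fst z) * ((gap z / R)\<^sup>2 * \<bar>A z\<bar>)" by (intro mult_right_mono mh) auto
        finally have "\<bar>?rem z * g (fst z) * A z\<bar> \<le> h (fst z) / R\<^sup>2 * ((gap z)\<^sup>2 * \<bar>A z\<bar>)"
          by (simp add: power_divide)
        then have "ennreal \<bar>?rem z * g (fst z) * A z\<bar> \<le> ennreal (h (fst z) / R\<^sup>2) * (ennreal ((gap z)\<^sup>2) * ennreal \<bar>A z\<bar>)"
          using h0 R by (simp flip: ennreal_mult)
        then show ?thesis using True by simp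
      next
        case False
        then show ?thesis by (auto simp: indicator_def)
      qed
    qed
    also have "\<dots> \<le> ennreal (moment_const s 2 * L * R powr (2 - 2 * s)) * (\<integral>\<^sup>+v. ennreal (h v / R\<^sup>2) \<partial>lborel)"
      using ktail_near(1)[OF _ _ tail tail_swap R(1) L, of "\<lambda>v. ennreal (h v / R\<^sup>2)" 2] s by simp
    also have "(\<integral>\<^sup>+v. ennreal (h v / R\<^sup>2) \<partial>lborel) = ennreal (1 / R\<^sup>2) * (\<integral>\<^sup>+v. ennreal (h v) \<partial>lborel)"
      by (subst nn_integral_cmult[symmetric]) (auto simp: h0 simp flip: ennreal_mult)
    also have "ennreal (moment_const s 2 * L * R powr (2 - 2 * s)) * (ennreal (1 / R\<^sup>2) * (\<integral>\<^sup>+v. ennreal (h v) \<partial>lborel))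
        \<le> ennreal (moment_const s 2 * L * R powr (2 - 2 * s)) * (ennreal (1 / R\<^sup>2) * ennreal H)"
      by (intro mult_left_mono hH) auto
    also have "\<dots> = ennreal (moment_const s 2 * L * R powr (- 2 * s) * H)"
    proof -
      have "R powr (2 - 2 * s) * (1 / R\<^sup>2) = R powr (- 2 * s)"
        using R by (simp add: powr_diff powr_minus field_simps)
      then have "moment_const s 2 * L * R powr (2 - 2 * s) * ((1 / R\<^sup>2) * H) = moment_const s 2 * L * R powr (- 2 * s) * H"
        by (metis mult.assoc)
      then show ?thesis
        using L moment_const_pos[of s 2] s H0 by (simp flip: ennreal_mult)
    qed
    finally have *: "(\<integral>\<^sup>+z. ennreal \<bar>indicator {0<..} (gap z) * ?F1 z\<bar> \<partial>lborel)
      \<le> ennreal (moment_const s 2 * L * R powr (- 2 * s) * H)" .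
    have nn: "0 \<le> moment_const s 2 * L * R powr (- 2 * s) * H"
      using L moment_const_pos[of s 2] s H0 by simp
    show "integrable lborel (\<lambda>z. indicator {0<..} (gap z) * ?F1 z)"
      by (rule integrable_of_nn_integral_le(1)[OF _ * nn]) measurable
    show "\<bar>LINT z|lborel. indicator {0<..} (gap z) * ?F1 z\<bar> \<le> moment_const s 2 * L * R powr (- 2 * s) * H"
      by (rule integrable_of_nn_integral_le(2)[OF _ * nn]) measurable
  qed
  have I3: "integrable lborel ?F3"
    by (rule integrable_far_test(3)[OF \<phi> g R(1)]) auto
  \<comment> \<open>Equal points \<open>\<phi> v g v\<close> cost \<open>2 h(v)\<close> and
    different points \<open>\<phi> v' g v\<close> cost \<open>h(v) + h(v')\<close>, which makes four
    integrals of \<open>h\<close>.\<close>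
  have B3: "\<bar>LINT z|lborel. ?F3 z\<bar> \<le> 4 * L * R powr (- 2 * s) * H"
  proof -
    let ?w = "\<lambda>z. indicator {R..} (gap z) * ennreal \<bar>A z\<bar> :: ennreal"
    let ?h1 = "\<lambda>v. ennreal (h v)"
    have "(\<integral>\<^sup>+z. ennreal \<bar>?F3 z\<bar> \<partial>lborel) \<le> (\<integral>\<^sup>+z. 2 * (?h1 (fst z) * ?w z) + (?h1 (fst z) * ?w z + ?h1 (snd z) * ?w z) \<partial>lborel)"
    proof (rule nn_integral_mono)
      fix z
      have "\<bar>(\<phi> (fst z) - \<phi> (snd z)) * g (fst z)\<bar> \<le> (\<bar>\<phi> (fst z)\<bar> + \<bar>\<phi> (snd z)\<bar>) * \<bar>g (fst z)\<bar>"
        unfolding abs_mult by (intro mult_right_mono abs_triangle_ineq4) auto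
      also have "\<dots> \<le> 2 * h (fst z) + (h (fst z) + h (snd z))"
        using \<phi>h[of "fst z" "fst z"] \<phi>h[of "snd z" "fst z"] by (simp add: distrib_right)
      finally have "ennreal (\<bar>A z\<bar> * \<bar>(\<phi> (fst z) - \<phi> (snd z)) * g (fst z)\<bar>)
          \<le> (ennreal (2 * h (fst z)) + ennreal (h (fst z) + h (snd z))) * ennreal \<bar>A z\<bar>"
        by (intro ennreal_weight_le) (auto simp: h0)
      then show "ennreal \<bar>?F3 z\<bar> \<le> 2 * (?h1 (fst z) * ?w z) + (?h1 (fst z) * ?w z + ?h1 (snd z) * ?w z)"
        by (cases "R \<le> gap z") (auto simp: h0 abs_mult ennreal_mult mult_ac distrib_left distrib_right)
    qed
    also have "\<dots> = 2 * (\<integral>\<^sup>+z. ?h1 (fst z) * ?w z \<partial>lborel) + ((\<integral>\<^sup>+z. ?h1 (fst z) * ?w z \<partial>lborel) + (\<integral>\<^sup>+z. ?h1 (snd z) * ?w z \<partial>lborel))"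
      by (simp add: nn_integral_add nn_integral_cmult)
    also have "\<dots> \<le> 2 * (ennreal (L * R powr (- 2 * s)) * ennreal H) + (ennreal (L * R powr (- 2 * s)) * ennreal H + ennreal (L * R powr (- 2 * s)) * ennreal H)"
      by (intro add_mono mult_left_mono order_trans[OF ktail_far(1)] order_trans[OF ktail_far(2)] hH)
         (use tail tail_swap R L hH in \<open>auto intro!: mult_left_mono\<close>)
    also have "\<dots> = 4 * (ennreal (L * R powr (- 2 * s)) * ennreal H)"
    proof -
      have "2 * e + (e + e) = 4 * e" for e :: ennreal
        by (simp flip: mult_2 distrib_right)
      then show ?thesis .
    qed
    also have "\<dots> = ennreal (4 * L * R powr (- 2 * s) * H)"
      using L H0 by (simp add: ennreal_mult mult.assoc)
    finally show ?thesis
      by (rule integrable_of_nn_integral_le(2)[rotated]) (use L H0 in auto)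
  qed
  \<comment> \<open>The coefficient of each coordinate of the linear part is a test function of the
    first variable alone, as \<open>pv1\<close> requires.\<close>
  have \<psi>: "test_function (\<lambda>v. grad \<phi> v b * g v)" for b
    by (intro test_function_mult test_function_grad \<phi> g)
  have "\<exists>l. ((\<lambda>\<epsilon>. LINT z|lborel. ?F2 \<epsilon> b z) \<longlongrightarrow> l) (at_right 0) \<and> \<bar>l\<bar> \<le> L * R powr (- 2 * s) * H"
    if b: "b \<in> Basis" for b
  proof -
    obtain l where l: "((\<lambda>\<epsilon>. LINT z|lborel. ?F2 \<epsilon> b z) \<longlongrightarrow> l) (at_right 0)"
      "\<bar>l\<bar> \<le> L * R powr (1 - 2 * s) * (LINT v|lborel. \<bar>grad \<phi> v b * g v\<bar>)"
      using pv1[OF R \<psi>[of b] b] by blast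
    have "(\<integral>\<^sup>+v. ennreal \<bar>grad \<phi> v b * g v\<bar> \<partial>lborel) \<le> (\<integral>\<^sup>+v. ennreal (1 / R) * ennreal (h v) \<partial>lborel)"
    proof (rule nn_integral_mono)
      fix v
      have "\<bar>grad \<phi> v b * g v\<bar> \<le> (1 / R) * (m v * \<bar>g v\<bar>)"
        using mult_right_mono[OF m1[OF b, of v] abs_ge_zero[of "g v"]] by (simp add: abs_mult)
      also have "\<dots> \<le> (1 / R) * h v" using R by (intro mult_left_mono mh) auto
      finally show "ennreal \<bar>grad \<phi> v b * g v\<bar> \<le> ennreal (1 / R) * ennreal (h v)"
        using R h0 by (subst ennreal_mult[symmetric]) (auto intro!: ennreal_leI)
    qed
    also have "\<dots> \<le> ennreal (1 / R) * ennreal H"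
      by (subst nn_integral_cmult) (auto intro!: mult_left_mono hH)
    also have "\<dots> = ennreal (H / R)" using R H0 by (simp flip: ennreal_mult)
    finally have "(LINT v|lborel. \<bar>grad \<phi> v b * g v\<bar>) \<le> H / R"
      by (rule integrable_of_nn_integral_le(3)[rotated]) (use R H0 in auto)
    then have "\<bar>l\<bar> \<le> L * R powr (1 - 2 * s) * (H / R)"
      using l(2) L by (meson mult_left_mono mult_nonneg_nonneg order_trans powr_ge_zero)
    also have "\<dots> = L * R powr (- 2 * s) * H"
      using R by (simp add: powr_diff powr_minus field_simps)
    finally show ?thesis using l(1) by blast
  qed
  then have "\<forall>b\<in>Basis. \<exists>l. ((\<lambda>\<epsilon>. LINT z|lborel. ?F2 \<epsilon> b z) \<longlongrightarrow> l) (at_right 0) \<and> \<bar>l\<bar> \<le> L * R powr (- 2 * s) * H"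
    by blast
  from bchoice[OF this] obtain l where l: "\<And>b. b \<in> Basis \<Longrightarrow> ((\<lambda>\<epsilon>. LINT z|lborel. ?F2 \<epsilon> b z) \<longlongrightarrow> l b) (at_right 0)"
     "\<And>b. b \<in> Basis \<Longrightarrow> \<bar>l b\<bar> \<le> L * R powr (- 2 * s) * H" by blast
  let ?l = "(LINT z|lborel. indicator {0<..} (gap z) * ?F1 z) + (\<Sum>b\<in>Basis. l b) + (LINT z|lborel. ?F3 z)"
  \<comment> \<open>For \<open>\<epsilon> < R\<close> the truncation does not reach the region
    beyond \<open>R\<close>, so that part is the same for all such
    \<open>\<epsilon>\<close>.\<close>
  have split: "skew_trunc \<epsilon> \<phi> g = (LINT z|lborel. indicator {\<epsilon><..} (gap z) * ?F1 z)
      + (\<Sum>b\<in>Basis. LINT z|lborel. ?F2 \<epsilon> b z) + (LINT z|lborel. ?F3 z)" if \<epsilon>: "0 < \<epsilon>" "\<epsilon> < R" for \<epsilon>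
  proof -
    have i1: "integrable lborel (\<lambda>z. indicator {\<epsilon><..} (gap z) * ?F1 z)"
    proof (rule Bochner_Integration.integrable_bound[OF I1])
      show "(\<lambda>z. indicator {\<epsilon><..} (gap z) * ?F1 z) \<in> borel_measurable lborel" by measurable
      show "AE z in lborel. norm (indicator {\<epsilon><..} (gap z) * ?F1 z) \<le> norm (indicator {0<..} (gap z) * ?F1 z)"
        unfolding real_norm_def by (rule AE_I2) (rule abs_truncation_mono[OF \<epsilon>(1)])
    qed
    have i2: "integrable lborel (?F2 \<epsilon> b)" if b: "b \<in> Basis" for b
    proof -
      have "integrable lborel (\<lambda>z. indicator {\<epsilon><..<R} (gap z) *
          ((indicator {\<epsilon><..<R} (gap z) * (grad \<phi> (fst z) b * g (fst z)) * ((fst z - snd z) \<bullet> b)) * A z))"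
      proof (rule integrable_far[OF _ integrable_mult_right[OF test_function_integrable[OF \<psi>[of b]], of R] _ \<epsilon>(1)])
        fix z :: "'a \<times> 'a"
        have "\<bar>(fst z - snd z) \<bullet> b\<bar> \<le> R" if "gap z < R"
          using Basis_le_norm[OF b, of "fst z - snd z"] that by (simp add: gap_def)
        then show "\<bar>indicator {\<epsilon><..<R} (gap z) * (grad \<phi> (fst z) b * g (fst z)) * ((fst z - snd z) \<bullet> b)\<bar>
          \<le> \<bar>R * (grad \<phi> (fst z) b * g (fst z))\<bar>"
          using R mult_left_mono[of "\<bar>(fst z - snd z) \<bullet> b\<bar>" R "\<bar>grad \<phi> (fst z) b * g (fst z)\<bar>"]
          by (cases "gap z \<in> {\<epsilon><..<R}") (auto simp: abs_mult mult.commute[of R])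
      qed auto
      moreover have "(\<lambda>z. indicator {\<epsilon><..<R} (gap z) *
          ((indicator {\<epsilon><..<R} (gap z) * (grad \<phi> (fst z) b * g (fst z)) * ((fst z - snd z) \<bullet> b)) * A z)) = ?F2 \<epsilon> b"
        by (auto simp: indicator_def mult_ac)
      ultimately show ?thesis by simp
    qed
    have i2s: "integrable lborel (\<lambda>z. \<Sum>b\<in>Basis. ?F2 \<epsilon> b z)"
      by (intro Bochner_Integration.integrable_sum i2)
    have sm: "(LINT z|lborel. (\<Sum>b\<in>Basis. ?F2 \<epsilon> b z)) = (\<Sum>b\<in>Basis. LINT z|lborel. ?F2 \<epsilon> b z)"
      by (intro Bochner_Integration.integral_sum i2)
    have "indicator {\<epsilon><..} (gap z) * ((\<phi> (fst z) - \<phi> (snd z)) * g (fst z) * A z)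
        = indicator {\<epsilon><..} (gap z) * ?F1 z + (\<Sum>b\<in>Basis. ?F2 \<epsilon> b z) + ?F3 z" for z
    proof (cases "gap z < R")
      case False
      then show ?thesis using \<epsilon> by (auto simp: indicator_def)
    next
      case True
      have "(\<Sum>b\<in>Basis. ?F2 \<epsilon> b z) = indicator {\<epsilon><..} (gap z) * ((\<Sum>b\<in>Basis. ((fst z - snd z) \<bullet> b) * grad \<phi> (fst z) b) * g (fst z) * A z)"
        using True unfolding sum_distrib_right sum_distrib_left
        by (intro sum.cong refl) (auto simp: indicator_def mult_ac)
      moreover have "indicator {..<R} (gap z) = (1::real)" "indicator {R..} (gap z) = (0::real)"
        using True by auto
      moreover have "i * ((a - b) * c * d) = i * (1 * ((a - b - S) * c * d)) + i * (S * c * d) + 0 * e"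
        for i a b c d S e :: real by (simp add: algebra_simps)
      ultimately show ?thesis by presburger
    qed
    then have "skew_trunc \<epsilon> \<phi> g = (LINT z|lborel. indicator {\<epsilon><..} (gap z) * ?F1 z + (\<Sum>b\<in>Basis. ?F2 \<epsilon> b z) + ?F3 z)"
      unfolding skew_trunc_def by (intro Bochner_Integration.integral_cong) auto
    also have "\<dots> = (LINT z|lborel. indicator {\<epsilon><..} (gap z) * ?F1 z)
      + (\<Sum>b\<in>Basis. LINT z|lborel. ?F2 \<epsilon> b z) + (LINT z|lborel. ?F3 z)"
      using Bochner_Integration.integral_add[OF Bochner_Integration.integrable_add[OF i1 i2s] I3]
        Bochner_Integration.integral_add[OF i1 i2s] sm by presburger
    finally show ?thesis .
  qed
  have "((\<lambda>\<epsilon>. (LINT z|lborel. indicator {\<epsilon><..} (gap z) * ?F1 z)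
      + (\<Sum>b\<in>Basis. LINT z|lborel. ?F2 \<epsilon> b z) + (LINT z|lborel. ?F3 z)) \<longlongrightarrow> ?l) (at_right 0)"
    by (intro tendsto_add tendsto_sum tendsto_const integral_truncated_tendsto I1 l(1)) measurable
  then have lim: "((\<lambda>\<epsilon>. skew_trunc \<epsilon> \<phi> g) \<longlongrightarrow> ?l) (at_right 0)"
    by (rule Lim_transform_eventually)
       (use R(1) split in \<open>auto simp: eventually_at_right_field intro!: exI[of _ R]\<close>)
  have "\<bar>\<Sum>b\<in>Basis. l b\<bar> \<le> (\<Sum>b\<in>(Basis::'a set). L * R powr (- 2 * s) * H)"
    by (rule order_trans[OF sum_abs]) (intro sum_mono l(2))
  then have "\<bar>\<Sum>b\<in>Basis. l b\<bar> \<le> real DIM('a) * L * R powr (- 2 * s) * H" by simp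
  then have "\<bar>?l\<bar> \<le> moment_const s 2 * L * R powr (- 2 * s) * H + real DIM('a) * L * R powr (- 2 * s) * H
      + 4 * L * R powr (- 2 * s) * H"
    using B1 B3 by linarith
  also have "\<dots> = scale_const TYPE('a) s * L * R powr (- 2 * s) * H"
    by (simp add: scale_const_def algebra_simps)
  finally show ?thesis using lim unfolding H_def by blast
qed

end

text \<open>Any single test function is smooth at scale 1, with a majorant not controlled by its
  norm. This suffices for the existence of limits and for L2-continuity in the other
  argument.\<close>

lemma ex_unit_scale_majorant:
  fixes \<phi> :: "'a::euclidean_space \<Rightarrow> real"
  assumes \<phi>: "test_function \<phi>"
  obtains m X where "m \<in> borel_measurable borel" "\<And>v. \<bar>\<phi> v\<bar> \<le> m v"
    "\<And>v b. b \<in> Basis \<Longrightarrow> \<bar>grad \<phi> v b\<bar> \<le> m v"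
    "\<And>v v'. norm (v' - v) < 1 \<Longrightarrow> \<bar>\<phi> v' - \<phi> v - grad \<phi> v (v' - v)\<bar> \<le> m v * (norm (v' - v))\<^sup>2"
    "(\<integral>\<^sup>+v. ennreal ((m v)\<^sup>2) \<partial>lborel) \<le> ennreal X" "X \<ge> 0"
proof -
  obtain A where A: "A > 0" "\<And>x. norm x > A \<Longrightarrow> \<phi> x = 0" using test_functionE[OF \<phi>] by metis
  obtain B where B: "B > 0" "\<And>x. \<bar>\<phi> x\<bar> \<le> B" using test_function_bounded[OF \<phi>] by metis
  obtain K where K: "K > 0" "\<And>x h. \<bar>grad \<phi> x h\<bar> \<le> K * norm h" using test_function_grad_bounded[OF \<phi>] by metis
  obtain T where T: "T > 0" "\<And>x y. \<bar>\<phi> y - \<phi> x - grad \<phi> x (y - x)\<bar> \<le> T * (norm (y - x))\<^sup>2"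
    using test_function_taylor[OF \<phi>] by metis
  define N where "N = B + K + T"
  \<comment> \<open>The margin 2 around the support ensures that outside the larger ball both
    \<open>v\<close> and every \<open>v'\<close> within distance 1 miss the support, so the Taylor
    remainder is 0 there.\<close>
  define m where "m v = N * indicator (ball 0 (A + 2)) v" for v :: 'a
  have N: "N > 0" using B K T by (simp add: N_def)
  have in_ball: "v \<in> ball 0 (A + 2) \<longleftrightarrow> norm v < A + 2" for v :: 'a by simp
  have sq: "(m v)\<^sup>2 = N\<^sup>2 * indicator (ball 0 (A + 2)) v" for v
    by (auto simp: m_def indicator_def power_mult_distrib)
  show ?thesis
  proof
    show "m \<in> borel_measurable borel" unfolding m_def by (intro borel_measurable_times borel_measurable_indicator) auto
    show "\<bar>\<phi> v\<bar> \<le> m v" for v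
      using A B(2)[of v] K T by (cases "norm v > A") (auto simp: m_def N_def indicator_def)
    show "\<bar>grad \<phi> v b\<bar> \<le> m v" if "b \<in> Basis" for v b
      using A K(2)[of v b] B T that grad_eq_0_outside[OF A(2), where x = v and h = b]
      by (cases "norm v > A") (auto simp: m_def N_def indicator_def)
    show "\<bar>\<phi> v' - \<phi> v - grad \<phi> v (v' - v)\<bar> \<le> m v * (norm (v' - v))\<^sup>2" if "norm (v' - v) < 1" for v v'
    proof (cases "norm v < A + 2")
      case True
      have "T * (norm (v' - v))\<^sup>2 \<le> N * (norm (v' - v))\<^sup>2"
        using B K by (intro mult_right_mono) (auto simp: N_def)
      then show ?thesis using T(2)[of v' v] True by (simp add: m_def)
    next
      case False
      then have "norm v > A" "norm v' > A"
        using that norm_triangle_ineq2[of v v'] by (auto simp: norm_minus_commute)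
      then show ?thesis using False A(2) grad_eq_0_outside[OF A(2), where x = v] by (simp add: m_def)
    qed
    have "(\<integral>\<^sup>+v. ennreal ((m v)\<^sup>2) \<partial>lborel) = ennreal (\<integral>v. (m v)\<^sup>2 \<partial>lborel)"
      unfolding sq using integral_ball_indicator(1)[of "A + 2" "0::'a"] A
      by (intro nn_integral_eq_integral integrable_mult_right) auto
    then show "(\<integral>\<^sup>+v. ennreal ((m v)\<^sup>2) \<partial>lborel) \<le> ennreal (\<integral>v. (m v)\<^sup>2 \<partial>lborel)" by simp
    show "(\<integral>v. (m v)\<^sup>2 \<partial>lborel) \<ge> 0" by simp
  qed
qed

lemma l2sq_le_of_majorant:
  assumes f: "test_function f" and m: "\<And>v. \<bar>f v\<bar> \<le> m v"
    and X: "(\<integral>\<^sup>+v. ennreal ((m v)\<^sup>2) \<partial>lborel) \<le> ennreal X" "X \<ge> 0"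
  shows "l2sq f \<le> X"
proof -
  have "ennreal (l2sq f) = (\<integral>\<^sup>+v. ennreal ((f v)\<^sup>2) \<partial>lborel)"
    using nn_l2sq[OF test_function_square_integrable[OF f]] by simp
  also have "\<dots> \<le> (\<integral>\<^sup>+v. ennreal ((m v)\<^sup>2) \<partial>lborel)"
  proof (intro nn_integral_mono ennreal_leI)
    fix v show "(f v)\<^sup>2 \<le> (m v)\<^sup>2" using power_mono[OF m[of v] abs_ge_zero, of 2] by simp
  qed
  also note X(1)
  finally show ?thesis using X(2) by simp
qed

lemma integral_linear_combination:
  fixes f g h :: "'a \<Rightarrow> real"
  assumes "integrable M f" "integrable M g" "\<And>x. h x = a * f x + b * g x"
  shows "integral\<^sup>L M h = a * integral\<^sup>L M f + b * integral\<^sup>L M g"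
proof -
  have "integral\<^sup>L M h = (\<integral>x. a * f x + b * g x \<partial>M)"
    by (rule Bochner_Integration.integral_cong) (simp_all add: assms(3))
  then show ?thesis using assms(1,2) by simp
qed

lemma integral_abs_mult_le:
  assumes "test_function f" "test_function g" "t > 0"
  shows "(LINT v|lborel. \<bar>f v * g v\<bar>) \<le> t * l2sq f + l2sq g / t"
proof -
  have "(LINT v|lborel. \<bar>f v * g v\<bar>) \<le> (LINT v|lborel. t * (f v)\<^sup>2 + (g v)\<^sup>2 / t)"
  proof (rule integral_mono)
    show "integrable lborel (\<lambda>v. \<bar>f v * g v\<bar>)"
      using assms by (intro integrable_abs test_function_integrable test_function_mult)
    show "integrable lborel (\<lambda>v. t * (f v)\<^sup>2 + (g v)\<^sup>2 / t)"
      using assms by (auto simp: test_function_square_integrable)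
    show "\<bar>f v * g v\<bar> \<le> t * (f v)\<^sup>2 + (g v)\<^sup>2 / t" for v
      using amgm_weighted[OF assms(3)] by (simp add: abs_mult)
  qed
  also have "\<dots> = t * l2sq f + l2sq g / t"
    using assms by (subst Bochner_Integration.integral_add) (auto simp: l2sq_def test_function_square_integrable)
  finally show ?thesis .
qed

context skew_kernel
begin

text \<open>The estimate at scale 1 is used here only for the existence of the limit.\<close>

lemma skew_form_tendsto:
  assumes \<phi>: "test_function \<phi>" and g: "test_function g"
  shows "((\<lambda>\<epsilon>. skew_trunc \<epsilon> \<phi> g) \<longlongrightarrow> skew_form \<phi> g) (at_right 0)"
proof -
  obtain m X where m: "m \<in> borel_measurable borel" "\<And>v. \<bar>\<phi> v\<bar> \<le> m v"
    "\<And>v b. b \<in> Basis \<Longrightarrow> \<bar>grad \<phi> v b\<bar> \<le> m v"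
    "\<And>v v'. norm (v' - v) < 1 \<Longrightarrow> \<bar>\<phi> v' - \<phi> v - grad \<phi> v (v' - v)\<bar> \<le> m v * (norm (v' - v))\<^sup>2"
    "(\<integral>\<^sup>+v. ennreal ((m v)\<^sup>2) \<partial>lborel) \<le> ennreal X" "X \<ge> 0"
    by (rule ex_unit_scale_majorant[OF \<phi>]) blast
  obtain l where l: "((\<lambda>\<epsilon>. skew_trunc \<epsilon> \<phi> g) \<longlongrightarrow> l) (at_right 0)"
    using skew_form_scale[OF \<phi> g zero_less_one order_refl m(1), of X "l2sq g" 1] m by auto
  moreover have "skew_form \<phi> g = l"
    unfolding skew_form_def by (rule tendsto_Lim[OF _ l]) simp
  ultimately show ?thesis by simp
qed

lemma skew_form_eqI:
  assumes "((\<lambda>\<epsilon>. skew_trunc \<epsilon> \<phi> g) \<longlongrightarrow> l) (at_right 0)"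
  shows "skew_form \<phi> g = l"
  unfolding skew_form_def by (rule tendsto_Lim[OF _ assms]) simp

lemma skew_form_scale_le:
  assumes "test_function \<phi>" "test_function g" "0 < R" "R \<le> 1" "m \<in> borel_measurable borel"
    "\<And>v. \<bar>\<phi> v\<bar> \<le> m v"
    "\<And>v b. b \<in> Basis \<Longrightarrow> \<bar>grad \<phi> v b\<bar> \<le> m v / R"
    "\<And>v v'. norm (v' - v) < R \<Longrightarrow> \<bar>\<phi> v' - \<phi> v - grad \<phi> v (v' - v)\<bar> \<le> m v * (norm (v' - v) / R)\<^sup>2"
    "(\<integral>\<^sup>+v. ennreal ((m v)\<^sup>2) \<partial>lborel) \<le> ennreal X" "X \<ge> 0" "l2sq g \<le> Y" "t > 0"
  shows "\<bar>skew_form \<phi> g\<bar> \<le> scale_const TYPE('a) s * L * R powr (- 2 * s) * (t * X + Y / t)"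
  using skew_form_scale[OF assms] skew_form_eqI by auto

lemma skew_form_linear_left:
  assumes "test_function \<phi>" "test_function \<psi>" "test_function g"
  shows "skew_form (\<lambda>v. a * \<phi> v + b * \<psi> v) g = a * skew_form \<phi> g + b * skew_form \<psi> g"
proof (rule skew_form_eqI)
  have "((\<lambda>\<epsilon>. a * skew_trunc \<epsilon> \<phi> g + b * skew_trunc \<epsilon> \<psi> g) \<longlongrightarrow> a * skew_form \<phi> g + b * skew_form \<psi> g) (at_right 0)"
    by (intro tendsto_intros skew_form_tendsto assms)
  moreover have "\<forall>\<^sub>F \<epsilon> in at_right 0. a * skew_trunc \<epsilon> \<phi> g + b * skew_trunc \<epsilon> \<psi> g = skew_trunc \<epsilon> (\<lambda>v. a * \<phi> v + b * \<psi> v) g"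
    using eventually_at_right_less[of 0]
  proof eventually_elim
    case (elim \<epsilon>)
    have J: "{\<epsilon><..} \<in> sets borel" "{\<epsilon><..} \<subseteq> {\<epsilon>..}" by auto
    note i = integrable_far_test(3)[OF assms(1,3) elim J] integrable_far_test(3)[OF assms(2,3) elim J]
    show ?case
      unfolding skew_trunc_def
      by (rule integral_linear_combination[OF i, symmetric]) (simp add: algebra_simps)
  qed
  ultimately show "((\<lambda>\<epsilon>. skew_trunc \<epsilon> (\<lambda>v. a * \<phi> v + b * \<psi> v) g) \<longlongrightarrow> a * skew_form \<phi> g + b * skew_form \<psi> g) (at_right 0)"
    by (rule Lim_transform_eventually)
qed

lemma skew_form_linear_right:
  assumes "test_function \<phi>" "test_function g" "test_function h"
  shows "skew_form \<phi> (\<lambda>v. a * g v + b * h v) = a * skew_form \<phi> g + b * skew_form \<phi> h"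
proof (rule skew_form_eqI)
  have "((\<lambda>\<epsilon>. a * skew_trunc \<epsilon> \<phi> g + b * skew_trunc \<epsilon> \<phi> h) \<longlongrightarrow> a * skew_form \<phi> g + b * skew_form \<phi> h) (at_right 0)"
    by (intro tendsto_intros skew_form_tendsto assms)
  moreover have "\<forall>\<^sub>F \<epsilon> in at_right 0. a * skew_trunc \<epsilon> \<phi> g + b * skew_trunc \<epsilon> \<phi> h = skew_trunc \<epsilon> \<phi> (\<lambda>v. a * g v + b * h v)"
    using eventually_at_right_less[of 0]
  proof eventually_elim
    case (elim \<epsilon>)
    have J: "{\<epsilon><..} \<in> sets borel" "{\<epsilon><..} \<subseteq> {\<epsilon>..}" by auto
    note i = integrable_far_test(3)[OF assms(1,2) elim J] integrable_far_test(3)[OF assms(1,3) elim J]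
    show ?case
      unfolding skew_trunc_def
      by (rule integral_linear_combination[OF i, symmetric]) (simp add: algebra_simps)
  qed
  ultimately show "((\<lambda>\<epsilon>. skew_trunc \<epsilon> \<phi> (\<lambda>v. a * g v + b * h v)) \<longlongrightarrow> a * skew_form \<phi> g + b * skew_form \<phi> h) (at_right 0)"
    by (rule Lim_transform_eventually)
qed

lemma skew_form_diff_left:
  "test_function \<phi> \<Longrightarrow> test_function \<psi> \<Longrightarrow> test_function g \<Longrightarrow>
    skew_form (\<lambda>v. \<phi> v - \<psi> v) g = skew_form \<phi> g - skew_form \<psi> g"
  using skew_form_linear_left[of \<phi> \<psi> g 1 "-1"] by simp

lemma skew_form_diff_right:
  "test_function \<phi> \<Longrightarrow> test_function g \<Longrightarrow> test_function h \<Longrightarrow>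
    skew_form \<phi> (\<lambda>v. g v - h v) = skew_form \<phi> g - skew_form \<phi> h"
  using skew_form_linear_right[of \<phi> g h 1 "-1"] by simp

text \<open>In \<open>(\<phi> - \<phi>')g + (g - g')\<phi> = 2\<phi>g - (\<phi>'g + g'\<phi>)\<close> the last bracket is symmetric and integrates
  to zero against the skew kernel.\<close>

lemma skew_form_flip:
  assumes \<phi>: "test_function \<phi>" and g: "test_function g"
  shows "\<bar>skew_form \<phi> g\<bar> \<le> \<bar>skew_form g \<phi>\<bar> + 2 * L * (LINT v|lborel. \<bar>\<phi> v * g v\<bar>)"
proof -
  have [measurable]: "\<phi> \<in> borel_measurable borel" "g \<in> borel_measurable borel"
    using \<phi> g test_function_measurable by auto
  obtain l where l: "((\<lambda>\<epsilon>. LINT z|lborel. indicator {\<epsilon><..} (gap z) * ((\<phi> (fst z) * g (fst z)) * A z)) \<longlongrightarrow> l) (at_right 0)"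
      "\<bar>l\<bar> \<le> L * (LINT v|lborel. \<bar>\<phi> v * g v\<bar>)"
    using pv0[OF test_function_mult[OF \<phi> g]] by blast
  have "((\<lambda>\<epsilon>. 2 * (LINT z|lborel. indicator {\<epsilon><..} (gap z) * ((\<phi> (fst z) * g (fst z)) * A z)) - skew_trunc \<epsilon> g \<phi>)
      \<longlongrightarrow> 2 * l - skew_form g \<phi>) (at_right 0)"
    by (intro tendsto_intros l(1) skew_form_tendsto \<phi> g)
  moreover have "\<forall>\<^sub>F \<epsilon> in at_right 0. 2 * (LINT z|lborel. indicator {\<epsilon><..} (gap z) * ((\<phi> (fst z) * g (fst z)) * A z)) - skew_trunc \<epsilon> g \<phi>
      = skew_trunc \<epsilon> \<phi> g"
    using eventually_at_right_less[of 0]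
  proof eventually_elim
    case (elim \<epsilon>)
    let ?i = "\<lambda>z. indicator {\<epsilon><..} (gap z) :: real"
    have J: "{\<epsilon><..} \<in> sets borel" "{\<epsilon><..} \<subseteq> {\<epsilon>..}" by auto
    note i = integrable_far_test(1)[OF \<phi> g elim J] integrable_far_test(2)[OF \<phi> g elim J]
      integrable_far_test(1)[OF g \<phi> elim J] integrable_far_test(2)[OF g \<phi> elim J]
    have sw: "(LINT z|lborel. ?i z * ((\<phi> (snd z) * g (fst z)) * A z)) = - (LINT z|lborel. ?i z * ((g (snd z) * \<phi> (fst z)) * A z))"
      by (subst integral_swap[symmetric]) (simp_all add: A_swap mult.commute[of "\<phi> _"])
    have 1: "skew_trunc \<epsilon> \<phi> g = (LINT z|lborel. ?i z * ((\<phi> (fst z) * g (fst z)) * A z)) - (LINT z|lborel. ?i z * ((\<phi> (snd z) * g (fst z)) * A z))"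
      unfolding skew_trunc_def by (subst Bochner_Integration.integral_diff[symmetric])
        (use i in \<open>auto intro!: Bochner_Integration.integral_cong simp: algebra_simps\<close>)
    have 2: "skew_trunc \<epsilon> g \<phi> = (LINT z|lborel. ?i z * ((\<phi> (fst z) * g (fst z)) * A z)) - (LINT z|lborel. ?i z * ((g (snd z) * \<phi> (fst z)) * A z))"
      unfolding skew_trunc_def by (subst Bochner_Integration.integral_diff[symmetric])
        (use i in \<open>auto intro!: Bochner_Integration.integral_cong simp: algebra_simps\<close>)
    show ?case unfolding 1 2 using sw by simp
  qed
  ultimately have "((\<lambda>\<epsilon>. skew_trunc \<epsilon> \<phi> g) \<longlongrightarrow> 2 * l - skew_form g \<phi>) (at_right 0)"
    by (rule Lim_transform_eventually)
  then have "skew_form \<phi> g = 2 * l - skew_form g \<phi>" by (rule skew_form_eqI)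
  then show ?thesis using l(2) by linarith
qed

end

section \<open>Frequency decomposition and summation over pairs of scales\<close>

lemma sum_geometric_below:
  fixes q :: real and n :: nat
  assumes q: "0 < q" "q < 1"
  shows "(\<Sum>i<n. q ^ (n - i)) \<le> 1 / (1 - q)"
proof -
  have "(\<Sum>i<n. q ^ (n - i)) = (\<Sum>i\<in>{1..n}. q ^ i)"
    by (rule sum.reindex_bij_witness[of _ "\<lambda>i. n - i" "\<lambda>i. n - i"]) auto
  also have "\<dots> \<le> (\<Sum>i<Suc n. q ^ i)" using q by (intro sum_mono2) auto
  also have "\<dots> = (1 - q ^ Suc n) / (1 - q)" using q by (subst sum_gp_strict) auto
  also have "\<dots> \<le> 1 / (1 - q)" using q by (intro divide_right_mono) auto
  finally show ?thesis .
qed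

text \<open>A discrete Schur test: the weights \<open>q^(j-i)\<close> with \<open>i < j\<close> have
  row and column sums at most \<open>1 / (1 - q)\<close>.\<close>

lemma sum_triangle_le:
  fixes q :: real and x y :: "nat \<Rightarrow> real"
  assumes q: "0 < q" "q < 1" and x: "\<And>i. x i \<ge> 0" and y: "\<And>i. y i \<ge> 0"
  shows "(\<Sum>j<n. \<Sum>i<j. q ^ (j - i) * (x i + y j)) \<le> 1 / (1 - q) * ((\<Sum>i<n. x i) + (\<Sum>j<n. y j))"
proof -
  have "(\<Sum>j<n. \<Sum>i<j. q ^ (j - i) * y j) \<le> (\<Sum>j<n. 1 / (1 - q) * y j)"
    unfolding sum_distrib_right[symmetric]
    by (intro sum_mono mult_right_mono sum_geometric_below q y)
  \<comment> \<open>The second sum is the part of each geometric series not yet reached. For fixed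
    \<open>i\<close> the total coefficient of \<open>x i\<close> telescopes to \<open>q\<close>, so
    the left side is preserved up to a new term \<open>q * x n\<close> in the induction.\<close>
  moreover have "(1 - q) * (\<Sum>j<n. \<Sum>i<j. q ^ (j - i) * x i) + (\<Sum>i<n. q ^ (n - i) * x i) \<le> (\<Sum>i<n. x i)"
  proof (induction n)
    case (Suc n)
    have "(\<Sum>i<n. q ^ (Suc n - i) * x i) = q * (\<Sum>i<n. q ^ (n - i) * x i)"
      unfolding sum_distrib_left by (intro sum.cong refl) (auto simp: Suc_diff_le)
    then have "(1 - q) * (\<Sum>j<Suc n. \<Sum>i<j. q ^ (j - i) * x i) + (\<Sum>i<Suc n. q ^ (Suc n - i) * x i)
      = ((1 - q) * (\<Sum>j<n. \<Sum>i<j. q ^ (j - i) * x i) + (\<Sum>i<n. q ^ (n - i) * x i)) + q * x n"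
      by (simp add: algebra_simps)
    also have "\<dots> \<le> (\<Sum>i<n. x i) + x n"
      using Suc.IH q x[of n] mult_left_le_one_le[of "x n" q] by (intro add_mono) auto
    finally show ?case by simp
  qed simp
  moreover have "(\<Sum>i<n. q ^ (n - i) * x i) \<ge> 0" using q x by (intro sum_nonneg) auto
  ultimately have Y: "(\<Sum>j<n. \<Sum>i<j. q ^ (j - i) * y j) \<le> 1 / (1 - q) * (\<Sum>j<n. y j)"
    and X: "(1 - q) * (\<Sum>j<n. \<Sum>i<j. q ^ (j - i) * x i) \<le> (\<Sum>i<n. x i)"
    by (simp_all only: sum_distrib_left[of "1 / (1 - q)"])
  have "(\<Sum>j<n. \<Sum>i<j. q ^ (j - i) * x i) \<le> 1 / (1 - q) * (\<Sum>i<n. x i)"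
    using X q by (simp only: pos_le_divide_eq[of "1 - q"] diff_gt_0_iff_gt mult.commute times_divide_eq_right mult_1_right)
  with Y show ?thesis
    by (simp only: distrib_left sum.distrib add_mono)
qed

text \<open>Integral over \<open>v\<close> of the square of \<open>2 C\<close> times the root of the
  oscillation at scale \<open>2^(-j)\<close>; the 2 counts the two mollifications in a dyadic
  difference.\<close>

definition majorant :: "real \<Rightarrow> nat \<Rightarrow> ('a::euclidean_space \<Rightarrow> real) \<Rightarrow> real" where
  "majorant C j f = 4 * C\<^sup>2 * oscint (1 / 2 ^ j) f"

lemma majorant_nonneg [simp]: "majorant C j f \<ge> 0"
  by (simp add: majorant_def)

locale mollified_skew = skew_kernel A s L + mollifier \<rho>
  for A :: "'a::euclidean_space \<times> 'a \<Rightarrow> real" and s L :: real and \<rho> :: "'a \<Rightarrow> real" +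
  fixes C :: real
  assumes C: "mollify_const \<rho> C"
begin

text \<open>Substitutes for the Littlewood-Paley projections: \<open>P j\<close> keeps frequencies
  up to about \<open>2^j\<close>, and the differences \<open>Q j\<close> are the bands. Only their
  size and smoothness at scale \<open>2^(-j)\<close> are used.\<close>

definition P :: "nat \<Rightarrow> ('a \<Rightarrow> real) \<Rightarrow> 'a \<Rightarrow> real" where
  "P j f = conv (scaled \<rho> (1 / 2 ^ j)) f"

definition Q :: "nat \<Rightarrow> ('a \<Rightarrow> real) \<Rightarrow> 'a \<Rightarrow> real" where
  "Q j f v = P (Suc j) f v - P j f v"

lemma C_pos: "C > 0"
  using C by (simp add: mollify_const_def)

lemma test_P: "test_function f \<Longrightarrow> test_function (P j f)"
  using test_function_mollify[of "1 / 2 ^ j" f] by (simp add: P_def mollify_def)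

lemma test_Q: "test_function f \<Longrightarrow> test_function (Q j f)"
  unfolding Q_def[abs_def] by (intro test_function_diff test_P)

lemma P_bounds:
  assumes f: "test_function f" and i: "i = j \<or> i = Suc j"
  shows "\<bar>P i f v - c\<bar> \<le> C * sqrt (osc (1 / 2 ^ j) c f v)"
    and "\<bar>grad (P i f) v h\<bar> \<le> C * (norm h / (1 / 2 ^ j)) * sqrt (osc (1 / 2 ^ j) c f v)"
    and "norm (v' - v) < 1 / 2 ^ j \<Longrightarrow> \<bar>P i f v' - P i f v - grad (P i f) v (v' - v)\<bar>
      \<le> C * (norm (v' - v) / (1 / 2 ^ j))\<^sup>2 * sqrt (osc (1 / 2 ^ j) c f v)"
proof -
  have R: "(1 / 2 ^ j :: real) > 0" by simp
  have r: "1 / 2 ^ i \<in> {1 / 2 ^ j / 2..1 / 2 ^ j :: real}" using i by (auto simp: field_simps)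
  show "\<bar>P i f v - c\<bar> \<le> C * sqrt (osc (1 / 2 ^ j) c f v)"
    and "\<bar>grad (P i f) v h\<bar> \<le> C * (norm h / (1 / 2 ^ j)) * sqrt (osc (1 / 2 ^ j) c f v)"
    and "norm (v' - v) < 1 / 2 ^ j \<Longrightarrow> \<bar>P i f v' - P i f v - grad (P i f) v (v' - v)\<bar>
      \<le> C * (norm (v' - v) / (1 / 2 ^ j))\<^sup>2 * sqrt (osc (1 / 2 ^ j) c f v)"
    using C R r f unfolding mollify_const_def P_def by blast+
qed

definition maj :: "nat \<Rightarrow> ('a \<Rightarrow> real) \<Rightarrow> 'a \<Rightarrow> real" where
  "maj j f v = 2 * C * sqrt (osc (1 / 2 ^ j) (f v) f v)"

lemma maj_measurable: "test_function f \<Longrightarrow> maj j f \<in> borel_measurable borel"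
  unfolding maj_def using test_function_measurable[of f] by measurable

lemma nn_maj:
  assumes f: "test_function f"
  shows "(\<integral>\<^sup>+v. ennreal ((maj j f v)\<^sup>2) \<partial>lborel) = ennreal (majorant C j f)"
proof -
  have [measurable]: "f \<in> borel_measurable borel" by (rule test_function_measurable[OF f])
  have "(\<integral>\<^sup>+v. ennreal ((maj j f v)\<^sup>2) \<partial>lborel) = (\<integral>\<^sup>+v. ennreal (4 * C\<^sup>2) * ennreal (osc (1 / 2 ^ j) (f v) f v) \<partial>lborel)"
    by (intro nn_integral_cong) (simp add: maj_def power_mult_distrib flip: ennreal_mult)
  also have "\<dots> = ennreal (4 * C\<^sup>2) * ennreal (oscint (1 / 2 ^ j) f)"
    by (subst nn_integral_cmult) (auto simp: nn_integral_osc[OF f s])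
  finally show ?thesis by (simp add: majorant_def flip: ennreal_mult)
qed

lemma diff_P_le_maj:
  assumes f: "test_function f"
  shows "\<bar>f v - P j f v\<bar> \<le> maj j f v"
proof -
  have "\<bar>P j f v - f v\<bar> \<le> C * sqrt (osc (1 / 2 ^ j) (f v) f v)" by (rule P_bounds(1)[OF f]) simp
  also have "\<dots> \<le> maj j f v" using C_pos by (auto simp: maj_def intro!: mult_right_mono)
  finally show ?thesis by (simp add: abs_minus_commute)
qed

lemma Q_le_maj:
  assumes f: "test_function f"
  shows "\<bar>Q j f v\<bar> \<le> maj j f v"
    and "b \<in> Basis \<Longrightarrow> \<bar>grad (Q j f) v b\<bar> \<le> maj j f v / (1 / 2 ^ j)"
    and "norm (v' - v) < 1 / 2 ^ j \<Longrightarrow> \<bar>Q j f v' - Q j f v - grad (Q j f) v (v' - v)\<bar>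
      \<le> maj j f v * (norm (v' - v) / (1 / 2 ^ j))\<^sup>2"
proof -
  have g: "grad (Q j f) v h = grad (P (Suc j) f) v h - grad (P j f) v h" for h
    unfolding Q_def[abs_def]
    using grad_eqI[OF has_derivative_diff[OF test_function_has_derivative[OF test_P[OF f]] test_function_has_derivative[OF test_P[OF f]]]]
    by metis
  show "\<bar>Q j f v\<bar> \<le> maj j f v"
    using P_bounds(1)[OF f, of j j v "f v"] P_bounds(1)[OF f, of "Suc j" j v "f v"]
    unfolding Q_def maj_def by linarith
  show "\<bar>grad (Q j f) v b\<bar> \<le> maj j f v / (1 / 2 ^ j)" if "b \<in> Basis"
    using P_bounds(2)[OF f, of j j v b "f v"] P_bounds(2)[OF f, of "Suc j" j v b "f v"] that
    unfolding g maj_def by (simp add: mult_ac)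
  show "\<bar>Q j f v' - Q j f v - grad (Q j f) v (v' - v)\<bar> \<le> maj j f v * (norm (v' - v) / (1 / 2 ^ j))\<^sup>2"
    if n: "norm (v' - v) < 1 / 2 ^ j"
  proof -
    let ?N = "(norm (v' - v) / (1 / 2 ^ j))\<^sup>2" and ?S = "sqrt (osc (1 / 2 ^ j) (f v) f v)"
    have "\<bar>P (Suc j) f v' - P (Suc j) f v - grad (P (Suc j) f) v (v' - v)\<bar> \<le> C * ?N * ?S"
      by (rule P_bounds(3)[OF f _ n]) simp
    moreover have "\<bar>P j f v' - P j f v - grad (P j f) v (v' - v)\<bar> \<le> C * ?N * ?S"
      by (rule P_bounds(3)[OF f _ n]) simp
    ultimately have "\<bar>Q j f v' - Q j f v - grad (Q j f) v (v' - v)\<bar> \<le> 2 * (C * ?N * ?S)"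
      unfolding g Q_def by linarith
    then show ?thesis by (simp add: maj_def mult_ac)
  qed
qed

lemma powr_scale: "(1 / 2 ^ j) powr (- 2 * s) = 2 powr (2 * s * real j)"
  by (simp add: powr_divide powr_minus powr_powr mult_ac flip: powr_realpow)

text \<open>The band \<open>Q j f\<close> is smooth at scale \<open>2^(-j)\<close> with majorant
  \<open>maj j f\<close>, so the operator costs \<open>2^(2sj)\<close> while \<open>g\<close> enters
  through its L2 norm only.\<close>

lemma skew_form_Q_le:
  assumes f: "test_function f" and g: "test_function g" and Y: "l2sq g \<le> Y" and t: "t > 0"
  shows "\<bar>skew_form (Q j f) g\<bar> \<le> scale_const TYPE('a) s * L * 2 powr (2 * s * real j) * (t * majorant C j f + Y / t)"
  unfolding powr_scale[symmetric]
  by (rule skew_form_scale_le[OF test_Q[OF f] g _ _ maj_measurable[OF f]])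
     (use Q_le_maj[OF f] nn_maj[OF f] Y t in auto)

lemma l2sq_Q: "test_function f \<Longrightarrow> l2sq (Q j f) \<le> majorant C j f"
  by (rule l2sq_le_of_majorant[OF test_Q Q_le_maj(1)]) (auto simp: nn_maj)

text \<open>The entire high-frequency part above scale \<open>2^(-j)\<close> is controlled by the
  oscillation at that one scale, so it can be paired with a band without splitting it
  further.\<close>

lemma l2sq_diff_P: "test_function f \<Longrightarrow> l2sq (\<lambda>v. f v - P j f v) \<le> majorant C j f"
  by (rule l2sq_le_of_majorant[OF test_function_diff[OF _ test_P] diff_P_le_maj]) (auto simp: nn_maj)

text \<open>Counterpart of \<open>majorant\<close> for the lowest frequency, with
  \<open>c = 0\<close> in the oscillation: the squared majorant of \<open>P 0 f\<close> integrates
  to \<open>base * l2sq f\<close>.\<close>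

definition base :: real where "base = C\<^sup>2 * (2 ^ DIM('a) * measure lborel (ball (0::'a) 1))"

lemma base_nonneg: "base \<ge> 0"
  by (auto simp: base_def)

lemma nn_base:
  fixes f :: "'a \<Rightarrow> real"
  assumes f: "test_function f"
  shows "(\<integral>\<^sup>+v. ennreal ((C * sqrt (osc 1 0 f v))\<^sup>2) \<partial>lborel) = ennreal (base * l2sq f)"
proof -
  have [measurable]: "f \<in> borel_measurable borel" by (rule test_function_measurable[OF f])
  have "(\<integral>\<^sup>+v. ennreal ((C * sqrt (osc 1 0 f v))\<^sup>2) \<partial>lborel) = (\<integral>\<^sup>+v. ennreal (C\<^sup>2) * ennreal (osc 1 0 f v) \<partial>lborel)"
    by (intro nn_integral_cong) (simp add: power_mult_distrib flip: ennreal_mult)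
  also have "\<dots> = ennreal (C\<^sup>2) * ennreal (2 ^ DIM('a) * measure lborel (ball (0::'a) 1) * l2sq f)"
    by (subst nn_integral_cmult) (auto simp: nn_integral_osc_0[OF f])
  finally show ?thesis by (simp add: base_def mult_ac flip: ennreal_mult)
qed

text \<open>At unit scale the comparison constant in the oscillation is 0, because the lowest
  frequency is measured by the L2 norm and not by an increment.\<close>

lemma skew_form_P0_le:
  assumes f: "test_function f" and g: "test_function g" and Y: "l2sq g \<le> Y" and t: "t > 0"
  shows "\<bar>skew_form (P 0 f) g\<bar> \<le> scale_const TYPE('a) s * L * (t * (base * l2sq f) + Y / t)"
proof -
  have [measurable]: "f \<in> borel_measurable borel" by (rule test_function_measurable[OF f])
  have gr: "\<bar>grad (P 0 f) v b\<bar> \<le> C * sqrt (osc 1 0 f v) / 1" if "b \<in> Basis" for v b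
    using P_bounds(2)[OF f, of 0 0 v b 0] that by simp
  have "\<bar>skew_form (P 0 f) g\<bar> \<le> scale_const TYPE('a) s * L * 1 powr (- 2 * s) * (t * (base * l2sq f) + Y / t)"
    by (rule skew_form_scale_le[OF test_P[OF f] g, where m = "\<lambda>v. C * sqrt (osc 1 0 f v)"])
       (use P_bounds(1)[OF f, of 0 0 _ 0] gr P_bounds(3)[OF f, of 0 0 _ _ 0]
          nn_base[OF f] base_nonneg Y t in \<open>auto simp: mult_ac \<close>)
  then show ?thesis by simp
qed

lemma l2sq_P0: "test_function f \<Longrightarrow> l2sq (P 0 f) \<le> base * l2sq f"
  by (rule l2sq_le_of_majorant[OF test_P, where m = "\<lambda>v. C * sqrt (osc 1 0 f v)"])
     (use P_bounds(1)[of f 0 0 _ 0] base_nonneg in \<open>auto simp: nn_base\<close>)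

lemma skew_form_telescope_right:
  assumes f: "test_function f" and g: "test_function g"
  shows "skew_form f (P n g) = skew_form f (P 0 g) + (\<Sum>j<n. skew_form f (Q j g))"
proof (induction n)
  case (Suc n)
  have "skew_form f (Q n g) = skew_form f (P (Suc n) g) - skew_form f (P n g)"
    unfolding Q_def[abs_def] by (rule skew_form_diff_right) (intro f test_P g)+
  then show ?case using Suc by simp
qed simp

lemma skew_form_telescope_left:
  assumes f: "test_function f" and g: "test_function g"
  shows "skew_form (P n f) g = skew_form (P 0 f) g + (\<Sum>j<n. skew_form (Q j f) g)"
proof (induction n)
  case (Suc n)
  have "skew_form (Q n f) g = skew_form (P (Suc n) f) g - skew_form (P n f) g"
    unfolding Q_def[abs_def] by (rule skew_form_diff_left) (intro g test_P f)+
  then show ?case using Suc by simp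
qed simp

definition geo :: real where "geo = 1 / (1 - 2 powr (- s))"

lemma geo: "0 < (2::real) powr (- s)" "2 powr (- s) < 1" "geo > 0"
  using s(1) powr_less_one[of 2 "- s"] by (auto simp: geo_def)

lemma sum_majorant_le:
  fixes f :: "'a \<Rightarrow> real"
  assumes f: "test_function f"
  shows "(\<Sum>j<n. 2 powr (2 * s * real j) * majorant C j f) \<le> 4 * C\<^sup>2 * square_fun_const TYPE('a) s * gag s f"
proof -
  have "(\<Sum>j<n. 2 powr (2 * s * real j) * majorant C j f)
    = 4 * C\<^sup>2 * (\<Sum>j<n. 2 powr (2 * s * real j) * oscint (1 / 2 ^ j) f)"
    unfolding sum_distrib_left by (intro sum.cong refl) (simp add: majorant_def)
  also have "\<dots> \<le> 4 * C\<^sup>2 * (square_fun_const TYPE('a) s * gag s f)"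
    by (intro mult_left_mono sum_oscint_le borel_Hs_test f s) auto
  finally show ?thesis by (simp add: mult_ac)
qed

text \<open>The summand 2 accounts for the transposition error. The terms with \<open>base\<close>
  belong to the lowest frequencies. Of the \<open>2 + geo\<close> square-function constants, one
  comes from the high part of \<open>f\<close>, one from the pairing with \<open>P 0 f\<close>, and
  \<open>geo\<close> from the pairs of bands.\<close>

definition total :: real where
  "total = (scale_const TYPE('a) s + 2) *
    (1 + base + geo * base + (2 + geo) * (4 * C\<^sup>2 * square_fun_const TYPE('a) s))"

text \<open>High frequencies of \<open>g\<close> are tested against low frequencies of \<open>f\<close>, on which the operator acts;
  the complementary part is transposed.\<close>

lemma skew_form_P_le:
  assumes f: "test_function f" and g: "test_function g"
  shows "\<bar>skew_form f (P n g)\<bar> \<le> total * L * (hs2 s f + hs2 s g)"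
proof -
  let ?c = "scale_const TYPE('a) s" and ?q = "2 powr (- s) :: real" and ?a = "4 * C\<^sup>2 * square_fun_const TYPE('a) s"
  \<comment> \<open>The weighted band energies, whose sums over \<open>j\<close> are bounded by the
    Gagliardo seminorms.\<close>
  define x y where "x j = 2 powr (2 * s * real j) * majorant C j f"
    and "y j = 2 powr (2 * s * real j) * majorant C j g" for j
  have c: "?c > 0" using s scale_const_pos by blast
  have cL: "?c * L \<ge> 0" using c L by simp
  have x0: "x j \<ge> 0" and y0: "y j \<ge> 0" for j by (auto simp: x_def y_def)
  have sf0: "0 \<le> square_fun_const TYPE('a) s" using square_fun_const_pos[OF s(1), where 'a='a] by simp
  have a0: "?a \<ge> 0" using square_fun_const_pos[OF s(1), where 'a='a] by simp
  note lf = l2sq_nonneg[of f] and lg = l2sq_nonneg[of g] and gf = gag_nonneg[of s f] and gg = gag_nonneg[of s g]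
  have pw: "1 \<le> 2 powr (2 * s * real j)" for j
    using s(1) by (intro ge_one_powr_ge_zero) auto
  have mx: "majorant C j f \<le> x j" and my: "majorant C j g \<le> y j" for j
    using mult_right_mono[OF pw majorant_nonneg, of C j f] mult_right_mono[OF pw majorant_nonneg, of C j g]
    by (auto simp: x_def y_def)
  have sx: "(\<Sum>j<n. x j) \<le> ?a * gag s f" and sy: "(\<Sum>j<n. y j) \<le> ?a * gag s g"
    unfolding x_def y_def using sum_majorant_le[OF f] sum_majorant_le[OF g] by auto
  \<comment> \<open>Transposed, so that the operator acts on the smooth function
    \<open>P 0 g\<close> and the rough \<open>f\<close> is seen in L2.\<close>
  have b0: "\<bar>skew_form f (P 0 g)\<bar> \<le> (?c + 2) * L * (l2sq f + base * l2sq g)"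
  proof -
    have "\<bar>skew_form f (P 0 g)\<bar> \<le> \<bar>skew_form (P 0 g) f\<bar> + 2 * L * (LINT v|lborel. \<bar>f v * P 0 g v\<bar>)"
      by (rule skew_form_flip[OF f test_P[OF g]])
    also have "\<dots> \<le> ?c * L * (1 * (base * l2sq g) + l2sq f / 1) + 2 * L * (1 * l2sq f + l2sq (P 0 g) / 1)"
      using L by (intro add_mono skew_form_P0_le[OF g f] mult_left_mono integral_abs_mult_le f test_P g) auto
    also have "\<dots> \<le> ?c * L * (base * l2sq g + l2sq f) + 2 * L * (l2sq f + base * l2sq g)"
      using L cL l2sq_P0[OF g] by (intro add_mono mult_left_mono) auto
    finally show ?thesis by (simp add: algebra_simps)
  qed
  \<comment> \<open>All frequencies of \<open>f\<close> above \<open>j\<close> against the band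
    \<open>j\<close> of \<open>g\<close>: transposing lets the operator act on \<open>Q j g\<close>,
    the lower one, and both factors are measured at the same scale with
    \<open>t = 1\<close>.\<close>
  have b1: "\<bar>skew_form (\<lambda>v. f v - P j f v) (Q j g)\<bar> \<le> (?c + 2) * L * (x j + y j)" for j
  proof -
    let ?d = "\<lambda>v. f v - P j f v"
    have d: "test_function ?d" by (intro test_function_diff f test_P)
    have "\<bar>skew_form ?d (Q j g)\<bar> \<le> \<bar>skew_form (Q j g) ?d\<bar> + 2 * L * (LINT v|lborel. \<bar>?d v * Q j g v\<bar>)"
      by (rule skew_form_flip[OF d test_Q[OF g]])
    also have "\<dots> \<le> ?c * L * 2 powr (2 * s * real j) * (1 * majorant C j g + majorant C j f / 1)
        + 2 * L * (1 * l2sq ?d + l2sq (Q j g) / 1)"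
      using L by (intro add_mono skew_form_Q_le[OF g d] mult_left_mono integral_abs_mult_le d test_Q g l2sq_diff_P f) auto
    also have "\<dots> \<le> ?c * L * 2 powr (2 * s * real j) * (majorant C j g + majorant C j f) + 2 * L * (x j + y j)"
      using L cL l2sq_Q[OF g, of j] l2sq_diff_P[OF f, of j] mx[of j] my[of j] by (intro add_mono mult_left_mono) auto
    also have "\<dots> = (?c + 2) * L * (x j + y j)" by (simp add: x_def y_def algebra_simps)
    finally show ?thesis .
  qed
  \<comment> \<open>The choice \<open>t = 2^(-2sj)\<close> turns the energy of \<open>Q j g\<close>
    into \<open>y j\<close> and leaves a summable factor on the lowest frequency of
    \<open>f\<close>.\<close>
  have b2: "\<bar>skew_form (P 0 f) (Q j g)\<bar> \<le> ?c * L * (?q ^ j * (base * l2sq f) + y j)" for j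
  proof -
    have "\<bar>skew_form (P 0 f) (Q j g)\<bar> \<le> ?c * L * (2 powr (- 2 * s * real j) * (base * l2sq f) + majorant C j g / 2 powr (- 2 * s * real j))"
      by (rule skew_form_P0_le[OF f test_Q[OF g] l2sq_Q[OF g]]) simp
    also have "majorant C j g / 2 powr (- 2 * s * real j) = y j"
      by (simp add: y_def powr_minus field_simps)
    also have "?c * L * (2 powr (- 2 * s * real j) * (base * l2sq f) + y j) \<le> ?c * L * (?q ^ j * (base * l2sq f) + y j)"
    proof (intro mult_left_mono add_right_mono mult_right_mono)
      have "2 powr (- 2 * s * real j) \<le> 2 powr (- s * real j)" using s(1) by (intro powr_mono) (auto simp: mult_right_mono)
      also have "\<dots> = ?q ^ j" by (simp add: powr_powr flip: powr_realpow)
      finally show "2 powr (- 2 * s * real j) \<le> ?q ^ j" .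
    qed (use cL base_nonneg in auto)
    finally show ?thesis .
  qed
  \<comment> \<open>The choice \<open>t = 2^(-s(j-i))\<close> balances the two terms:
    \<open>2^(2si) / t = t 2^(2sj)\<close>, so both weighted energies receive the same gain
    \<open>t\<close>.\<close>
  have b3: "\<bar>skew_form (Q i f) (Q j g)\<bar> \<le> ?c * L * (?q ^ (j - i) * (x i + y j))" if ij: "i < j" for i j
  proof -
    let ?t = "2 powr (- s * (real j - real i)) :: real"
    have t: "?t > 0" by simp
    have "\<bar>skew_form (Q i f) (Q j g)\<bar> \<le> ?c * L * (2 powr (2 * s * real i) * (?t * majorant C i f + majorant C j g / ?t))"
      using skew_form_Q_le[OF f test_Q[OF g] l2sq_Q[OF g] t, of i j] by (simp only: mult.assoc)
    also have "2 powr (2 * s * real i) * (?t * majorant C i f + majorant C j g / ?t) = ?t * (x i + y j)"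
    proof -
      have "2 powr (2 * s * real i) / ?t = ?t * 2 powr (2 * s * real j)"
        by (simp add: powr_diff[symmetric] powr_add[symmetric] algebra_simps)
      moreover have "2 powr (2 * s * real i) * (majorant C j g / ?t) = 2 powr (2 * s * real i) / ?t * majorant C j g"
        by simp
      ultimately have "2 powr (2 * s * real i) * (majorant C j g / ?t) = ?t * y j"
        by (simp only: y_def mult.assoc)
      then show ?thesis by (simp add: x_def distrib_left mult_ac)
    qed
    also have "?t = ?q ^ (j - i)" using ij by (simp add: powr_powr of_nat_diff flip: powr_realpow)
    finally show ?thesis .
  qed
  \<comment> \<open>Split \<open>f\<close> at the frequency of \<open>Q j g\<close> into the part
    above \<open>j\<close>, the lowest frequency, and the bands \<open>i < j\<close> below
    it.\<close>
  have step: "\<bar>skew_form f (Q j g)\<bar> \<le> (?c + 2) * L * (x j + y j) + ?c * L * (?q ^ j * (base * l2sq f) + y j)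
      + (\<Sum>i<j. ?c * L * (?q ^ (j - i) * (x i + y j)))" for j
  proof -
    have "skew_form f (Q j g) = skew_form (\<lambda>v. f v - P j f v) (Q j g) + skew_form (P j f) (Q j g)"
      using skew_form_diff_left[OF f test_P[OF f] test_Q[OF g]] by simp
    also have "skew_form (P j f) (Q j g) = skew_form (P 0 f) (Q j g) + (\<Sum>i<j. skew_form (Q i f) (Q j g))"
      by (rule skew_form_telescope_left[OF f test_Q[OF g]])
    finally have "\<bar>skew_form f (Q j g)\<bar> \<le> \<bar>skew_form (\<lambda>v. f v - P j f v) (Q j g)\<bar> + \<bar>skew_form (P 0 f) (Q j g)\<bar>
        + (\<Sum>i<j. \<bar>skew_form (Q i f) (Q j g)\<bar>)"
      using sum_abs[of "\<lambda>i. skew_form (Q i f) (Q j g)" "{..<j}"] by linarith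
    also have "\<dots> \<le> (?c + 2) * L * (x j + y j) + ?c * L * (?q ^ j * (base * l2sq f) + y j)
      + (\<Sum>i<j. ?c * L * (?q ^ (j - i) * (x i + y j)))"
      by (intro add_mono b1 b2 sum_mono b3) auto
    finally show ?thesis .
  qed
  have geo_sum: "(\<Sum>j<n. ?q ^ j) \<le> geo"
  proof -
    have "(\<Sum>j<n. ?q ^ j) = (1 - ?q ^ n) / (1 - ?q)" using geo by (subst sum_gp_strict) auto
    also have "\<dots> \<le> geo" using geo unfolding geo_def by (intro divide_right_mono) auto
    finally show ?thesis .
  qed
  have tri: "(\<Sum>j<n. \<Sum>i<j. ?q ^ (j - i) * (x i + y j)) \<le> geo * ((\<Sum>j<n. x j) + (\<Sum>j<n. y j))"
    unfolding geo_def by (rule sum_triangle_le[OF geo(1,2) x0 y0])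
  have "skew_form f (P n g) = skew_form f (P 0 g) + (\<Sum>j<n. skew_form f (Q j g))"
    by (rule skew_form_telescope_right[OF f g])
  then have "\<bar>skew_form f (P n g)\<bar> \<le> \<bar>skew_form f (P 0 g)\<bar> + (\<Sum>j<n. \<bar>skew_form f (Q j g)\<bar>)"
    using sum_abs[of "\<lambda>j. skew_form f (Q j g)" "{..<n}"] by linarith
  also have "\<dots> \<le> (?c + 2) * L * (l2sq f + base * l2sq g) + (\<Sum>j<n. (?c + 2) * L * (x j + y j)
      + ?c * L * (?q ^ j * (base * l2sq f) + y j) + (\<Sum>i<j. ?c * L * (?q ^ (j - i) * (x i + y j))))"
    by (intro add_mono b0 sum_mono step)
  also have "\<dots> = (?c + 2) * L * (l2sq f + base * l2sq g + ((\<Sum>j<n. x j) + (\<Sum>j<n. y j)))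
      + ?c * L * ((\<Sum>j<n. ?q ^ j) * (base * l2sq f) + (\<Sum>j<n. y j) + (\<Sum>j<n. \<Sum>i<j. ?q ^ (j - i) * (x i + y j)))"
    by (simp only: sum.distrib distrib_left sum_distrib_left[symmetric] sum_distrib_right[symmetric] add.assoc)
  also have "\<dots> \<le> (?c + 2) * L * (l2sq f + base * l2sq g + (?a * gag s f + ?a * gag s g))
      + (?c + 2) * L * (geo * (base * l2sq f) + ?a * gag s g + geo * (?a * gag s f + ?a * gag s g))"
  proof (intro add_mono mult_left_mono[OF _ mult_nonneg_nonneg])
    have "(\<Sum>j<n. \<Sum>i<j. ?q ^ (j - i) * (x i + y j)) \<le> geo * (?a * gag s f + ?a * gag s g)"
      using tri geo(3) sx sy by (meson add_mono mult_left_mono order_less_imp_le order_trans)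
    then have *: "(\<Sum>j<n. ?q ^ j) * (base * l2sq f) + (\<Sum>j<n. y j) + (\<Sum>j<n. \<Sum>i<j. ?q ^ (j - i) * (x i + y j))
        \<le> geo * (base * l2sq f) + ?a * gag s g + geo * (?a * gag s f + ?a * gag s g)"
      using geo_sum sy base_nonneg by (intro add_mono mult_right_mono) auto
    have nn: "0 \<le> geo * (base * l2sq f) + ?a * gag s g + geo * (?a * gag s f + ?a * gag s g)"
      using geo(3) base_nonneg a0 sf0 by (intro add_nonneg_nonneg mult_nonneg_nonneg) auto
    have "?c * L * ((\<Sum>j<n. ?q ^ j) * (base * l2sq f) + (\<Sum>j<n. y j) + (\<Sum>j<n. \<Sum>i<j. ?q ^ (j - i) * (x i + y j)))
      \<le> ?c * L * (geo * (base * l2sq f) + ?a * gag s g + geo * (?a * gag s f + ?a * gag s g))"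
      by (rule mult_left_mono[OF * cL])
    also have "\<dots> \<le> (?c + 2) * L * (geo * (base * l2sq f) + ?a * gag s g + geo * (?a * gag s f + ?a * gag s g))"
      using L by (intro mult_right_mono[OF _ nn]) (simp add: distrib_right)
    finally show "?c * L * ((\<Sum>j<n. ?q ^ j) * (base * l2sq f) + (\<Sum>j<n. y j) + (\<Sum>j<n. \<Sum>i<j. ?q ^ (j - i) * (x i + y j)))
      \<le> (?c + 2) * L * (geo * (base * l2sq f) + ?a * gag s g + geo * (?a * gag s f + ?a * gag s g))" .
  qed (use c L sx sy in auto)
  also have "\<dots> = (?c + 2) * L * (l2sq f + base * l2sq g + (?a * gag s f + ?a * gag s g)
      + (geo * (base * l2sq f) + ?a * gag s g + geo * (?a * gag s f + ?a * gag s g)))"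
    by (simp only: distrib_left)
  also have "\<dots> \<le> (?c + 2) * L * ((1 + base + geo * base + (2 + geo) * ?a) * (hs2 s f + hs2 s g))"
  proof (rule mult_left_mono)
    \<comment> \<open>The second bracket is the nonnegative excess of the uniform constant over the
      terms actually present.\<close>
    have e: "(1 + base + geo * base + (2 + geo) * ?a) * (hs2 s f + hs2 s g)
      = (l2sq f + base * l2sq g + (?a * gag s f + ?a * gag s g)
      + (geo * (base * l2sq f) + ?a * gag s g + geo * (?a * gag s f + ?a * gag s g)))
      + (l2sq g + (gag s f + gag s g) + base * (l2sq f + gag s f + gag s g) + geo * base * (l2sq g + gag s f + gag s g)
        + ?a * gag s f + (2 + geo) * ?a * (l2sq f + l2sq g))"
      unfolding hs2_def by algebra
    have "0 \<le> l2sq g + (gag s f + gag s g) + base * (l2sq f + gag s f + gag s g) + geo * base * (l2sq g + gag s f + gag s g)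
        + ?a * gag s f + (2 + geo) * ?a * (l2sq f + l2sq g)"
      using base_nonneg geo(3) a0 sf0 by (intro add_nonneg_nonneg mult_nonneg_nonneg) auto
    then show "l2sq f + base * l2sq g + (?a * gag s f + ?a * gag s g)
      + (geo * (base * l2sq f) + ?a * gag s g + geo * (?a * gag s f + ?a * gag s g))
      \<le> (1 + base + geo * base + (2 + geo) * ?a) * (hs2 s f + hs2 s g)"
      unfolding e by linarith
  qed (use c L in auto)
  finally show ?thesis by (simp only: total_def mult_ac)
qed

text \<open>With \<open>f\<close> fixed and smooth at scale 1, the form is continuous in
  \<open>g\<close> for the L2 norm, and \<open>P n g\<close> tends to \<open>g\<close> in L2. The
  size \<open>X\<close> of the majorant of \<open>f\<close> is uncontrolled, but it carries the
  factor \<open>t\<close>.\<close>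

lemma skew_form_le:
  assumes f: "test_function f" and g: "test_function g"
  shows "\<bar>skew_form f g\<bar> \<le> total * L * (hs2 s f + hs2 s g)"
proof -
  let ?c = "scale_const TYPE('a) s" and ?a = "4 * C\<^sup>2 * square_fun_const TYPE('a) s" and ?B = "total * L * (hs2 s f + hs2 s g)"
  obtain m X where m: "m \<in> borel_measurable borel" "\<And>v. \<bar>f v\<bar> \<le> m v"
    "\<And>v b. b \<in> Basis \<Longrightarrow> \<bar>grad f v b\<bar> \<le> m v"
    "\<And>v v'. norm (v' - v) < 1 \<Longrightarrow> \<bar>f v' - f v - grad f v (v' - v)\<bar> \<le> m v * (norm (v' - v))\<^sup>2"
    "(\<integral>\<^sup>+v. ennreal ((m v)\<^sup>2) \<partial>lborel) \<le> ennreal X" "X \<ge> 0"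
    by (rule ex_unit_scale_majorant[OF f]) blast
  \<comment> \<open>The order of limits matters: \<open>n\<close> tends to infinity for fixed
    \<open>t\<close>, which removes the term divided by \<open>t\<close>, and only then does
    \<open>t\<close> tend to 0.\<close>
  have bound: "\<bar>skew_form f g\<bar> \<le> ?B + ?c * L * (t * X + (?a * gag s g / 2 powr (2 * s * real n)) / t)" if t: "t > 0" for t n
  proof -
    have "2 powr (2 * s * real n) * majorant C n g \<le> ?a * gag s g"
      using mult_left_mono[OF oscint_le[OF borel_Hs_test[OF g s] s(1), of n], of "4 * C\<^sup>2"]
      by (simp add: majorant_def mult_ac)
    then have "l2sq (\<lambda>v. g v - P n g v) \<le> ?a * gag s g / 2 powr (2 * s * real n)"
      using order_trans[OF mult_left_mono[OF l2sq_diff_P[OF g, of n], of "2 powr (2 * s * real n)"]]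
      by (subst pos_le_divide_eq) (simp_all add: mult.commute[of _ "2 powr (2 * s * real n)"])
    then have "\<bar>skew_form f (\<lambda>v. g v - P n g v)\<bar> \<le> ?c * L * 1 powr (- 2 * s) * (t * X + (?a * gag s g / 2 powr (2 * s * real n)) / t)"
      using t m by (intro skew_form_scale_le[OF f test_function_diff[OF g test_P[OF g]], of 1 m]) auto
    moreover have "skew_form f g = skew_form f (\<lambda>v. g v - P n g v) + skew_form f (P n g)"
      using skew_form_diff_right[OF f g test_P[OF g]] by simp
    ultimately show ?thesis using skew_form_P_le[OF f g, of n] by simp
  qed
  have bound2: "\<bar>skew_form f g\<bar> \<le> ?B + ?c * L * (t * X)" if t: "t > 0" for t
  proof (rule LIMSEQ_le_const)
    have "(\<lambda>n. 2 powr (- (2 * s) * real n)) \<longlonglongrightarrow> 0"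
    proof -
      have "(\<lambda>n. (2 powr (- (2 * s))) ^ n) \<longlonglongrightarrow> (0::real)"
        using s(1) powr_less_one[of 2 "- (2 * s)"] by (intro LIMSEQ_realpow_zero) auto
      then show ?thesis by (simp add: powr_powr flip: powr_realpow)
    qed
    then have "(\<lambda>n. ?B + ?c * L * (t * X + (?a * gag s g * 2 powr (- (2 * s) * real n)) / t)) \<longlonglongrightarrow> ?B + ?c * L * (t * X + (?a * gag s g * 0) / t)"
      by (intro tendsto_intros) (use t in auto)
    then show "(\<lambda>n. ?B + ?c * L * (t * X + (?a * gag s g / 2 powr (2 * s * real n)) / t)) \<longlonglongrightarrow> ?B + ?c * L * (t * X)"
      by (simp add: powr_minus divide_inverse)
  qed (use bound[OF t] in auto)
  have "((\<lambda>t. ?B + ?c * L * (t * X)) \<longlongrightarrow> ?B + ?c * L * (0 * X)) (at_right 0)"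
    by (intro tendsto_intros)
  then show ?thesis
    by (intro tendsto_lowerbound[of _ "?B" "at_right 0"])
       (use bound2 eventually_at_right_less[of 0] in \<open>auto elim: eventually_mono\<close>)
qed

end

section \<open>Continuity of translations in the mean\<close>

text \<open>A Lipschitz cutoff is enough, since smoothness is restored later by mollification. For
  \<open>M >= 1\<close> its Lipschitz constant is at most 1, uniformly in \<open>M\<close>.\<close>

definition cutoff :: "real \<Rightarrow> 'b::real_normed_vector \<Rightarrow> real" where
  "cutoff M x = max 0 (min 1 (2 - norm x / M))"

lemma cutoff_bounds: "0 \<le> cutoff M x" "cutoff M x \<le> 1"
  by (auto simp: cutoff_def)

lemma cutoff_eq_1: "M > 0 \<Longrightarrow> norm x \<le> M \<Longrightarrow> cutoff M x = 1"
  by (auto simp: cutoff_def min_def max_def field_simps)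

lemma cutoff_eq_0: "M > 0 \<Longrightarrow> norm x \<ge> 2 * M \<Longrightarrow> cutoff M x = 0"
  by (auto simp: cutoff_def min_def max_def field_simps)

lemma continuous_cutoff: "continuous_on S (cutoff M)"
  unfolding cutoff_def[abs_def] by (cases "M = 0") (auto intro!: continuous_intros)

lemma cutoff_measurable [measurable]: "cutoff M \<in> borel_measurable borel"
  by (intro borel_measurable_continuous_onI continuous_cutoff)

lemma cutoff_Lipschitz:
  assumes "M \<ge> 1" shows "\<bar>cutoff M x - cutoff M y\<bar> \<le> norm (x - y)"
proof -
  have "\<bar>cutoff M x - cutoff M y\<bar> \<le> \<bar>norm x / M - norm y / M\<bar>"
    by (auto simp: cutoff_def max_def min_def)
  also have "\<dots> = \<bar>norm x - norm y\<bar> / M"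
    using assms by (simp add: diff_divide_distrib[symmetric])
  also have "\<dots> \<le> \<bar>norm x - norm y\<bar> / 1"
    using assms by (intro divide_left_mono) auto
  also have "\<dots> \<le> norm (x - y)" using norm_triangle_ineq3[of x y] by simp
  finally show ?thesis .
qed

definition clip :: "real \<Rightarrow> real \<Rightarrow> real" where
  "clip M y = max (- M) (min M y)"

lemma continuous_clip: "continuous_on S (clip M)"
  unfolding clip_def[abs_def] by (intro continuous_intros)

lemma clip_measurable [measurable]: "clip M \<in> borel_measurable borel"
  by (intro borel_measurable_continuous_onI continuous_clip)

lemma abs_clip: "M \<ge> 0 \<Longrightarrow> \<bar>clip M y\<bar> \<le> M" "M \<ge> 0 \<Longrightarrow> \<bar>clip M y\<bar> \<le> \<bar>y\<bar>"
  and clip_eq: "\<bar>y\<bar> \<le> M \<Longrightarrow> clip M y = y"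
  by (auto simp: clip_def max_def min_def)

lemma power2_diff_le: "(a - b)\<^sup>2 \<le> 2 * a\<^sup>2 + 2 * (b::real)\<^sup>2"
  using zero_le_power2[of "a + b"] by (simp add: power2_eq_square algebra_simps)

lemma power2_add_le: "(a + b)\<^sup>2 \<le> 2 * a\<^sup>2 + 2 * (b::real)\<^sup>2"
  using power2_diff_le[of a "- b"] by simp

lemma clip_cutoff_tendsto:
  fixes F :: "'b::euclidean_space \<Rightarrow> real"
  assumes [measurable]: "F \<in> borel_measurable borel" and int: "integrable lborel (\<lambda>x. (F x)\<^sup>2)"
  shows "(\<lambda>n. LINT x|lborel. (F x - clip (real (Suc n)) (F x) * cutoff (real (Suc n)) x)\<^sup>2) \<longlonglongrightarrow> 0"
proof -
  have "(\<lambda>n. LINT x|lborel. (F x - clip (real (Suc n)) (F x) * cutoff (real (Suc n)) x)\<^sup>2) \<longlonglongrightarrow> (LINT x|(lborel :: 'b measure). 0)"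
  proof (rule integral_dominated_convergence[where w = "\<lambda>x. 4 * (F x)\<^sup>2"])
    show "AE x in lborel. (\<lambda>n. (F x - clip (real (Suc n)) (F x) * cutoff (real (Suc n)) x)\<^sup>2) \<longlonglongrightarrow> 0"
    proof (rule AE_I2, rule tendsto_eventually)
      fix x
      obtain N :: nat where N: "\<bar>F x\<bar> + norm x \<le> real N" using real_arch_simple by blast
      show "\<forall>\<^sub>F n in sequentially. (F x - clip (real (Suc n)) (F x) * cutoff (real (Suc n)) x)\<^sup>2 = 0"
        using eventually_ge_at_top[of N]
      proof eventually_elim
        case (elim n)
        then have "real N \<le> real n" by simp
        then have "\<bar>F x\<bar> \<le> real (Suc n)" "norm x \<le> real (Suc n)"
          using N norm_ge_zero[of x] abs_ge_zero[of "F x"] by linarith+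
        then show ?case by (simp add: clip_eq cutoff_eq_1 del: of_nat_Suc)
      qed
    qed
    show "AE x in lborel. norm ((F x - clip (real (Suc n)) (F x) * cutoff (real (Suc n)) x)\<^sup>2) \<le> 4 * (F x)\<^sup>2" for n
    proof (rule AE_I2)
      fix x
      let ?c = "clip (real (Suc n)) (F x) * cutoff (real (Suc n)) x"
      have "\<bar>?c\<bar> \<le> \<bar>F x\<bar> * 1"
        unfolding abs_mult using cutoff_bounds[of "real (Suc n)" x] by (intro mult_mono abs_clip) auto
      then have "?c\<^sup>2 \<le> (F x)\<^sup>2" by (simp add: abs_le_square_iff)
      then show "norm ((F x - ?c)\<^sup>2) \<le> 4 * (F x)\<^sup>2" using power2_diff_le[of "F x" ?c] by simp
    qed
  qed (auto intro!: integrable_mult_right int)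
  then show ?thesis by simp
qed

text \<open>First clip the values and cut off the support. Then take continuous functions converging
  almost everywhere to \<open>F\<close> and apply the same clip and cutoff to them: all are
  dominated by a constant on a fixed ball, and dominated convergence gives L2 convergence.\<close>

lemma ex_continuous_L2_approx:
  fixes F :: "'b::euclidean_space \<Rightarrow> real"
  assumes [measurable]: "F \<in> borel_measurable borel" and int: "integrable lborel (\<lambda>x. (F x)\<^sup>2)" and e: "e > 0"
  obtains G M where "continuous_on UNIV G" "M > 0" "\<And>x. norm x \<ge> M \<Longrightarrow> G x = 0"
    "(\<integral>\<^sup>+x. ennreal ((F x - G x)\<^sup>2) \<partial>lborel) \<le> ennreal e"
proof -
  obtain n where n: "(LINT x|lborel. (F x - clip (real (Suc n)) (F x) * cutoff (real (Suc n)) x)\<^sup>2) < e / 4"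
    using LIMSEQ_D[OF clip_cutoff_tendsto[OF assms(1) int], of "e / 4"] e by fastforce
  define M where "M = real (Suc n)"
  have M: "M > 0" by (simp add: M_def)
  let ?H = "\<lambda>x. clip M (F x) * cutoff M x"
  have intFH: "integrable lborel (\<lambda>x. (F x - ?H x)\<^sup>2)"
  proof (rule Bochner_Integration.integrable_bound[OF integrable_mult_right[OF int, of 4]])
    have "norm ((F x - ?H x)\<^sup>2) \<le> norm (4 * (F x)\<^sup>2)" for x
    proof -
      have "\<bar>?H x\<bar> \<le> \<bar>F x\<bar> * 1"
        unfolding abs_mult using cutoff_bounds[of M x] M by (intro mult_mono abs_clip) auto
      then have "(?H x)\<^sup>2 \<le> (F x)\<^sup>2" by (simp add: abs_le_square_iff)
      then show ?thesis using power2_diff_le[of "F x" "?H x"] by simp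
    qed
    then show "AE x in lborel. norm ((F x - ?H x)\<^sup>2) \<le> norm (4 * (F x)\<^sup>2)" by simp
  qed measurable
  have "F \<in> borel_measurable lebesgue" by (simp add: measurable_completion)
  \<comment> \<open>This notion of measurability supplies the continuous functions
    \<open>g k\<close> that converge to \<open>F\<close> off a negligible set.\<close>
  then have "F measurable_on UNIV" by (rule lebesgue_measurable_imp_measurable_on) auto
  then obtain N g where N: "negligible N" and g: "\<And>k. continuous_on UNIV (g k)"
    "\<And>x. x \<notin> N \<Longrightarrow> (\<lambda>k. g k x) \<longlonglongrightarrow> F x"
    by (auto simp: measurable_on_def)
  have ae: "AE x in lborel. x \<notin> N"
    using N AE_not_in[of N lebesgue] by (simp add: negligible_iff_null_sets AE_completion_iff)
  let ?G = "\<lambda>k x. clip M (g k x) * cutoff M x"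
  have contG: "continuous_on UNIV (?G k)" for k
    by (intro continuous_on_mult continuous_cutoff continuous_on_compose2[OF continuous_clip g(1)]) auto
  then have [measurable]: "?G k \<in> borel_measurable borel" for k by (intro borel_measurable_continuous_onI)
  have suppc: "cutoff M x = indicator (cball 0 (2 * M)) x * cutoff M x" for x :: 'b
    using cutoff_eq_0[OF M, of x] by (auto simp: indicator_def)
  have bnd: "(?H x - ?G k x)\<^sup>2 \<le> 4 * M\<^sup>2 * indicator (cball 0 (2 * M)) x" for x k
  proof -
    have "\<bar>clip M (F x) - clip M (g k x)\<bar> \<le> 2 * M"
      using abs_clip(1)[of M "F x"] abs_clip(1)[of M "g k x"] M by linarith
    then have "(clip M (F x) - clip M (g k x))\<^sup>2 \<le> (2 * M)\<^sup>2"
      using M by (subst abs_le_square_iff[symmetric]) auto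
    moreover have "(?H x - ?G k x)\<^sup>2 = (clip M (F x) - clip M (g k x))\<^sup>2 * (cutoff M x)\<^sup>2"
      by (simp add: power_mult_distrib flip: left_diff_distrib)
    moreover have "(cutoff M x)\<^sup>2 \<le> indicator (cball 0 (2 * M)) x"
      using cutoff_bounds[of M x] cutoff_eq_0[OF M, of x] by (auto simp: indicator_def power_le_one)
    ultimately show ?thesis
      using mult_mono[of "(clip M (F x) - clip M (g k x))\<^sup>2" "(2 * M)\<^sup>2" "(cutoff M x)\<^sup>2" "indicator (cball 0 (2 * M)) x"]
      by (simp add: power_mult_distrib)
  qed
  have intw: "integrable lborel (\<lambda>x::'b. 4 * M\<^sup>2 * indicator (cball 0 (2 * M)) x)"
    using emeasure_lborel_cball_finite[of "0::'b" "2 * M"]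
    by (intro integrable_mult_right integrable_real_indicator) auto
  have "(\<lambda>k. LINT x|lborel. (?H x - ?G k x)\<^sup>2) \<longlonglongrightarrow> (LINT x|(lborel::'b measure). 0)"
  proof (rule integral_dominated_convergence[OF _ _ intw])
    show "AE x in lborel. (\<lambda>k. (?H x - ?G k x)\<^sup>2) \<longlonglongrightarrow> 0"
      using ae
    proof eventually_elim
      case (elim x)
      have "isCont (clip M) (F x)"
        using continuous_clip[of UNIV M] by (simp add: continuous_on_eq_continuous_at)
      then have "(\<lambda>k. clip M (g k x)) \<longlonglongrightarrow> clip M (F x)"
        using g(2)[OF elim] by (rule isCont_tendsto_compose)
      then have "(\<lambda>k. (?H x - ?G k x)\<^sup>2) \<longlonglongrightarrow> (?H x - ?H x)\<^sup>2"
        by (intro tendsto_intros)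
      then show ?case by simp
    qed
  qed (use bnd in auto)
  then obtain k where k: "(LINT x|lborel. (?H x - ?G k x)\<^sup>2) < e / 4"
    using e by (auto dest!: LIMSEQ_D[of _ _ "e / 4"])
  have intHG: "integrable lborel (\<lambda>x. (?H x - ?G k x)\<^sup>2)"
    by (rule Bochner_Integration.integrable_bound[OF intw]) (use bnd in auto)
  show ?thesis
  proof
    show "continuous_on UNIV (?G k)" by (rule contG)
    show "2 * M > 0" using M by simp
    show "?G k x = 0" if "norm x \<ge> 2 * M" for x using cutoff_eq_0[OF M that] by simp
    have "(\<integral>\<^sup>+x. ennreal ((F x - ?G k x)\<^sup>2) \<partial>lborel) \<le> (\<integral>\<^sup>+x. ennreal (2 * (F x - ?H x)\<^sup>2 + 2 * (?H x - ?G k x)\<^sup>2) \<partial>lborel)"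
    proof (intro nn_integral_mono ennreal_leI)
      show "(F x - ?G k x)\<^sup>2 \<le> 2 * (F x - ?H x)\<^sup>2 + 2 * (?H x - ?G k x)\<^sup>2" for x
        using power2_add_le[of "F x - ?H x" "?H x - ?G k x"] by simp
    qed
    also have "\<dots> = ennreal (LINT x|lborel. 2 * (F x - ?H x)\<^sup>2 + 2 * (?H x - ?G k x)\<^sup>2)"
      by (intro nn_integral_eq_integral Bochner_Integration.integrable_add integrable_mult_right intFH intHG) auto
    also have "(LINT x|lborel. 2 * (F x - ?H x)\<^sup>2 + 2 * (?H x - ?G k x)\<^sup>2) \<le> e"
      using n k intFH intHG by (simp add: M_def)
    finally show "(\<integral>\<^sup>+x. ennreal ((F x - ?G k x)\<^sup>2) \<partial>lborel) \<le> ennreal e" by (simp add: ennreal_leI)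
  qed
qed

text \<open>A three-term comparison with a continuous compactly supported \<open>G\<close>:
  translation preserves the distance from \<open>F\<close> to \<open>G\<close>, and uniform
  continuity handles \<open>G\<close> itself.\<close>

lemma L2_translation_continuous:
  fixes F :: "'b::euclidean_space \<Rightarrow> real"
  assumes [measurable]: "F \<in> borel_measurable borel" and int: "integrable lborel (\<lambda>x. (F x)\<^sup>2)" and e: "e > 0"
  obtains \<delta> where "\<delta> > 0" "\<And>h. norm h < \<delta> \<Longrightarrow> (\<integral>\<^sup>+x. ennreal ((F (x - h) - F x)\<^sup>2) \<partial>lborel) \<le> ennreal e"
proof -
  obtain G M where G: "continuous_on UNIV G" "M > 0" "\<And>x. norm x \<ge> M \<Longrightarrow> G x = 0"
    "(\<integral>\<^sup>+x. ennreal ((F x - G x)\<^sup>2) \<partial>lborel) \<le> ennreal (e / 24)"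
    using ex_continuous_L2_approx[OF assms(1) int, of "e / 24"] e by auto
  have [measurable]: "G \<in> borel_measurable borel" by (intro borel_measurable_continuous_onI G)
  let ?V = "(M + 1) ^ DIM('b) * measure lborel (ball (0::'b) 1)"
  have V: "?V > 0" using G(2) content_ball_unit_pos[where 'a='b] by simp
  \<comment> \<open>Chosen so that \<open>\<eta>^2 * ?V = e / 4\<close>; with the factor 3 from
    squaring a sum of three terms the budget is
    \<open>3 (e / 24) + 3 (e / 4) + 3 (e / 24) = e\<close>.\<close>
  define \<eta> where "\<eta> = sqrt (e / (4 * ?V))"
  have \<eta>: "\<eta> > 0" using e V by (simp add: \<eta>_def)
  have "uniformly_continuous_on (cball 0 (M + 1)) G"
    by (intro compact_uniformly_continuous continuous_on_subset[OF G(1)]) auto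
  then obtain d where d: "d > 0" "\<And>x y. norm x \<le> M + 1 \<Longrightarrow> norm y \<le> M + 1 \<Longrightarrow> norm (y - x) < d \<Longrightarrow> \<bar>G y - G x\<bar> < \<eta>"
    using \<eta> unfolding uniformly_continuous_on_def by (auto simp: dist_norm)
  have uc: "\<bar>G (x - h) - G x\<bar> \<le> \<eta> * indicator (ball 0 (M + 1)) x" if h: "norm h < min 1 d" for x h
  proof (cases "norm x < M + 1")
    case True
    show ?thesis
    proof (cases "norm (x - h) \<le> M + 1")
      case True': True
      then show ?thesis using d(2)[of x "x - h"] True h by (auto simp: indicator_def)
    next
      case False
      moreover have "norm (x - h) \<le> norm x + norm h" by (rule norm_triangle_ineq4)
      ultimately have "norm x \<ge> M" using h by linarith
      then show ?thesis using False G(3)[of x] G(3)[of "x - h"] \<eta> by (simp add: indicator_def)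
    qed
  next
    case False
    then have "norm (x - h) \<ge> M" using h norm_triangle_ineq2[of x h] by linarith
    then show ?thesis using False G(3)[of x] G(3)[of "x - h"] G(2) \<eta> by simp
  qed
  have "(\<integral>\<^sup>+x. ennreal ((F (x - h) - F x)\<^sup>2) \<partial>lborel) \<le> ennreal e" if h: "norm h < min 1 d" for h
  proof -
    let ?A = "\<lambda>x. ennreal ((F x - G x)\<^sup>2)" and ?B = "\<lambda>x. ennreal ((G (x - h) - G x)\<^sup>2)"
    have "(\<integral>\<^sup>+x. ennreal ((F (x - h) - F x)\<^sup>2) \<partial>lborel) \<le> (\<integral>\<^sup>+x. 3 * ?A (x - h) + 3 * ?B x + 3 * ?A x \<partial>lborel)"
    proof (rule nn_integral_mono)
      fix x
      have "(F (x - h) - F x)\<^sup>2 \<le> 3 * (F (x - h) - G (x - h))\<^sup>2 + 3 * (G (x - h) - G x)\<^sup>2 + 3 * (F x - G x)\<^sup>2"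
      proof -
        have "(a + b + c)\<^sup>2 \<le> 3 * a\<^sup>2 + 3 * b\<^sup>2 + 3 * c\<^sup>2" for a b c :: real
          using zero_le_power2[of "a - b"] zero_le_power2[of "b - c"] zero_le_power2[of "a - c"]
          by (simp add: power2_eq_square algebra_simps)
        from this[of "F (x - h) - G (x - h)" "G (x - h) - G x" "G x - F x"] show ?thesis
          by (simp add: power2_commute[of "G x"])
      qed
      then have "ennreal ((F (x - h) - F x)\<^sup>2) \<le> ennreal (3 * (F (x - h) - G (x - h))\<^sup>2 + 3 * (G (x - h) - G x)\<^sup>2 + 3 * (F x - G x)\<^sup>2)"
        by (rule ennreal_leI)
      then show "ennreal ((F (x - h) - F x)\<^sup>2) \<le> 3 * ?A (x - h) + 3 * ?B x + 3 * ?A x"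
        by (simp add: ennreal_mult)
    qed
    also have "\<dots> = 3 * (\<integral>\<^sup>+x. ?A (x - h) \<partial>lborel) + 3 * (\<integral>\<^sup>+x. ?B x \<partial>lborel) + 3 * (\<integral>\<^sup>+x. ?A x \<partial>lborel)"
      by (simp add: nn_integral_add nn_integral_cmult)
    also have "(\<integral>\<^sup>+x. ?A (x - h) \<partial>lborel) = (\<integral>\<^sup>+x. ?A x \<partial>lborel)"
      by (subst (2) nn_integral_lborel_affine[of _ 1 "- h"]) auto
    also have "(\<integral>\<^sup>+x. ?B x \<partial>lborel) \<le> (\<integral>\<^sup>+x. ennreal (\<eta>\<^sup>2) * indicator (ball (0::'b) (M + 1)) x \<partial>lborel)"
    proof (rule nn_integral_mono)
      fix x
      show "?B x \<le> ennreal (\<eta>\<^sup>2) * indicator (ball 0 (M + 1)) x"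
        using power_mono[OF uc[OF h, of x] abs_ge_zero, of 2]
        by (auto simp: indicator_def intro!: ennreal_leI split: if_splits)
    qed
    also have "\<dots> = ennreal (\<eta>\<^sup>2) * ennreal ?V"
      using G(2) by (subst nn_integral_cmult) (auto simp: nn_integral_ball_indicator simp del: nn_integral_indicator intro!: borel_measurable_indicator)
    also have "\<dots> = ennreal (e / 4)"
      using V e G(2) by (simp add: \<eta>_def flip: ennreal_mult)
    also have "3 * (\<integral>\<^sup>+x. ?A x \<partial>lborel) + 3 * ennreal (e / 4) + 3 * (\<integral>\<^sup>+x. ?A x \<partial>lborel)
       \<le> 3 * ennreal (e / 24) + 3 * ennreal (e / 4) + 3 * ennreal (e / 24)"
      by (intro add_mono mult_left_mono G(4)) auto
    also have "\<dots> \<le> ennreal e"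
    proof -
      have "3 * ennreal x = ennreal (3 * x)" if "x \<ge> 0" for x using that by (simp add: ennreal_mult)
      then show ?thesis using e by (simp flip: ennreal_plus)
    qed
    finally show ?thesis by (simp add: add_mono mult_left_mono)
  qed
  then show ?thesis using d(1) by (intro that[of "min 1 d"]) auto
qed

section \<open>Mollification as an average of translations\<close>

context mollifier
begin

lemma scaled_nonneg: "r > 0 \<Longrightarrow> scaled \<rho> r x \<ge> 0"
  by (simp add: scaled_def nonneg)

lemma nn_integral_scaled: "r > 0 \<Longrightarrow> (\<integral>\<^sup>+z. ennreal (scaled \<rho> r z) \<partial>lborel) = 1"
  using nn_integral_eq_integral[OF test_function_integrable[OF test_function_scaled[OF test]]]
    integral_scaled[OF test] integral_1 scaled_nonneg by auto

text \<open>The mollifier is a probability density; Cauchy-Schwarz is applied with its square root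
  placed in both factors. An infinite right side needs no argument.\<close>

lemma scaled_Jensen:
  assumes r: "r > 0" and [measurable]: "h \<in> borel_measurable borel"
  shows "ennreal ((LINT z|lborel. scaled \<rho> r z * h z)\<^sup>2) \<le> (\<integral>\<^sup>+z. ennreal (scaled \<rho> r z * (h z)\<^sup>2) \<partial>lborel)"
proof (cases "(\<integral>\<^sup>+z. ennreal (scaled \<rho> r z * (h z)\<^sup>2) \<partial>lborel) = \<infinity>")
  case False
  have [measurable]: "scaled \<rho> r \<in> borel_measurable borel"
    by (intro test_function_measurable test_function_scaled test r)
  note nn = scaled_nonneg[OF r]
  have 1: "integrable lborel (\<lambda>z. (sqrt (scaled \<rho> r z))\<^sup>2)"
    using test_function_integrable[OF test_function_scaled[OF test r]] nn by simp
  have 2: "integrable lborel (\<lambda>z. (sqrt (scaled \<rho> r z) * h z)\<^sup>2)"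
    using False nn by (intro integrableI_bounded) (auto simp: power_mult_distrib abs_mult top.not_eq_extremum)
  have "\<bar>LINT z|lborel. sqrt (scaled \<rho> r z) * (sqrt (scaled \<rho> r z) * h z)\<bar>
      \<le> sqrt (LINT z|lborel. (sqrt (scaled \<rho> r z))\<^sup>2) * sqrt (LINT z|lborel. (sqrt (scaled \<rho> r z) * h z)\<^sup>2)"
    by (rule Cauchy_Schwarz_integral(2)[OF _ _ 1 2]) auto
  then have "\<bar>LINT z|lborel. scaled \<rho> r z * h z\<bar> \<le> sqrt (LINT z|lborel. scaled \<rho> r z * (h z)\<^sup>2)"
    using nn integral_scaled[OF test r] integral_1 by (simp add: power_mult_distrib flip: mult.assoc)
  then have "(LINT z|lborel. scaled \<rho> r z * h z)\<^sup>2 \<le> (LINT z|lborel. scaled \<rho> r z * (h z)\<^sup>2)"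
    using nn by (metis (no_types, lifting) Bochner_Integration.integral_nonneg mult_nonneg_nonneg real_sqrt_abs real_sqrt_le_iff zero_le_power2)
  moreover have "(\<integral>\<^sup>+z. ennreal (scaled \<rho> r z * (h z)\<^sup>2) \<partial>lborel) = ennreal (LINT z|lborel. scaled \<rho> r z * (h z)\<^sup>2)"
    using 2 nn by (intro nn_integral_eq_integral) (auto simp: power_mult_distrib)
  ultimately show ?thesis by (simp add: ennreal_leI)
qed simp

text \<open>The map \<open>\<iota>\<close> allows translations in a different space: the identity
  treats the function itself, and \<open>z\<close> mapped to \<open>(z, z)\<close> treats the
  weighted increments on pairs.\<close>

lemma mollify_L2_le:
  fixes F :: "'b::euclidean_space \<Rightarrow> real" and \<iota> :: "'a \<Rightarrow> 'b"
  assumes r: "r > 0" and [measurable]: "F \<in> borel_measurable borel" "\<iota> \<in> borel_measurable borel"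
    and le: "\<And>z. norm z < r \<Longrightarrow> (\<integral>\<^sup>+x. ennreal ((F (x - \<iota> z) - F x)\<^sup>2) \<partial>lborel) \<le> ennreal e"
  shows "(\<integral>\<^sup>+x. ennreal ((LINT z|lborel. scaled \<rho> r z * (F (x - \<iota> z) - F x))\<^sup>2) \<partial>lborel) \<le> ennreal e"
proof -
  have [measurable]: "scaled \<rho> r \<in> borel_measurable borel"
    by (intro test_function_measurable test_function_scaled test r)
  note nn = scaled_nonneg[OF r]
  have "(\<integral>\<^sup>+x. ennreal ((LINT z|lborel. scaled \<rho> r z * (F (x - \<iota> z) - F x))\<^sup>2) \<partial>lborel)
    \<le> (\<integral>\<^sup>+x. \<integral>\<^sup>+z. ennreal (scaled \<rho> r z * (F (x - \<iota> z) - F x)\<^sup>2) \<partial>lborel \<partial>lborel)"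
    by (intro nn_integral_mono scaled_Jensen r) measurable
  also have "\<dots> = (\<integral>\<^sup>+z. \<integral>\<^sup>+x. ennreal (scaled \<rho> r z * (F (x - \<iota> z) - F x)\<^sup>2) \<partial>lborel \<partial>lborel)"
    by (rule lborel_pair.Fubini'[symmetric]) measurable
  also have "\<dots> = (\<integral>\<^sup>+z. ennreal (scaled \<rho> r z) * (\<integral>\<^sup>+x. ennreal ((F (x - \<iota> z) - F x)\<^sup>2) \<partial>lborel) \<partial>lborel)"
    by (intro nn_integral_cong) (simp add: ennreal_mult nn nn_integral_cmult)
  also have "\<dots> \<le> (\<integral>\<^sup>+z. ennreal (scaled \<rho> r z) * ennreal e \<partial>lborel)"
  proof (rule nn_integral_mono)
    fix z
    show "ennreal (scaled \<rho> r z) * (\<integral>\<^sup>+x. ennreal ((F (x - \<iota> z) - F x)\<^sup>2) \<partial>lborel) \<le> ennreal (scaled \<rho> r z) * ennreal e"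
      using le[of z] scaled_support[OF r, of z] by (cases "norm z < r") (auto intro: mult_left_mono)
  qed
  also have "\<dots> = ennreal e"
    by (simp add: nn_integral_multc nn_integral_scaled[OF r])
  finally show ?thesis .
qed

end

section \<open>Density of test functions\<close>

lemma borel_Hs_measurable: "borel_Hs s f \<Longrightarrow> f \<in> borel_measurable borel"
  by (simp add: borel_Hs_def)

lemma nn_hs2:
  assumes "borel_Hs s f"
  shows "ennreal (hs2 s f) = (\<integral>\<^sup>+v. ennreal ((f v)\<^sup>2) \<partial>lborel) + (\<integral>\<^sup>+z. ennreal (sqdiff f z * gkernel s z) \<partial>lborel)"
  using assms unfolding borel_Hs_def hs2_def l2sq_def gag_def
  by (subst (1 2) nn_integral_eq_integral) (auto intro!: ennreal_plus Bochner_Integration.integral_nonneg)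

text \<open>Working with squared norms and a factor 2 replaces Minkowski's inequality; a triangle
  inequality up to constants is all that later limits use.\<close>

lemma hs2_linear_combination:
  assumes f: "borel_Hs s f" and g: "borel_Hs s g"
  shows "borel_Hs s (\<lambda>v. a * f v + b * g v)"
    "hs2 s (\<lambda>v. a * f v + b * g v) \<le> 2 * a\<^sup>2 * hs2 s f + 2 * b\<^sup>2 * hs2 s g"
proof -
  have [measurable]: "f \<in> borel_measurable borel" "g \<in> borel_measurable borel"
    using f g by (auto simp: borel_Hs_def)
  let ?h = "\<lambda>v. a * f v + b * g v"
  have i: "integrable lborel (\<lambda>v. (f v)\<^sup>2)" "integrable lborel (\<lambda>v. (g v)\<^sup>2)"
    "integrable lborel (\<lambda>z. sqdiff f z * gkernel s z)" "integrable lborel (\<lambda>z. sqdiff g z * gkernel s z)"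
    using f g by (auto simp: borel_Hs_def)
  have le1: "(?h v)\<^sup>2 \<le> 2 * a\<^sup>2 * (f v)\<^sup>2 + 2 * b\<^sup>2 * (g v)\<^sup>2" for v
    using power2_add_le[of "a * f v" "b * g v"] by (simp add: power_mult_distrib mult.assoc)
  have le2: "sqdiff ?h z * gkernel s z \<le> 2 * a\<^sup>2 * (sqdiff f z * gkernel s z) + 2 * b\<^sup>2 * (sqdiff g z * gkernel s z)" for z
  proof -
    have "sqdiff ?h z = (a * (f (snd z) - f (fst z)) + b * (g (snd z) - g (fst z)))\<^sup>2"
      by (simp add: sqdiff_def algebra_simps)
    also have "\<dots> \<le> 2 * a\<^sup>2 * sqdiff f z + 2 * b\<^sup>2 * sqdiff g z"
      using power2_add_le[of "a * (f (snd z) - f (fst z))" "b * (g (snd z) - g (fst z))"]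
      by (simp add: power_mult_distrib mult.assoc sqdiff_def)
    finally have "sqdiff ?h z * gkernel s z \<le> (2 * a\<^sup>2 * sqdiff f z + 2 * b\<^sup>2 * sqdiff g z) * gkernel s z"
      by (rule mult_right_mono) simp
    then show ?thesis by (simp add: algebra_simps)
  qed
  have j1: "integrable lborel (\<lambda>v. 2 * a\<^sup>2 * (f v)\<^sup>2 + 2 * b\<^sup>2 * (g v)\<^sup>2)"
    and j2: "integrable lborel (\<lambda>z. 2 * a\<^sup>2 * (sqdiff f z * gkernel s z) + 2 * b\<^sup>2 * (sqdiff g z * gkernel s z))"
    by (intro Bochner_Integration.integrable_add integrable_mult_right i)+
  have k1: "integrable lborel (\<lambda>v. (?h v)\<^sup>2)"
  proof (rule Bochner_Integration.integrable_bound[OF j1])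
    show "AE v in lborel. norm ((?h v)\<^sup>2) \<le> norm (2 * a\<^sup>2 * (f v)\<^sup>2 + 2 * b\<^sup>2 * (g v)\<^sup>2)"
      using le1 by (intro AE_I2) (simp add: order_trans[OF le1])
  qed measurable
  have k2: "integrable lborel (\<lambda>z. sqdiff ?h z * gkernel s z)"
  proof (rule Bochner_Integration.integrable_bound[OF j2])
    show "AE z in lborel. norm (sqdiff ?h z * gkernel s z)
        \<le> norm (2 * a\<^sup>2 * (sqdiff f z * gkernel s z) + 2 * b\<^sup>2 * (sqdiff g z * gkernel s z))"
    proof (rule AE_I2)
      fix z
      have "norm (sqdiff ?h z * gkernel s z) = sqdiff ?h z * gkernel s z" by (simp add: abs_mult)
      also note le2[of z]
      also note abs_ge_self[of "2 * a\<^sup>2 * (sqdiff f z * gkernel s z) + 2 * b\<^sup>2 * (sqdiff g z * gkernel s z)"]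
      finally show "norm (sqdiff ?h z * gkernel s z)
        \<le> norm (2 * a\<^sup>2 * (sqdiff f z * gkernel s z) + 2 * b\<^sup>2 * (sqdiff g z * gkernel s z))" by simp
    qed
  qed measurable
  show "borel_Hs s ?h" using k1 k2 by (simp add: borel_Hs_def)
  have "l2sq ?h \<le> 2 * a\<^sup>2 * l2sq f + 2 * b\<^sup>2 * l2sq g"
    unfolding l2sq_def using integral_mono[OF k1 j1 le1] i by simp
  moreover have "gag s ?h \<le> 2 * a\<^sup>2 * gag s f + 2 * b\<^sup>2 * gag s g"
    unfolding gag_def using integral_mono[OF k2 j2 le2] i by simp
  ultimately show "hs2 s ?h \<le> 2 * a\<^sup>2 * hs2 s f + 2 * b\<^sup>2 * hs2 s g"
    by (simp add: hs2_def algebra_simps)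
qed

lemma hs2_add:
  assumes "borel_Hs s f" "borel_Hs s g"
  shows "borel_Hs s (\<lambda>v. f v + g v)" "hs2 s (\<lambda>v. f v + g v) \<le> 2 * hs2 s f + 2 * hs2 s g"
  using hs2_linear_combination[OF assms, of 1 1] by auto

lemma hs2_diff:
  assumes "borel_Hs s f" "borel_Hs s g"
  shows "borel_Hs s (\<lambda>v. f v - g v)" "hs2 s (\<lambda>v. f v - g v) \<le> 2 * hs2 s f + 2 * hs2 s g"
  using hs2_linear_combination[OF assms, of 1 "-1"] by auto

text \<open>The increment of \<open>(c - 1) f\<close> is split as
  \<open>(c(x) - 1)(f(y) - f(x)) + f(y)(c(y) - c(x))\<close>. The first part is dominated by the
  Gagliardo integrand of \<open>f\<close>, the second by \<open>f(y)^2 min(1, |x - y|^2)\<close>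
  times the kernel, so dominated convergence applies.\<close>

lemma cutoff_approx:
  fixes f :: "'a::euclidean_space \<Rightarrow> real"
  assumes f: "borel_Hs s f" and s: "0 < s" "s < 1" and e: "e > 0"
  obtains u M where "borel_Hs s u" "\<And>x. norm x \<ge> M \<Longrightarrow> u x = 0" "hs2 s (\<lambda>v. u v - f v) < e"
proof -
  have [measurable]: "f \<in> borel_measurable borel" using f by (simp add: borel_Hs_def)
  have i: "integrable lborel (\<lambda>v. (f v)\<^sup>2)" "integrable lborel (\<lambda>z. sqdiff f z * gkernel s z)"
    using f by (auto simp: borel_Hs_def)
  let ?c = "\<lambda>n. cutoff (real (Suc n)) :: 'a \<Rightarrow> real"
  let ?w = "\<lambda>n v. ?c n v * f v - f v"
  have c1: "\<bar>?c n v - 1\<bar> \<le> 1" for n v using cutoff_bounds[of "real (Suc n)" v] by auto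
  have ev: "\<forall>\<^sub>F n in sequentially. ?c n v = 1" for v
  proof -
    obtain N :: nat where N: "norm v \<le> real N" using real_arch_simple by blast
    show ?thesis using eventually_ge_at_top[of N]
    proof eventually_elim
      case (elim n)
      then have "norm v \<le> real (Suc n)" using N by linarith
      then show ?case by (intro cutoff_eq_1) auto
    qed
  qed
  have wle: "(?w n v)\<^sup>2 \<le> (f v)\<^sup>2" for n v
  proof -
    have "\<bar>?w n v\<bar> = \<bar>?c n v - 1\<bar> * \<bar>f v\<bar>" by (simp add: abs_mult[symmetric] algebra_simps)
    also have "\<dots> \<le> \<bar>f v\<bar>" using c1[of n v] by (simp add: mult_left_le_one_le)
    finally show ?thesis by (simp add: abs_le_square_iff)
  qed
  have l2: "(\<lambda>n. LINT v|lborel. (?w n v)\<^sup>2) \<longlonglongrightarrow> (LINT v|(lborel::'a measure). 0)"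
  proof (rule integral_dominated_convergence[OF _ _ i(1)])
    show "AE v in lborel. (\<lambda>n. (?w n v)\<^sup>2) \<longlonglongrightarrow> 0"
      by (intro AE_I2 tendsto_eventually, rule eventually_mono[OF ev]) auto
  qed (use wle in auto)
  \<comment> \<open>Bounds the squared increments of all cutoffs at once, as they are 1-Lipschitz
    with values between 0 and 1. The factor 1 makes the kernel integrable at infinity, the square
    near the diagonal.\<close>
  let ?m = "\<lambda>z. min 1 ((gap z)\<^sup>2) :: real"
  have intm: "integrable lborel (\<lambda>z::'a \<times> 'a. (f (snd z))\<^sup>2 * (?m z * gkernel s z))"
  proof (rule integrableI_bounded)
    let ?L = "gtail_const TYPE('a) s"
    have L: "?L \<ge> 0" using gtail_const_pos[OF s(1), where 'a='a] by simp
    have t: "ktail s ?L (gkernel s :: 'a \<times> 'a \<Rightarrow> real)" "ktail s ?L (\<lambda>z::'a \<times> 'a. gkernel s (prod.swap z))"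
      using ktail_gkernel[OF s(1)] by simp_all
    let ?n = "\<lambda>z::'a \<times> 'a. indicator {0<..<1} (gap z) * (ennreal (gap z powr 2) * ennreal \<bar>gkernel s z\<bar>) :: ennreal"
    let ?f = "\<lambda>z::'a \<times> 'a. indicator {1..} (gap z) * ennreal \<bar>gkernel s z\<bar> :: ennreal"
    let ?h = "\<lambda>v. ennreal ((f v)\<^sup>2)"
    have "(\<integral>\<^sup>+z. ennreal (norm ((f (snd z))\<^sup>2 * (?m z * gkernel s z))) \<partial>lborel)
      \<le> (\<integral>\<^sup>+z. ?h (snd z) * ?n z + ?h (snd z) * ?f z \<partial>lborel)"
    proof (rule nn_integral_mono)
      fix z :: "'a \<times> 'a"
      consider "gap z = 0" | "gap z \<ge> 1" | "0 < gap z" "gap z < 1" using gap_nonneg[of z] by linarith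
      then show "ennreal (norm ((f (snd z))\<^sup>2 * (?m z * gkernel s z))) \<le> ?h (snd z) * ?n z + ?h (snd z) * ?f z"
      proof cases
        case 2
        then show ?thesis by (auto simp: abs_mult simp flip: ennreal_mult intro!: ennreal_leI mult_left_mono)
      next
        case 3
        then show ?thesis by (auto simp: abs_mult simp flip: ennreal_mult intro!: ennreal_leI mult_left_mono mult_right_mono)
      qed simp
    qed
    also have "\<dots> = (\<integral>\<^sup>+z. ?h (snd z) * ?n z \<partial>lborel) + (\<integral>\<^sup>+z. ?h (snd z) * ?f z \<partial>lborel)"
      by (rule nn_integral_add) measurable
    also have "\<dots> < \<infinity>"
      using ktail_near(2)[OF _ _ t _ L, of ?h 1 2] ktail_far(2)[OF _ _ t _ L, of ?h 1] s i(1)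
      by (auto simp: ennreal_mult_less_top integrable_iff_bounded elim!: le_less_trans)
    finally show "(\<integral>\<^sup>+z. ennreal (norm ((f (snd z))\<^sup>2 * (?m z * gkernel s z))) \<partial>lborel) < \<infinity>" .
  qed measurable
  let ?W = "\<lambda>z. 2 * (sqdiff f z * gkernel s z) + 2 * ((f (snd z))\<^sup>2 * (?m z * gkernel s z))"
  have intW: "integrable lborel ?W"
    by (intro Bochner_Integration.integrable_add integrable_mult_right i intm)
  have Wle: "sqdiff (?w n) z * gkernel s z \<le> ?W z" for n z
  proof -
    let ?x = "fst z" and ?y = "snd z"
    have "sqdiff (?w n) z = ((?c n ?x - 1) * (f ?y - f ?x) + f ?y * (?c n ?y - ?c n ?x))\<^sup>2"
      by (simp add: sqdiff_def algebra_simps)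
    also have "\<dots> \<le> 2 * ((?c n ?x - 1) * (f ?y - f ?x))\<^sup>2 + 2 * (f ?y * (?c n ?y - ?c n ?x))\<^sup>2"
      by (rule power2_add_le)
    also have "\<dots> \<le> 2 * sqdiff f z + 2 * ((f ?y)\<^sup>2 * ?m z)"
    proof (intro add_mono mult_left_mono)
      have "(?c n ?x - 1)\<^sup>2 \<le> 1" using c1[of n ?x] by (simp add: abs_square_le_1)
      then show "((?c n ?x - 1) * (f ?y - f ?x))\<^sup>2 \<le> sqdiff f z"
        unfolding power_mult_distrib sqdiff_def by (intro mult_left_le_one_le) auto
      have "\<bar>?c n ?y - ?c n ?x\<bar> \<le> gap z" using cutoff_Lipschitz[of "real (Suc n)" ?y ?x] by (simp add: gap_def norm_minus_commute)
      then have "(?c n ?y - ?c n ?x)\<^sup>2 \<le> (gap z)\<^sup>2"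
        using power_mono[of "\<bar>?c n ?y - ?c n ?x\<bar>" "gap z" 2] by (simp only: power2_abs abs_ge_zero simp_thms)
      moreover have "\<bar>?c n ?y - ?c n ?x\<bar> \<le> 1"
        using cutoff_bounds[of "real (Suc n)" ?x] cutoff_bounds[of "real (Suc n)" ?y] by linarith
      then have "(?c n ?y - ?c n ?x)\<^sup>2 \<le> 1" by (simp add: abs_square_le_1)
      ultimately show "(f ?y * (?c n ?y - ?c n ?x))\<^sup>2 \<le> (f ?y)\<^sup>2 * ?m z"
        unfolding power_mult_distrib by (intro mult_left_mono) auto
    qed auto
    finally have "sqdiff (?w n) z * gkernel s z \<le> (2 * sqdiff f z + 2 * ((f ?y)\<^sup>2 * ?m z)) * gkernel s z"
      by (rule mult_right_mono) simp
    then show ?thesis by (simp add: algebra_simps)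
  qed
  have Wle': "norm (sqdiff (?w n) z * gkernel s z) \<le> ?W z" for n z
    using Wle[of n z] by (simp add: abs_mult)
  have l3: "(\<lambda>n. LINT z|lborel. sqdiff (?w n) z * gkernel s z) \<longlonglongrightarrow> (LINT z|(lborel::('a \<times> 'a) measure). 0)"
  proof (rule integral_dominated_convergence[OF _ _ intW])
    show "AE z in lborel. (\<lambda>n. sqdiff (?w n) z * gkernel s z) \<longlonglongrightarrow> 0"
    proof (intro AE_I2 tendsto_eventually)
      fix z :: "'a \<times> 'a"
      show "\<forall>\<^sub>F n in sequentially. sqdiff (?w n) z * gkernel s z = 0"
        using ev[of "fst z"] ev[of "snd z"] by eventually_elim (simp add: sqdiff_def)
    qed
  qed (use Wle' in auto)
  have wH: "borel_Hs s (?w n)" for n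
    unfolding borel_Hs_def
  proof (intro conjI)
    show "integrable lborel (\<lambda>v. (?w n v)\<^sup>2)"
      by (rule Bochner_Integration.integrable_bound[OF i(1)]) (use wle in auto)
    show "integrable lborel (\<lambda>z. sqdiff (?w n) z * gkernel s z)"
    proof (rule Bochner_Integration.integrable_bound[OF intW])
      show "AE z in lborel. norm (sqdiff (?w n) z * gkernel s z) \<le> norm (?W z)"
        by (intro AE_I2 order_trans[OF Wle']) auto
    qed measurable
  qed measurable
  have "(\<lambda>n. hs2 s (?w n)) \<longlonglongrightarrow> 0 + 0"
    unfolding hs2_def l2sq_def gag_def using l2 l3 by (intro tendsto_add) simp_all
  then obtain n where n: "hs2 s (?w n) < e"
    using e by (auto dest!: LIMSEQ_D[of _ _ e])
  show ?thesis
  proof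
    show "borel_Hs s (\<lambda>v. ?c n v * f v)" using hs2_add(1)[OF wH[of n] f] by simp
    show "?c n x * f x = 0" if "norm x \<ge> 2 * real (Suc n)" for x
      using cutoff_eq_0[of "real (Suc n)" x] that by simp
    show "hs2 s (?w n) < e" by (rule n)
  qed
qed

lemma integrable_of_compact_support:
  fixes u :: "'a::euclidean_space \<Rightarrow> real"
  assumes [measurable]: "u \<in> borel_measurable borel" and int: "integrable lborel (\<lambda>v. (u v)\<^sup>2)"
    and M: "\<And>x. norm x \<ge> M \<Longrightarrow> u x = 0"
  shows "integrable lborel u"
proof -
  have "integrable lborel (\<lambda>v::'a. (indicator (ball 0 \<bar>M\<bar>) v)\<^sup>2 :: real)"
    using integral_ball_indicator(1)[of "\<bar>M\<bar>" "0::'a"] by (simp add: power2_eq_square flip: indicator_inter_arith)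
  then have "integrable lborel (\<lambda>v. indicator (ball 0 \<bar>M\<bar>) v * u v)"
    by (rule Cauchy_Schwarz_integral(1)[OF _ _ _ int, rotated 2]) (auto intro!: borel_measurable_indicator)
  moreover have "(\<lambda>v. indicator (ball 0 \<bar>M\<bar>) v * u v) = u"
    using M by (force simp: indicator_def)
  ultimately show ?thesis by simp
qed

text \<open>Mollification commutes with the diagonal translations of pairs, and the Gagliardo kernel is
  invariant under them; so both parts of the norm reduce to translation continuity in the mean.\<close>

lemma test_function_approx:
  fixes f :: "'a::euclidean_space \<Rightarrow> real"
  assumes f: "borel_Hs s f" and s: "0 < s" "s < 1" and e: "e > 0"
  obtains \<phi> where "test_function \<phi>" "hs2 s (\<lambda>v. \<phi> v - f v) < e"
proof -
  \<comment> \<open>The cutoff costs \<open>e / 8\<close> and the mollification at most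
    \<open>e / 4\<close>; by \<open>hs2_add\<close> the total is at most
    \<open>2 (e / 4) + 2 (e / 8) < e\<close>.\<close>
  obtain u M where u: "borel_Hs s u" "\<And>x. norm x \<ge> M \<Longrightarrow> u x = 0" "hs2 s (\<lambda>v. u v - f v) < e / 8"
    using cutoff_approx[OF f s, of "e / 8"] e by auto
  have [measurable]: "u \<in> borel_measurable borel" using u by (simp add: borel_Hs_def)
  have i: "integrable lborel (\<lambda>v. (u v)\<^sup>2)" "integrable lborel (\<lambda>z. sqdiff u z * gkernel s z)"
    using u by (auto simp: borel_Hs_def)
  have iu: "integrable lborel u" by (rule integrable_of_compact_support[OF _ i(1) u(2)]) auto
  obtain \<rho> :: "'a \<Rightarrow> real" where "mollifier \<rho>"
    using ex_mollifier[where 'a='a] by (auto simp: mollifier_def)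
  then interpret mollifier \<rho> .
  \<comment> \<open>Its square is the Gagliardo integrand of \<open>u\<close>, so the seminorm is
    the L2 norm of a function on pairs.\<close>
  let ?F = "\<lambda>z. (u (snd z) - u (fst z)) * sqrt (gkernel s z)"
  have F2: "(?F z)\<^sup>2 = sqdiff u z * gkernel s z" for z
    by (simp add: power_mult_distrib sqdiff_def)
  obtain d1 where d1: "d1 > 0" "\<And>h. norm h < d1 \<Longrightarrow> (\<integral>\<^sup>+x. ennreal ((u (x - h) - u x)\<^sup>2) \<partial>lborel) \<le> ennreal (e / 8)"
    using L2_translation_continuous[of u "e / 8"] i(1) e by auto
  obtain d2 where d2: "d2 > 0" "\<And>h. norm h < d2 \<Longrightarrow> (\<integral>\<^sup>+x. ennreal ((?F (x - h) - ?F x)\<^sup>2) \<partial>lborel) \<le> ennreal (e / 8)"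
    using L2_translation_continuous[of ?F "e / 8"] i(2) e by (auto simp: F2)
  \<comment> \<open>The half compensates for the length of a diagonal translation,
    \<open>norm (z, z) <= 2 * norm z\<close>.\<close>
  define r where "r = min d1 (d2 / 2)"
  have r: "r > 0" using d1 d2 by (simp add: r_def)
  let ?\<phi> = "conv (scaled \<rho> r) u"
  have sc: "test_function (scaled \<rho> r)" by (rule test_function_scaled[OF test r])
  have [measurable]: "scaled \<rho> r \<in> borel_measurable borel" by (rule test_function_measurable[OF sc])
  have \<phi>: "test_function ?\<phi>" by (rule test_function_conv[OF sc iu, of M]) (use u(2) in auto)
  have ic: "integrable lborel (\<lambda>z. scaled \<rho> r z * u (v - z))" for v
    using integrable_lborel_affine[OF conv_integrable[OF sc iu, of v], of "-1" v] by simp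
  have isc: "integrable lborel (scaled \<rho> r)" by (rule test_function_integrable[OF sc])
  have is1: "integral\<^sup>L lborel (scaled \<rho> r) = 1" by (simp add: integral_scaled[OF test r] integral_1)
  have conv_eq: "?\<phi> v = (LINT z|lborel. scaled \<rho> r z * u (v - z))" for v
    using integral_reflect_shift[of "\<lambda>w. scaled \<rho> r (v - w) * u w" v] by (simp add: conv_def)
  have diff_eq: "?\<phi> v - u v = (LINT z|lborel. scaled \<rho> r z * (u (v - z) - u v))" for v
    unfolding conv_eq using ic isc is1 by (simp add: right_diff_distrib)
  let ?w = "\<lambda>v. ?\<phi> v - u v"
  have wH: "borel_Hs s ?w" by (rule hs2_diff(1)[OF borel_Hs_test[OF \<phi> s] u(1)])
  have "(\<integral>\<^sup>+v. ennreal ((?w v)\<^sup>2) \<partial>lborel) \<le> ennreal (e / 8)"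
    unfolding diff_eq by (rule mollify_L2_le[OF r, where \<iota> = "\<lambda>z. z"]) (use d1 in \<open>auto simp: r_def\<close>)
  moreover have "(\<integral>\<^sup>+z. ennreal (sqdiff ?w z * gkernel s z) \<partial>lborel) \<le> ennreal (e / 8)"
  proof -
    have gk: "gkernel s (p - (z, z)) = gkernel s p" for p :: "'a \<times> 'a" and z
      by (simp add: gkernel_def gap_def)
    have "sqdiff ?w p * gkernel s p = (LINT z|lborel. scaled \<rho> r z * (?F (p - (z, z)) - ?F p))\<^sup>2" for p
    proof -
      have "(LINT z|lborel. scaled \<rho> r z * (?F (p - (z, z)) - ?F p))
        = (LINT z|lborel. sqrt (gkernel s p) * (scaled \<rho> r z * (u (snd p - z) - u (snd p)) - scaled \<rho> r z * (u (fst p - z) - u (fst p))))"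
        unfolding gk by (intro Bochner_Integration.integral_cong refl) (simp add: algebra_simps)
      also have "\<dots> = sqrt (gkernel s p) * (?w (snd p) - ?w (fst p))"
        unfolding diff_eq using ic isc by (simp add: right_diff_distrib)
      finally show ?thesis by (simp add: power_mult_distrib sqdiff_def)
    qed
    moreover have "(\<integral>\<^sup>+p. ennreal ((LINT z|lborel. scaled \<rho> r z * (?F (p - (z, z)) - ?F p))\<^sup>2) \<partial>lborel) \<le> ennreal (e / 8)"
    proof (rule mollify_L2_le[OF r, where \<iota> = "\<lambda>z. (z, z)"])
      fix z :: 'a assume "norm z < r"
      moreover have "norm (z, z) \<le> norm z + norm z" by (rule norm_Pair_le)
      ultimately have "norm (z, z) < d2" by (simp add: r_def)
      then show "(\<integral>\<^sup>+x. ennreal ((?F (x - (z, z)) - ?F x)\<^sup>2) \<partial>lborel) \<le> ennreal (e / 8)" by (rule d2(2))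
    qed measurable
    ultimately show ?thesis by simp
  qed
  ultimately have "ennreal (hs2 s ?w) \<le> ennreal (e / 8) + ennreal (e / 8)"
    unfolding nn_hs2[OF wH] by (rule add_mono)
  also have "\<dots> = ennreal (e / 4)" using e by (simp flip: ennreal_plus)
  finally have "hs2 s ?w \<le> e / 4" using e by simp
  moreover have "hs2 s (\<lambda>v. ?w v + (u v - f v)) \<le> 2 * hs2 s ?w + 2 * hs2 s (\<lambda>v. u v - f v)"
    by (rule hs2_add(2)[OF wH hs2_diff(1)[OF u(1) f]])
  ultimately have "hs2 s (\<lambda>v. ?\<phi> v - f v) < e" using u(3) e by simp
  then show ?thesis by (rule that[OF \<phi>])
qed

section \<open>Passing to a Borel representative of the kernel\<close>

text \<open>Completeness of Lebesgue measure makes \<open>f\<close> measurable as soon as it agrees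
  almost everywhere with a Borel function; all statements over \<open>lebesgue\<close> are moved to
  \<open>lborel\<close> in this way, where product-measure arguments are carried out.\<close>

lemma lebesgue_integral_eq_lborel:
  fixes f g :: "'a::euclidean_space \<Rightarrow> 'b::euclidean_space"
  assumes g: "g \<in> borel_measurable borel" and ae: "AE x in lborel. f x = g x"
  shows "f \<in> borel_measurable lebesgue" "integral\<^sup>L lebesgue f = integral\<^sup>L lborel g"
    "integrable lebesgue f \<longleftrightarrow> integrable lborel g"
proof -
  have gl: "g \<in> borel_measurable lebesgue" using g by (simp add: measurable_completion)
  have ae': "AE x in lebesgue. g x = f x" using ae by (intro AE_completion) (auto elim: eventually_mono)
  show fl: "f \<in> borel_measurable lebesgue" by (rule borel_measurable_AE[OF gl ae'])
  have "integral\<^sup>L lebesgue f = integral\<^sup>L lebesgue g"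
    by (rule integral_cong_AE[OF fl gl]) (use ae' in \<open>auto elim: eventually_mono\<close>)
  then show "integral\<^sup>L lebesgue f = integral\<^sup>L lborel g"
    using integral_completion[of g lborel] g by simp
  have "integrable lebesgue f \<longleftrightarrow> integrable lebesgue g"
    by (rule integrable_cong_AE[OF fl gl]) (use ae' in \<open>auto elim: eventually_mono\<close>)
  then show "integrable lebesgue f \<longleftrightarrow> integrable lborel g"
    using integrable_completion[of g lborel] g by simp
qed

lemma AE_lborel_fst_snd:
  assumes "AE v in (lborel :: 'a::euclidean_space measure). P v"
  shows "AE z in (lborel :: ('a \<times> 'a) measure). P (fst z)" "AE z in (lborel :: ('a \<times> 'a) measure). P (snd z)"
proof -
  obtain N where "N \<in> null_sets lborel" "{v \<in> space lborel. \<not> P v} \<subseteq> N"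
    using assms unfolding eventually_ae_filter by blast
  then have N: "N \<in> null_sets lborel" "\<And>v. v \<notin> N \<Longrightarrow> P v" by auto
  then have [measurable]: "N \<in> sets borel" by auto
  have ae: "AE v in lborel. v \<notin> N" using N by (intro AE_not_in)
  have "AE z in (lborel :: 'a measure) \<Otimes>\<^sub>M lborel. fst z \<notin> N"
  proof (rule lborel_pair.AE_pair_measure)
    show "{z \<in> space (lborel \<Otimes>\<^sub>M lborel). fst z \<notin> N} \<in> sets (lborel \<Otimes>\<^sub>M lborel)" by measurable
  qed (use ae in auto)
  then show "AE z in (lborel :: ('a \<times> 'a) measure). P (fst z)"
    unfolding lborel_prod by (rule eventually_mono) (use N in auto)
  have "AE z in (lborel :: 'a measure) \<Otimes>\<^sub>M lborel. snd z \<notin> N"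
  proof (rule lborel_pair.AE_pair_measure)
    show "{z \<in> space (lborel \<Otimes>\<^sub>M lborel). snd z \<notin> N} \<in> sets (lborel \<Otimes>\<^sub>M lborel)" by measurable
  qed (use ae in auto)
  then show "AE z in (lborel :: ('a \<times> 'a) measure). P (snd z)"
    unfolding lborel_prod by (rule eventually_mono) (use N in auto)
qed

lemma AE_lborel_swap:
  assumes "AE z in (lborel :: ('a::euclidean_space \<times> 'a) measure). P z"
  shows "AE z in (lborel :: ('a \<times> 'a) measure). P (prod.swap z)"
proof -
  obtain N where "N \<in> null_sets lborel" "{z \<in> space lborel. \<not> P z} \<subseteq> N"
    using assms unfolding eventually_ae_filter by blast
  then have N: "N \<in> null_sets lborel" "\<And>z. z \<notin> N \<Longrightarrow> P z" by auto
  then have [measurable]: "N \<in> sets borel" by auto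
  have "AE z in distr lborel borel prod.swap. z \<notin> N"
    unfolding distr_lborel_swap using N by (intro AE_not_in)
  then have "AE z in (lborel :: ('a \<times> 'a) measure). prod.swap z \<notin> N"
    by (subst (asm) AE_distr_iff) auto
  then show ?thesis by (rule eventually_mono) (use N in auto)
qed

lemma AE_lborel_iterated:
  assumes "AE z in (lborel :: ('a::euclidean_space \<times> 'a) measure). P z"
  shows "AE v in lborel. AE v' in lborel. P (v, v')"
  by (rule lborel_pair.AE_pair) (unfold lborel_prod, rule assms)

text \<open>Principal values are truncated by removing an open ball, which keeps the sphere, whereas
  the form uses a strict inequality; the discrepancy is a null set.\<close>

lemma AE_norm_diff_neq: "AE v' in (lborel :: 'a::euclidean_space measure). norm (v - v') \<noteq> r"
proof -
  have "sphere v r \<in> null_sets lebesgue"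
    using negligible_sphere[of v r] by (simp add: negligible_iff_null_sets)
  then have "AE v' in lebesgue. v' \<notin> sphere v r" by (rule AE_not_in)
  then have "AE v' in lborel. v' \<notin> sphere v r" by (simp add: AE_completion_iff)
  then show ?thesis by (rule eventually_mono) (simp add: dist_norm)
qed

lemma integral_Fubini:
  fixes f :: "'a::euclidean_space \<times> 'a \<Rightarrow> real"
  assumes "integrable lborel f"
  shows "(LINT v|lborel. LINT v'|lborel. f (v, v')) = (LINT z|lborel. f z)"
  using lborel_pair.integral_fst'[of f] assms by (simp add: lborel_prod)

text \<open>The integrand \<open>\<psi> P\<close> may fail to be integrable; its integral is then 0
  by convention and the bound remains true.\<close>

lemma abs_integral_mult_le:
  fixes \<psi> :: "'a::euclidean_space \<Rightarrow> real" and P :: "'a \<Rightarrow> 'b::euclidean_space"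
  assumes \<psi>: "test_function \<psi>" and P: "\<And>v. norm (P v) \<le> c"
  shows "norm (LINT v|lebesgue. \<psi> v *\<^sub>R P v) \<le> c * (LINT v|lborel. \<bar>\<psi> v\<bar>)"
proof -
  have c: "c \<ge> 0" using P[of undefined] norm_ge_zero order_trans by blast
  have meas: "\<psi> \<in> borel_measurable borel" by (rule test_function_measurable[OF \<psi>])
  have i: "integrable lebesgue (\<lambda>v. c * \<bar>\<psi> v\<bar>)"
    using lebesgue_integral_eq_lborel(3)[of "\<lambda>v. c * \<bar>\<psi> v\<bar>" "\<lambda>v. c * \<bar>\<psi> v\<bar>"] meas test_function_integrable[OF \<psi>]
    by simp
  have "norm (LINT v|lebesgue. \<psi> v *\<^sub>R P v) \<le> (LINT v|lebesgue. norm (\<psi> v *\<^sub>R P v))"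
    by (rule integral_norm_bound)
  also have "\<dots> \<le> (LINT v|lebesgue. c * \<bar>\<psi> v\<bar>)"
  proof (rule integral_mono')
    show "norm (\<psi> v *\<^sub>R P v) \<le> c * \<bar>\<psi> v\<bar>" for v
      using mult_right_mono[OF P[of v] abs_ge_zero[of "\<psi> v"]] by (simp add: mult.commute)
  qed (use i c in auto)
  also have "\<dots> = (LINT v|lborel. c * \<bar>\<psi> v\<bar>)"
    using meas by (intro lebesgue_integral_eq_lborel) auto
  finally show ?thesis by simp
qed

section \<open>The hypotheses on \<open>K\<close> restated as double integrals of a Borel
  kernel\<close>

locale kernel_representative =
  fixes K :: "'a::euclidean_space \<Rightarrow> 'a \<Rightarrow> real" and k :: "'a \<times> 'a \<Rightarrow> real" and s \<Lambda> :: real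
  assumes k_measurable [measurable]: "k \<in> borel_measurable borel"
    and K_eq_k: "AE z in lborel. K (fst z) (snd z) = k z"
    and s: "0 < s" "s < 1"
    and K_tail: "tail_bound s \<Lambda> K" "tail_bound s \<Lambda> (\<lambda>v v'. K v' v)"
begin

lemma Lambda_nonneg: "\<Lambda> \<ge> 0"
proof -
  have "0 \<le> (LINT v':- ball 0 1|lebesgue. \<bar>K 0 v'\<bar>)"
    unfolding set_lebesgue_integral_def by (intro Bochner_Integration.integral_nonneg) (auto simp: indicator_def)
  also have "\<dots> \<le> \<Lambda> * 1 powr (- 2 * s)"
    using K_tail(1)[unfolded tail_bound_def, rule_format, of 1 0] by simp
  finally show ?thesis by simp
qed

lemma K_eq_k_iterated:
  "AE v in lborel. (AE v' in lborel. K v v' = k (v, v')) \<and> (AE v' in lborel. K v' v = k (v', v))"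
  using AE_lborel_iterated[OF K_eq_k] AE_lborel_iterated[OF AE_lborel_swap[OF K_eq_k]]
  by (simp add: AE_conj_iff)

lemma ktail_of_tail_bound:
  assumes t: "tail_bound s \<Lambda> H" and [measurable]: "h \<in> borel_measurable borel"
    and ae: "AE v in lborel. AE v' in lborel. H v v' = h (v, v')"
  shows "ktail s \<Lambda> h"
  unfolding ktail_def
proof (intro allI impI)
  fix R :: real assume R: "R > 0"
  show "AE v in lborel. (\<integral>\<^sup>+v'. indicator {R..} (gap (v, v')) * ennreal \<bar>h (v, v')\<bar> \<partial>lborel) \<le> ennreal (\<Lambda> * R powr (- 2 * s))"
    using ae
  proof eventually_elim
    case (elim v)
    have i: "integrable lebesgue (\<lambda>v'. indicator (- ball v R) v' * \<bar>H v v'\<bar>)"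
    proof -
      have "set_integrable lebesgue (- ball v R) (H v)" using t R by (simp add: tail_bound_def)
      from set_integrable_abs[OF this] show ?thesis by (simp add: set_integrable_def)
    qed
    have "(\<integral>\<^sup>+v'. indicator {R..} (gap (v, v')) * ennreal \<bar>h (v, v')\<bar> \<partial>lborel)
      = (\<integral>\<^sup>+v'. ennreal (indicator (- ball v R) v' * \<bar>H v v'\<bar>) \<partial>lborel)"
    proof (rule nn_integral_cong_AE)
      show "AE v' in lborel. indicator {R..} (gap (v, v')) * ennreal \<bar>h (v, v')\<bar> = ennreal (indicator (- ball v R) v' * \<bar>H v v'\<bar>)"
        using elim by eventually_elim (auto simp: indicator_def gap_Pair dist_norm)
    qed
    also have "\<dots> = (\<integral>\<^sup>+v'. ennreal (indicator (- ball v R) v' * \<bar>H v v'\<bar>) \<partial>lebesgue)"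
      by (rule nn_integral_completion[symmetric])
    also have "\<dots> = ennreal (LINT v'|lebesgue. indicator (- ball v R) v' * \<bar>H v v'\<bar>)"
      by (rule nn_integral_eq_integral[OF i]) auto
    also have "\<dots> \<le> ennreal (\<Lambda> * R powr (- 2 * s))"
      using t R by (intro ennreal_leI) (simp add: tail_bound_def set_lebesgue_integral_def)
    finally show ?case .
  qed
qed

lemma k_tail: "ktail s \<Lambda> k" "ktail s \<Lambda> (\<lambda>z. k (prod.swap z))"
proof -
  show "ktail s \<Lambda> k"
    by (rule ktail_of_tail_bound[OF K_tail(1)]) (use AE_lborel_iterated[OF K_eq_k] in auto)
  show "ktail s \<Lambda> (\<lambda>z. k (prod.swap z))"
    by (rule ktail_of_tail_bound[OF K_tail(2)]) (use AE_lborel_iterated[OF AE_lborel_swap[OF K_eq_k]] in auto)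
qed

definition skew :: "'a \<times> 'a \<Rightarrow> real" where
  "skew z = k z - k (prod.swap z)"

lemma skew_measurable [measurable]: "skew \<in> borel_measurable borel"
  unfolding skew_def[abs_def] by measurable

lemma skew_swap: "skew (prod.swap z) = - skew z"
  by (simp add: skew_def)

lemma skew_tail: "ktail s (2 * \<Lambda>) skew"
  unfolding ktail_def
proof (intro allI impI)
  fix R :: real assume R: "R > 0"
  have 1: "AE v in lborel. (\<integral>\<^sup>+v'. indicator {R..} (gap (v, v')) * ennreal \<bar>k (v, v')\<bar> \<partial>lborel) \<le> ennreal (\<Lambda> * R powr (- 2 * s))"
    and 2: "AE v in lborel. (\<integral>\<^sup>+v'. indicator {R..} (gap (v, v')) * ennreal \<bar>k (v', v)\<bar> \<partial>lborel) \<le> ennreal (\<Lambda> * R powr (- 2 * s))"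
    using k_tail R by (auto simp: ktail_def)
  from 1 2 show "AE v in lborel. (\<integral>\<^sup>+v'. indicator {R..} (gap (v, v')) * ennreal \<bar>skew (v, v')\<bar> \<partial>lborel) \<le> ennreal (2 * \<Lambda> * R powr (- 2 * s))"
  proof eventually_elim
    case (elim v)
    have [measurable]: "(\<lambda>v'. k (v, v')) \<in> borel_measurable borel" "(\<lambda>v'. k (v', v)) \<in> borel_measurable borel"
      by measurable
    have "(\<integral>\<^sup>+v'. indicator {R..} (gap (v, v')) * ennreal \<bar>skew (v, v')\<bar> \<partial>lborel)
      \<le> (\<integral>\<^sup>+v'. indicator {R..} (gap (v, v')) * ennreal \<bar>k (v, v')\<bar> + indicator {R..} (gap (v, v')) * ennreal \<bar>k (v', v)\<bar> \<partial>lborel)"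
      by (intro nn_integral_mono) (auto simp: skew_def indicator_def simp flip: ennreal_plus intro!: ennreal_leI)
    also have "\<dots> \<le> ennreal (\<Lambda> * R powr (- 2 * s)) + ennreal (\<Lambda> * R powr (- 2 * s))"
    proof (subst nn_integral_add)
      show "(\<integral>\<^sup>+v'. indicator {R..} (gap (v, v')) * ennreal \<bar>k (v, v')\<bar> \<partial>lborel) + (\<integral>\<^sup>+v'. indicator {R..} (gap (v, v')) * ennreal \<bar>k (v', v)\<bar> \<partial>lborel)
        \<le> ennreal (\<Lambda> * R powr (- 2 * s)) + ennreal (\<Lambda> * R powr (- 2 * s))"
        by (intro add_mono elim)
    qed measurable
    also have "\<dots> = ennreal (2 * \<Lambda> * R powr (- 2 * s))"
      using Lambda_nonneg by (simp flip: ennreal_plus)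
    finally show ?case .
  qed
qed

lemma skew_tail_swap: "ktail s (2 * \<Lambda>) (\<lambda>z. skew (prod.swap z))"
  using skew_tail by (simp add: ktail_def skew_swap)

text \<open>Away from the diagonal the tail bounds give absolute convergence, which justifies
  Fubini. The weight \<open>w\<close> is 1 for the zeroth moment and a coordinate of
  \<open>v - v'\<close> for the first.\<close>

lemma integral_truncated_skew:
  fixes J :: "real set" and w :: "'a \<times> 'a \<Rightarrow> real"
  assumes \<psi>: "test_function \<psi>" and \<epsilon>: "\<epsilon> > 0" and J: "J \<in> sets borel" "J \<subseteq> {\<epsilon>..}"
    and [measurable]: "w \<in> borel_measurable borel" and w: "\<And>z. gap z \<in> J \<Longrightarrow> \<bar>w z\<bar> \<le> B" and B: "B \<ge> 0"
  shows "integrable lborel (\<lambda>z. indicator J (gap z) * (\<psi> (fst z) * (w z * skew z)))" (is ?int)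
    and "(LINT v|lborel. \<psi> v * (LINT v'|lborel. indicator J (gap (v, v')) * (w (v, v') * skew (v, v'))))
      = (LINT z|lborel. indicator J (gap z) * (\<psi> (fst z) * (w z * skew z)))"
proof -
  have [measurable]: "\<psi> \<in> borel_measurable borel" "J \<in> sets borel"
    using J test_function_measurable[OF \<psi>] by auto
  \<comment> \<open>The indicator is repeated inside the bounded factor because \<open>w\<close> is
    bounded by \<open>B\<close> only where the distance lies in \<open>J\<close>.\<close>
  have "integrable lborel (\<lambda>z. indicator J (gap z) * ((indicator J (gap z) * (\<psi> (fst z) * w z)) * skew z))"
  proof (rule integrable_kernel_far[OF skew_measurable skew_tail skew_tail_swap _ _ integrable_mult_right[OF test_function_integrable[OF \<psi>], of B] _ \<epsilon> J])
    fix z :: "'a \<times> 'a"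
    have "\<bar>indicator J (gap z) * (\<psi> (fst z) * w z)\<bar> \<le> \<bar>B * \<psi> (fst z)\<bar>"
      using mult_right_mono[OF w[of z] abs_ge_zero[of "\<psi> (fst z)"]] B
      by (cases "gap z \<in> J") (auto simp: abs_mult mult.commute)
    then show "\<bar>indicator J (gap z) * (\<psi> (fst z) * w z)\<bar> \<le> \<bar>B * \<psi> (fst z)\<bar> + \<bar>B * \<psi> (snd z)\<bar>" by simp
  qed (use Lambda_nonneg in auto)
  moreover have "(\<lambda>z. indicator J (gap z) * ((indicator J (gap z) * (\<psi> (fst z) * w z)) * skew z))
      = (\<lambda>z. indicator J (gap z) * (\<psi> (fst z) * (w z * skew z)))"
    by (auto simp: indicator_def)
  ultimately show ?int by simp
  from integral_Fubini[OF this]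
  show "(LINT v|lborel. \<psi> v * (LINT v'|lborel. indicator J (gap (v, v')) * (w (v, v') * skew (v, v'))))
      = (LINT z|lborel. indicator J (gap z) * (\<psi> (fst z) * (w z * skew z)))"
    by (simp add: mult.left_commute[of "\<psi> _"] flip: integral_mult_right_zero)
qed

text \<open>Identifies the quantity whose convergence is assumed in
  \<open>has_principal_value\<close> with the truncated double integral used by the skew
  form.\<close>

lemma truncated_pv0:
  assumes \<psi>: "test_function \<psi>" and \<epsilon>: "\<epsilon> > 0"
  shows "(LINT v|lebesgue. \<psi> v *\<^sub>R truncated_integral (\<lambda>v. UNIV) (\<lambda>v v'. K v v' - K v' v) \<epsilon> v)
    = (LINT z|lborel. indicator {\<epsilon><..} (gap z) * (\<psi> (fst z) * skew z))"
proof -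
  have [measurable]: "\<psi> \<in> borel_measurable borel" by (rule test_function_measurable[OF \<psi>])
  have ae: "AE v in lborel. \<psi> v *\<^sub>R truncated_integral (\<lambda>v. UNIV) (\<lambda>v v'. K v v' - K v' v) \<epsilon> v
      = \<psi> v * (LINT v'|lborel. indicator {\<epsilon><..} (gap (v, v')) * (1 * skew (v, v')))"
    using K_eq_k_iterated
  proof eventually_elim
    case (elim v)
    have "truncated_integral (\<lambda>v. UNIV) (\<lambda>v v'. K v v' - K v' v) \<epsilon> v
      = (LINT v'|lborel. indicator {\<epsilon><..} (gap (v, v')) * (1 * skew (v, v')))"
      unfolding truncated_integral_def set_lebesgue_integral_def
    proof (rule lebesgue_integral_eq_lborel)
      show "AE v' in lborel. indicator (UNIV - ball v \<epsilon>) v' *\<^sub>R (K v v' - K v' v) = indicator {\<epsilon><..} (gap (v, v')) * (1 * skew (v, v'))"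
        using elim[THEN conjunct1] elim[THEN conjunct2] AE_norm_diff_neq[of v \<epsilon>]
        by eventually_elim (auto simp: indicator_def gap_Pair dist_norm skew_def)
    qed measurable
    then show ?case by simp
  qed
  have "(LINT v|lebesgue. \<psi> v *\<^sub>R truncated_integral (\<lambda>v. UNIV) (\<lambda>v v'. K v v' - K v' v) \<epsilon> v)
    = (LINT v|lborel. \<psi> v * (LINT v'|lborel. indicator {\<epsilon><..} (gap (v, v')) * (1 * skew (v, v'))))"
    by (rule lebesgue_integral_eq_lborel[OF _ ae]) measurable
  also have "\<dots> = (LINT z|lborel. indicator {\<epsilon><..} (gap z) * (\<psi> (fst z) * (1 * skew z)))"
    by (rule integral_truncated_skew[OF \<psi> \<epsilon>, where w = "\<lambda>_. 1" and B = 1]) auto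
  finally show ?thesis by simp
qed

text \<open>The hypothesis is vector valued while the Taylor expansion uses coordinates. Taking the
  inner product inside both integrals needs integrability of the vector fields, first in
  \<open>v'\<close> for almost every \<open>v\<close>, then in \<open>v\<close>.\<close>

lemma truncated_pv1:
  assumes \<psi>: "test_function \<psi>" and \<epsilon>: "\<epsilon> > 0" and R: "R > 0" and b: "b \<in> Basis"
  shows "(LINT v|lebesgue. \<psi> v *\<^sub>R truncated_integral (\<lambda>v. ball v R) (\<lambda>v v'. (K v v' - K v' v) *\<^sub>R (v - v')) \<epsilon> v) \<bullet> b
    = (LINT z|lborel. indicator {\<epsilon><..<R} (gap z) * (\<psi> (fst z) * (((fst z - snd z) \<bullet> b) * skew z)))"
proof -
  let ?T = "\<lambda>v. truncated_integral (\<lambda>v. ball v R) (\<lambda>v v'. (K v v' - K v' v) *\<^sub>R (v - v')) \<epsilon> v"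
  let ?J = "{\<epsilon><..<R}"
  have [measurable]: "\<psi> \<in> borel_measurable borel" by (rule test_function_measurable[OF \<psi>])
  have wb: "\<bar>(fst z - snd z) \<bullet> c\<bar> \<le> R" if "gap z \<in> ?J" "c \<in> Basis" for c and z :: "'a \<times> 'a"
    using Basis_le_norm[OF that(2), of "fst z - snd z"] that(1) by (simp add: gap_def)
  let ?V = "\<lambda>v. LINT v'|lborel. (indicator ?J (gap (v, v')) * skew (v, v')) *\<^sub>R (v - v')"
  have [measurable]: "?V \<in> borel_measurable borel" by measurable
  have ae: "AE v in lborel. \<psi> v *\<^sub>R ?T v = \<psi> v *\<^sub>R ?V v"
    using K_eq_k_iterated
  proof eventually_elim
    case (elim v)
    have "?T v = ?V v"
      unfolding truncated_integral_def set_lebesgue_integral_def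
    proof (rule lebesgue_integral_eq_lborel)
      show "AE v' in lborel. indicator (ball v R - ball v \<epsilon>) v' *\<^sub>R (K v v' - K v' v) *\<^sub>R (v - v') = (indicator ?J (gap (v, v')) * skew (v, v')) *\<^sub>R (v - v')"
        using elim[THEN conjunct1] elim[THEN conjunct2] AE_norm_diff_neq[of v \<epsilon>]
        by eventually_elim (auto simp: indicator_def gap_Pair dist_norm skew_def)
    qed measurable
    then show ?case by simp
  qed
  have J: "?J \<in> sets borel" "?J \<subseteq> {\<epsilon>..}" by auto
  have intz: "integrable lborel (\<lambda>z. indicator ?J (gap z) * (\<psi> (fst z) * (((fst z - snd z) \<bullet> c) * skew z)))" if "c \<in> Basis" for c
    by (rule integral_truncated_skew(1)[OF \<psi> \<epsilon> J, where B = R]) (use wb that R in auto)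
  have V_inner: "AE v in lborel. \<forall>c\<in>Basis. ?V v \<bullet> c = (LINT v'|lborel. indicator ?J (gap (v, v')) * (((v - v') \<bullet> c) * skew (v, v')))"
  proof -
    have "AE v in lborel. (\<integral>\<^sup>+v'. indicator {\<epsilon>..} (gap (v, v')) * ennreal \<bar>skew (v, v')\<bar> \<partial>lborel) \<le> ennreal (2 * \<Lambda> * \<epsilon> powr (- 2 * s))"
      using skew_tail \<epsilon> by (simp add: ktail_def)
    then show ?thesis
    proof eventually_elim
      case (elim v)
      have "(\<integral>\<^sup>+v'. ennreal (norm ((indicator ?J (gap (v, v')) * skew (v, v')) *\<^sub>R (v - v'))) \<partial>lborel)
        \<le> (\<integral>\<^sup>+v'. ennreal R * (indicator {\<epsilon>..} (gap (v, v')) * ennreal \<bar>skew (v, v')\<bar>) \<partial>lborel)"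
      proof (rule nn_integral_mono)
        fix v'
        show "ennreal (norm ((indicator ?J (gap (v, v')) * skew (v, v')) *\<^sub>R (v - v'))) \<le> ennreal R * (indicator {\<epsilon>..} (gap (v, v')) * ennreal \<bar>skew (v, v')\<bar>)"
          using R mult_right_mono[of "norm (v - v')" R "\<bar>skew (v, v')\<bar>"]
          by (cases "gap (v, v') \<in> ?J")
             (auto simp: gap_Pair abs_mult mult.commute[of _ "norm (v - v')"] simp flip: ennreal_mult intro!: ennreal_leI)
      qed
      also have "\<dots> = ennreal R * (\<integral>\<^sup>+v'. indicator {\<epsilon>..} (gap (v, v')) * ennreal \<bar>skew (v, v')\<bar> \<partial>lborel)"
        by (rule nn_integral_cmult) measurable
      also have "\<dots> < \<infinity>"
        using le_less_trans[OF elim ennreal_less_top] by (auto simp: ennreal_mult_less_top)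
      finally have i: "integrable lborel (\<lambda>v'. (indicator ?J (gap (v, v')) * skew (v, v')) *\<^sub>R (v - v'))"
        by (intro integrableI_bounded) measurable
      show ?case
      proof
        fix c :: 'a assume "c \<in> Basis"
        have "?V v \<bullet> c = (LINT v'|lborel. ((indicator ?J (gap (v, v')) * skew (v, v')) *\<^sub>R (v - v')) \<bullet> c)"
          by (rule integral_inner_left[symmetric]) (use i in auto)
        then show "?V v \<bullet> c = (LINT v'|lborel. indicator ?J (gap (v, v')) * (((v - v') \<bullet> c) * skew (v, v')))"
          by (simp add: mult_ac)
      qed
    qed
  qed
  have intc: "integrable lborel (\<lambda>v. \<psi> v * (?V v \<bullet> c))" if c: "c \<in> Basis" for c
  proof -
    have "integrable lborel (\<lambda>v. LINT v'|lborel. indicator ?J (gap (v, v')) * (\<psi> v * (((v - v') \<bullet> c) * skew (v, v'))))"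
      using lborel_pair.integrable_fst'[of "\<lambda>z. indicator ?J (gap z) * (\<psi> (fst z) * (((fst z - snd z) \<bullet> c) * skew z))"] intz[OF c]
      by (simp add: lborel_prod)
    then show ?thesis
    proof (rule integrable_cong_AE_imp)
      show "AE v in lborel. (LINT v'|lborel. indicator ?J (gap (v, v')) * (\<psi> v * (((v - v') \<bullet> c) * skew (v, v')))) = \<psi> v * (?V v \<bullet> c)"
        using V_inner
      proof eventually_elim
        case (elim v)
        show ?case unfolding elim[rule_format, OF c]
          by (simp add: mult.left_commute[of _ "\<psi> v"])
      qed
    qed measurable
  qed
  \<comment> \<open>Recovered from the integrability of the coordinates by expanding in the
    basis.\<close>
  have intV: "integrable lborel (\<lambda>v. \<psi> v *\<^sub>R ?V v)"
  proof -
    have "integrable lborel (\<lambda>v. \<Sum>c\<in>Basis. (\<psi> v * (?V v \<bullet> c)) *\<^sub>R c)"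
      by (intro Bochner_Integration.integrable_sum integrable_scaleR_left intc)
    moreover have "(\<Sum>c\<in>Basis. (\<psi> v * (?V v \<bullet> c)) *\<^sub>R c) = \<psi> v *\<^sub>R ?V v" for v
      using euclidean_representation[of "\<psi> v *\<^sub>R ?V v"] by simp
    ultimately show ?thesis by simp
  qed
  have "(LINT v|lebesgue. \<psi> v *\<^sub>R ?T v) = (LINT v|lborel. \<psi> v *\<^sub>R ?V v)"
    by (rule lebesgue_integral_eq_lborel[OF _ ae]) measurable
  then have "(LINT v|lebesgue. \<psi> v *\<^sub>R ?T v) \<bullet> b = (LINT v|lborel. (\<psi> v *\<^sub>R ?V v) \<bullet> b)"
    using intV by (simp only: integral_inner_left)
  also have "\<dots> = (LINT v|lborel. \<psi> v * (LINT v'|lborel. indicator ?J (gap (v, v')) * (((fst (v, v') - snd (v, v')) \<bullet> b) * skew (v, v'))))"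
  proof (rule integral_cong_AE)
    show "AE v in lborel. (\<psi> v *\<^sub>R ?V v) \<bullet> b = \<psi> v * (LINT v'|lborel. indicator ?J (gap (v, v')) * (((fst (v, v') - snd (v, v')) \<bullet> b) * skew (v, v')))"
      using V_inner by eventually_elim (use b in auto)
  qed measurable
  also have "\<dots> = (LINT z|lborel. indicator ?J (gap z) * (\<psi> (fst z) * (((fst z - snd z) \<bullet> b) * skew z)))"
    by (rule integral_truncated_skew(2)[OF \<psi> \<epsilon> J, where B = R]) (use wb b R in auto)
  finally show ?thesis .
qed

end

lemma ktail_mono:
  assumes "ktail s L k" "L \<le> L'" shows "ktail s L' k"
  unfolding ktail_def
proof (intro allI impI)
  fix R :: real assume "R > 0"
  then have "AE v in lborel. (\<integral>\<^sup>+v'. indicator {R..} (gap (v, v')) * ennreal \<bar>k (v, v')\<bar> \<partial>lborel) \<le> ennreal (L * R powr (- 2 * s))"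
    using assms(1) by (simp add: ktail_def)
  moreover have "ennreal (L * R powr (- 2 * s)) \<le> ennreal (L' * R powr (- 2 * s))"
    using assms(2) by (intro ennreal_leI mult_right_mono) auto
  ultimately show "AE v in lborel. (\<integral>\<^sup>+v'. indicator {R..} (gap (v, v')) * ennreal \<bar>k (v, v')\<bar> \<partial>lborel) \<le> ennreal (L' * R powr (- 2 * s))"
    by (auto elim!: eventually_mono intro: order_trans)
qed

section \<open>The quadratic form on test functions\<close>

locale pv_kernel = kernel_representative +
  assumes PV0: "\<exists>P. has_principal_value (\<lambda>v. UNIV) (\<lambda>v v'. K v v' - K v' v) P \<and> (\<forall>v. \<bar>P v\<bar> \<le> \<Lambda>)"
    and PV1: "s \<ge> 1 / 2 \<Longrightarrow> \<forall>R>0. \<exists>P. has_principal_value (\<lambda>v. ball v R) (\<lambda>v v'. (K v v' - K v' v) *\<^sub>R (v - v')) P \<and>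
                 (\<forall>v. norm (P v) \<le> \<Lambda> * (1 + R powr (1 - 2 * s)))"
begin

text \<open>The term \<open>moment_const s 1\<close> is only meaningful, and only needed, for \<open>s < 1/2\<close>; the absolute
  value guards against its sign for larger \<open>s\<close>.\<close>

definition skew_bound :: real where
  "skew_bound = \<Lambda> * (4 + 2 * \<bar>moment_const s 1\<bar>)"

lemma skew_bound_ge: "\<Lambda> \<le> skew_bound" "2 * \<Lambda> \<le> skew_bound" "2 * \<Lambda> * moment_const s 1 \<le> skew_bound" "0 \<le> skew_bound"
proof -
  have "0 \<le> \<Lambda> * (3 + 2 * \<bar>moment_const s 1\<bar>)" "0 \<le> \<Lambda> * (2 + 2 * \<bar>moment_const s 1\<bar>)"
     "0 \<le> \<Lambda> * (4 + (2 * \<bar>moment_const s 1\<bar> - 2 * moment_const s 1))" "0 \<le> \<Lambda> * (4 + 2 * \<bar>moment_const s 1\<bar>)"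
    using Lambda_nonneg by (auto intro!: mult_nonneg_nonneg)
  then show "\<Lambda> \<le> skew_bound" "2 * \<Lambda> \<le> skew_bound" "2 * \<Lambda> * moment_const s 1 \<le> skew_bound" "0 \<le> skew_bound"
    by (auto simp: skew_bound_def algebra_simps)
qed

text \<open>If \<open>s >= 1/2\<close> and \<open>R <= 1\<close>, then \<open>1 <= R^(1-2s)\<close>,
  so the assumed bound \<open>1 + R^(1-2s)\<close> is at most twice the homogeneous one. If
  \<open>s < 1/2\<close>, the first moment converges absolutely by the tail bound and no
  cancellation enters.\<close>

lemma skew_first_moment:
  assumes R: "0 < R" "R \<le> 1" and \<psi>: "test_function \<psi>" and b: "b \<in> Basis"
  shows "\<exists>l. ((\<lambda>\<epsilon>. LINT z|lborel. indicator {\<epsilon><..<R} (gap z) * (\<psi> (fst z) * (((fst z - snd z) \<bullet> b) * skew z)))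
        \<longlongrightarrow> l) (at_right 0) \<and> \<bar>l\<bar> \<le> skew_bound * R powr (1 - 2 * s) * (LINT v|lborel. \<bar>\<psi> v\<bar>)"
proof (cases "s \<ge> 1 / 2")
  case True
  then obtain P where P: "has_principal_value (\<lambda>v. ball v R) (\<lambda>v v'. (K v v' - K v' v) *\<^sub>R (v - v')) P"
    "\<And>v. norm (P v) \<le> \<Lambda> * (1 + R powr (1 - 2 * s))"
    using PV1 R by blast
  have "((\<lambda>\<epsilon>. LINT v|lebesgue. \<psi> v *\<^sub>R truncated_integral (\<lambda>v. ball v R) (\<lambda>v v'. (K v v' - K v' v) *\<^sub>R (v - v')) \<epsilon> v)
      \<longlongrightarrow> (LINT v|lebesgue. \<psi> v *\<^sub>R P v)) (at_right 0)"
    using P(1) \<psi> by (simp add: has_principal_value_def)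
  then have "((\<lambda>\<epsilon>. (LINT v|lebesgue. \<psi> v *\<^sub>R truncated_integral (\<lambda>v. ball v R) (\<lambda>v v'. (K v v' - K v' v) *\<^sub>R (v - v')) \<epsilon> v) \<bullet> b)
      \<longlongrightarrow> (LINT v|lebesgue. \<psi> v *\<^sub>R P v) \<bullet> b) (at_right 0)"
    by (intro tendsto_intros)
  then have lim: "((\<lambda>\<epsilon>. LINT z|lborel. indicator {\<epsilon><..<R} (gap z) * (\<psi> (fst z) * (((fst z - snd z) \<bullet> b) * skew z)))
      \<longlongrightarrow> (LINT v|lebesgue. \<psi> v *\<^sub>R P v) \<bullet> b) (at_right 0)"
    by (rule Lim_transform_eventually)
       (use eventually_at_right_less[of 0] truncated_pv1[OF \<psi> _ R(1) b] in \<open>auto elim!: eventually_mono\<close>)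
  have i0: "0 \<le> (LINT v|lborel. \<bar>\<psi> v\<bar>)" by simp
  have "\<bar>(LINT v|lebesgue. \<psi> v *\<^sub>R P v) \<bullet> b\<bar> \<le> norm (LINT v|lebesgue. \<psi> v *\<^sub>R P v)"
    by (rule Basis_le_norm[OF b])
  also have "\<dots> \<le> \<Lambda> * (1 + R powr (1 - 2 * s)) * (LINT v|lborel. \<bar>\<psi> v\<bar>)"
    by (rule abs_integral_mult_le[OF \<psi> P(2)])
  also have "\<dots> \<le> (2 * \<Lambda>) * R powr (1 - 2 * s) * (LINT v|lborel. \<bar>\<psi> v\<bar>)"
  proof (rule mult_right_mono[OF _ i0])
    have "1 \<le> R powr (1 - 2 * s)"
      using powr_mono'[of "1 - 2 * s" 0 R] R True by simp
    then have "1 + R powr (1 - 2 * s) \<le> 2 * R powr (1 - 2 * s)" by simp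
    from mult_left_mono[OF this Lambda_nonneg]
    show "\<Lambda> * (1 + R powr (1 - 2 * s)) \<le> (2 * \<Lambda>) * R powr (1 - 2 * s)" by (simp add: mult_ac)
  qed
  also have "\<dots> \<le> skew_bound * R powr (1 - 2 * s) * (LINT v|lborel. \<bar>\<psi> v\<bar>)"
    by (intro mult_right_mono skew_bound_ge i0) auto
  finally show ?thesis using lim by blast
next
  case False
  then have s1: "1 > 2 * s" by simp
  have [measurable]: "\<psi> \<in> borel_measurable borel" by (rule test_function_measurable[OF \<psi>])
  let ?F = "\<lambda>z. indicator {..<R} (gap z) * (\<psi> (fst z) * (((fst z - snd z) \<bullet> b) * skew z))"
  let ?B = "2 * \<Lambda> * moment_const s 1 * R powr (1 - 2 * s) * (LINT v|lborel. \<bar>\<psi> v\<bar>)"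
  have m0: "moment_const s 1 > 0" using moment_const_pos s1 by blast
  have B0: "?B \<ge> 0" using Lambda_nonneg m0 by simp
  have "(\<integral>\<^sup>+z. ennreal \<bar>indicator {0<..} (gap z) * ?F z\<bar> \<partial>lborel)
    \<le> (\<integral>\<^sup>+z. ennreal \<bar>\<psi> (fst z)\<bar> * (indicator {0<..<R} (gap z) * (ennreal (gap z powr 1) * ennreal \<bar>skew z\<bar>)) \<partial>lborel)"
  proof (rule nn_integral_mono)
    fix z :: "'a \<times> 'a"
    have "\<bar>(fst z - snd z) \<bullet> b\<bar> \<le> gap z" using Basis_le_norm[OF b, of "fst z - snd z"] by (simp add: gap_def)
    then have "\<bar>\<psi> (fst z)\<bar> * (\<bar>(fst z - snd z) \<bullet> b\<bar> * \<bar>skew z\<bar>) \<le> \<bar>\<psi> (fst z)\<bar> * (gap z * \<bar>skew z\<bar>)"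
      by (intro mult_left_mono mult_right_mono) auto
    then show "ennreal \<bar>indicator {0<..} (gap z) * ?F z\<bar>
        \<le> ennreal \<bar>\<psi> (fst z)\<bar> * (indicator {0<..<R} (gap z) * (ennreal (gap z powr 1) * ennreal \<bar>skew z\<bar>))"
      by (cases "0 < gap z \<and> gap z < R") (auto simp: abs_mult simp flip: ennreal_mult intro!: ennreal_leI simp: indicator_def)
  qed
  also have "\<dots> \<le> ennreal (moment_const s 1 * (2 * \<Lambda>) * R powr (1 - 2 * s)) * (\<integral>\<^sup>+v. ennreal \<bar>\<psi> v\<bar> \<partial>lborel)"
    using Lambda_nonneg R s1 by (intro ktail_near(1)[OF _ _ skew_tail skew_tail_swap]) auto
  also have "(\<integral>\<^sup>+v. ennreal \<bar>\<psi> v\<bar> \<partial>lborel) = ennreal (LINT v|lborel. \<bar>\<psi> v\<bar>)"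
    by (intro nn_integral_eq_integral integrable_abs test_function_integrable \<psi>) auto
  also have "ennreal (moment_const s 1 * (2 * \<Lambda>) * R powr (1 - 2 * s)) * ennreal (LINT v|lborel. \<bar>\<psi> v\<bar>) = ennreal ?B"
    using Lambda_nonneg m0 by (simp add: mult_ac flip: ennreal_mult)
  finally have *: "(\<integral>\<^sup>+z. ennreal \<bar>indicator {0<..} (gap z) * ?F z\<bar> \<partial>lborel) \<le> ennreal ?B" .
  have meas: "(\<lambda>z. indicator {0<..} (gap z) * ?F z) \<in> borel_measurable lborel" by measurable
  have "((\<lambda>\<epsilon>. LINT z|lborel. indicator {\<epsilon><..} (gap z) * ?F z) \<longlongrightarrow> (LINT z|lborel. indicator {0<..} (gap z) * ?F z)) (at_right 0)"
    by (rule integral_truncated_tendsto[OF integrable_of_nn_integral_le(1)[OF meas * B0]]) measurable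
  moreover have "indicator {\<epsilon><..} (gap z) * ?F z = indicator {\<epsilon><..<R} (gap z) * (\<psi> (fst z) * (((fst z - snd z) \<bullet> b) * skew z))" for \<epsilon> z
    by (auto simp: indicator_def)
  ultimately have lim: "((\<lambda>\<epsilon>. LINT z|lborel. indicator {\<epsilon><..<R} (gap z) * (\<psi> (fst z) * (((fst z - snd z) \<bullet> b) * skew z)))
      \<longlongrightarrow> (LINT z|lborel. indicator {0<..} (gap z) * ?F z)) (at_right 0)" by (simp only:)
  have "\<bar>LINT z|lborel. indicator {0<..} (gap z) * ?F z\<bar> \<le> ?B"
    by (rule integrable_of_nn_integral_le(2)[OF meas * B0])
  also have "\<dots> \<le> skew_bound * R powr (1 - 2 * s) * (LINT v|lborel. \<bar>\<psi> v\<bar>)"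
    by (intro mult_right_mono skew_bound_ge) auto
  finally show ?thesis using lim by blast
qed

sublocale skew_kernel skew s skew_bound
proof
  show "skew (prod.swap z) = - skew z" for z by (rule skew_swap)
  show "ktail s skew_bound skew" by (rule ktail_mono[OF skew_tail skew_bound_ge(2)])
  show "\<exists>l. ((\<lambda>\<epsilon>. LINT z|lborel. indicator {\<epsilon><..} (gap z) * (\<psi> (fst z) * skew z)) \<longlongrightarrow> l) (at_right 0) \<and>
      \<bar>l\<bar> \<le> skew_bound * (LINT v|lborel. \<bar>\<psi> v\<bar>)" if \<psi>: "test_function \<psi>" for \<psi> :: "'a \<Rightarrow> real"
  proof -
    obtain P where P: "has_principal_value (\<lambda>v. UNIV) (\<lambda>v v'. K v v' - K v' v) P" "\<And>v. \<bar>P v\<bar> \<le> \<Lambda>"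
      using PV0 by blast
    have "((\<lambda>\<epsilon>. LINT v|lebesgue. \<psi> v *\<^sub>R truncated_integral (\<lambda>v. UNIV) (\<lambda>v v'. K v v' - K v' v) \<epsilon> v)
      \<longlongrightarrow> (LINT v|lebesgue. \<psi> v *\<^sub>R P v)) (at_right 0)"
      using P(1) \<psi> unfolding has_principal_value_def by blast
    then have "((\<lambda>\<epsilon>. LINT z|lborel. indicator {\<epsilon><..} (gap z) * (\<psi> (fst z) * skew z)) \<longlongrightarrow> (LINT v|lebesgue. \<psi> v *\<^sub>R P v)) (at_right 0)"
      by (rule Lim_transform_eventually)
         (use eventually_at_right_less[of 0] truncated_pv0[OF \<psi>] in \<open>auto elim!: eventually_mono\<close>)
    moreover have "\<bar>LINT v|lebesgue. \<psi> v *\<^sub>R P v\<bar> \<le> \<Lambda> * (LINT v|lborel. \<bar>\<psi> v\<bar>)"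
      using abs_integral_mult_le[OF \<psi>, of P \<Lambda>] P(2) by simp
    moreover have "\<Lambda> * (LINT v|lborel. \<bar>\<psi> v\<bar>) \<le> skew_bound * (LINT v|lborel. \<bar>\<psi> v\<bar>)"
      by (intro mult_right_mono skew_bound_ge) auto
    ultimately show ?thesis by (meson order_trans)
  qed
qed (use s skew_bound_ge(4) skew_first_moment in auto)

lemma truncated_form_eq:
  assumes \<phi>: "test_function \<phi>" and g: "test_function g"
  shows "truncated_form K \<epsilon> \<phi> g = (LINT z|lborel. indicator {\<epsilon><..} (gap z) * (((\<phi> (fst z) - \<phi> (snd z)) * g (fst z)) * k z))"
  unfolding truncated_form_def set_lebesgue_integral_def
proof (rule lebesgue_integral_eq_lborel)
  have [measurable]: "\<phi> \<in> borel_measurable borel" "g \<in> borel_measurable borel"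
    using \<phi> g test_function_measurable by auto
  show "(\<lambda>z. indicator {\<epsilon><..} (gap z) * (((\<phi> (fst z) - \<phi> (snd z)) * g (fst z)) * k z)) \<in> borel_measurable borel"
    by measurable
  show "AE z in lborel. indicator {(v, v'). norm (v - v') > \<epsilon>} z *\<^sub>R (case z of (v, v') \<Rightarrow> (\<phi> v - \<phi> v') * g v * K v v')
      = indicator {\<epsilon><..} (gap z) * (((\<phi> (fst z) - \<phi> (snd z)) * g (fst z)) * k z)"
    using K_eq_k by eventually_elim (auto simp: indicator_def gap_def)
qed

definition sym_form :: "('a \<Rightarrow> real) \<Rightarrow> ('a \<Rightarrow> real) \<Rightarrow> real" where
  "sym_form \<phi> g = (LINT z|lborel. indicator {0<..} (gap z) * ((\<phi> (fst z) - \<phi> (snd z)) * (g (fst z) - g (snd z)) * k z))"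

lemma sym_form_bound:
  assumes \<phi>: "test_function \<phi>" and g: "test_function g"
  shows "integrable lborel (\<lambda>z. indicator {0<..} (gap z) * ((\<phi> (fst z) - \<phi> (snd z)) * (g (fst z) - g (snd z)) * k z))"
    and "\<bar>sym_form \<phi> g\<bar> \<le> sym_const TYPE('a) s * \<Lambda> * (hs2 s \<phi> + hs2 s g)"
proof -
  have [measurable]: "\<phi> \<in> borel_measurable borel" "g \<in> borel_measurable borel"
    using \<phi> g test_function_measurable by auto
  let ?F = "\<lambda>z. indicator {0<..} (gap z) * ((\<phi> (fst z) - \<phi> (snd z)) * (g (fst z) - g (snd z)) * k z)"
  let ?c = "sym_const TYPE('a) s * \<Lambda>"
  have c: "?c \<ge> 0" using sym_const_pos[OF s(1), where 'a='a] Lambda_nonneg by simp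
  have "(\<integral>\<^sup>+z. ennreal \<bar>?F z\<bar> \<partial>lborel) \<le> (\<integral>\<^sup>+z. ennreal (\<bar>k z\<bar> * sqdiff \<phi> z) + ennreal (\<bar>k z\<bar> * sqdiff g z) \<partial>lborel)"
  proof (rule nn_integral_mono)
    fix z
    have "\<bar>?F z\<bar> \<le> \<bar>\<phi> (snd z) - \<phi> (fst z)\<bar> * \<bar>g (snd z) - g (fst z)\<bar> * \<bar>k z\<bar>"
      by (auto simp: indicator_def abs_mult abs_minus_commute)
    also have "\<dots> \<le> (sqdiff \<phi> z + sqdiff g z) * \<bar>k z\<bar>"
      using amgm_weighted[of 1 "\<phi> (snd z) - \<phi> (fst z)" "g (snd z) - g (fst z)"]
      by (intro mult_right_mono) (auto simp: sqdiff_def)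
    finally have "ennreal \<bar>?F z\<bar> \<le> ennreal (\<bar>k z\<bar> * sqdiff \<phi> z + \<bar>k z\<bar> * sqdiff g z)"
      by (intro ennreal_leI) (simp add: algebra_simps)
    then show "ennreal \<bar>?F z\<bar> \<le> ennreal (\<bar>k z\<bar> * sqdiff \<phi> z) + ennreal (\<bar>k z\<bar> * sqdiff g z)"
      by simp
  qed
  also have "\<dots> = (\<integral>\<^sup>+z. ennreal (\<bar>k z\<bar> * sqdiff \<phi> z) \<partial>lborel) + (\<integral>\<^sup>+z. ennreal (\<bar>k z\<bar> * sqdiff g z) \<partial>lborel)"
    by (rule nn_integral_add) measurable
  also have "\<dots> \<le> ennreal (?c * hs2 s \<phi>) + ennreal (?c * hs2 s g)"
    by (intro add_mono kernel_sqdiff_le k_tail \<phi> g s Lambda_nonneg) auto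
  also have "\<dots> = ennreal (?c * (hs2 s \<phi> + hs2 s g))"
    unfolding distrib_left by (intro ennreal_plus[symmetric] mult_nonneg_nonneg[OF c]) auto
  finally have *: "(\<integral>\<^sup>+z. ennreal \<bar>?F z\<bar> \<partial>lborel) \<le> ennreal (?c * (hs2 s \<phi> + hs2 s g))" .
  have nn: "0 \<le> ?c * (hs2 s \<phi> + hs2 s g)" by (rule mult_nonneg_nonneg[OF c]) simp
  have meas: "?F \<in> borel_measurable lborel" by measurable
  show "integrable lborel ?F" by (rule integrable_of_nn_integral_le(1)[OF meas * nn])
  show "\<bar>sym_form \<phi> g\<bar> \<le> ?c * (hs2 s \<phi> + hs2 s g)"
    unfolding sym_form_def by (rule integrable_of_nn_integral_le(2)[OF meas * nn])
qed

text \<open>Averaging the integrand with its image under swapping the two variables: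
  \<open>(\<phi> - \<phi>')(gk - g'k\<^sup>t) = (\<phi> - \<phi>')(g - g')k + (\<phi> - \<phi>')g'(k - k\<^sup>t)\<close>.\<close>

lemma truncated_form_split:
  assumes \<phi>: "test_function \<phi>" and g: "test_function g" and \<epsilon>: "\<epsilon> > 0"
  shows "truncated_form K \<epsilon> \<phi> g = 1 / 2 * (LINT z|lborel. indicator {\<epsilon><..} (gap z) *
      ((\<phi> (fst z) - \<phi> (snd z)) * (g (fst z) - g (snd z)) * k z)) + 1 / 2 * skew_trunc \<epsilon> \<phi> g"
proof -
  have [measurable]: "\<phi> \<in> borel_measurable borel" "g \<in> borel_measurable borel"
    using \<phi> g test_function_measurable by auto
  obtain B where B: "B > 0" "\<And>x. \<bar>\<phi> x\<bar> \<le> B" using test_function_bounded[OF \<phi>] by metis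
  let ?i = "\<lambda>z. indicator {\<epsilon><..} (gap z) :: real" and ?d = "\<lambda>z. \<phi> (fst z) - \<phi> (snd z)"
  have J: "{\<epsilon><..} \<in> sets borel" "{\<epsilon><..} \<subseteq> {\<epsilon>..}" by auto
  have h: "integrable lborel (\<lambda>v. 2 * B * g v)" by (intro integrable_mult_right test_function_integrable g)
  have dB: "\<bar>?d z\<bar> \<le> \<bar>2 * B\<bar>" for z using B(2)[of "fst z"] B(2)[of "snd z"] B(1) by linarith
  have le1: "\<bar>?d z * g (fst z)\<bar> \<le> \<bar>2 * B * g (fst z)\<bar> + \<bar>2 * B * g (snd z)\<bar>" for z
    using mult_right_mono[OF dB[of z] abs_ge_zero[of "g (fst z)"]] abs_ge_zero[of "2 * B * g (snd z)"]
    unfolding abs_mult[symmetric] by linarith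
  have le2: "\<bar>?d z * g (snd z)\<bar> \<le> \<bar>2 * B * g (fst z)\<bar> + \<bar>2 * B * g (snd z)\<bar>" for z
    using mult_right_mono[OF dB[of z] abs_ge_zero[of "g (snd z)"]] abs_ge_zero[of "2 * B * g (fst z)"]
    unfolding abs_mult[symmetric] by linarith
  have i1: "integrable lborel (\<lambda>z. ?i z * ((?d z * g (fst z)) * k z))"
    by (rule integrable_kernel_far[OF k_measurable k_tail Lambda_nonneg _ h le1 \<epsilon> J]) measurable
  have i2: "integrable lborel (\<lambda>z. ?i z * ((?d z * g (snd z)) * k z))"
    by (rule integrable_kernel_far[OF k_measurable k_tail Lambda_nonneg _ h le2 \<epsilon> J]) measurable
  have i3: "integrable lborel (\<lambda>z. ?i z * ((?d z * g (snd z)) * skew z))"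
    by (rule integrable_kernel_far[OF skew_measurable skew_tail skew_tail_swap _ _ h le2 \<epsilon> J])
       (simp add: Lambda_nonneg, measurable)
  \<comment> \<open>Under the swap the increment of \<open>\<phi>\<close> and the skew kernel both
    change sign, so only the argument of \<open>g\<close> moves.\<close>
  have sw: "skew_trunc \<epsilon> \<phi> g = (LINT z|lborel. ?i z * ((?d z * g (snd z)) * skew z))"
    unfolding skew_trunc_def
    by (subst integral_swap[symmetric]) (auto simp: skew_swap algebra_simps intro!: Bochner_Integration.integral_cong)
  have "(LINT z|lborel. ?i z * ((?d z * g (fst z)) * k z)) = (LINT z|lborel. - (?i z * ((?d z * g (snd z)) * k (prod.swap z))))"
    by (subst integral_swap[symmetric]) (auto simp: algebra_simps intro!: Bochner_Integration.integral_cong)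
  also have "\<dots> = (LINT z|lborel. 1 * (?i z * ((?d z * g (snd z)) * skew z)) + (-1) * (?i z * ((?d z * g (snd z)) * k z)))"
    by (intro Bochner_Integration.integral_cong refl) (simp add: skew_def algebra_simps)
  also have "\<dots> = skew_trunc \<epsilon> \<phi> g - (LINT z|lborel. ?i z * ((?d z * g (snd z)) * k z))"
    using i2 i3 by (simp add: sw)
  finally have e1: "(LINT z|lborel. ?i z * ((?d z * g (fst z)) * k z))
      = skew_trunc \<epsilon> \<phi> g - (LINT z|lborel. ?i z * ((?d z * g (snd z)) * k z))" .
  have e2: "(LINT z|lborel. ?i z * (?d z * (g (fst z) - g (snd z)) * k z))
    = 1 * (LINT z|lborel. ?i z * ((?d z * g (fst z)) * k z)) + (-1) * (LINT z|lborel. ?i z * ((?d z * g (snd z)) * k z))"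
    by (rule integral_linear_combination[OF i1 i2]) (simp add: algebra_simps)
  have "a = 1 / 2 * (1 * a + (-1) * b) + 1 / 2 * c" if "a = c - b" for a b c :: real
    using that by (simp add: field_simps)
  from this[OF e1] show ?thesis unfolding truncated_form_eq[OF \<phi> g] e2 .
qed

lemma truncated_form_tendsto:
  assumes \<phi>: "test_function \<phi>" and g: "test_function g"
  shows "((\<lambda>\<epsilon>. truncated_form K \<epsilon> \<phi> g) \<longlongrightarrow> 1 / 2 * sym_form \<phi> g + 1 / 2 * skew_form \<phi> g) (at_right 0)"
proof -
  have [measurable]: "\<phi> \<in> borel_measurable borel" "g \<in> borel_measurable borel"
    using \<phi> g test_function_measurable by auto
  have "((\<lambda>\<epsilon>. 1 / 2 * (LINT z|lborel. indicator {\<epsilon><..} (gap z) *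
      ((\<phi> (fst z) - \<phi> (snd z)) * (g (fst z) - g (snd z)) * k z)) + 1 / 2 * skew_trunc \<epsilon> \<phi> g)
      \<longlongrightarrow> 1 / 2 * sym_form \<phi> g + 1 / 2 * skew_form \<phi> g) (at_right 0)"
    unfolding sym_form_def
    by (intro tendsto_intros skew_form_tendsto \<phi> g integral_truncated_tendsto sym_form_bound) measurable
  then show ?thesis
    by (rule Lim_transform_eventually)
       (use eventually_at_right_less[of 0] truncated_form_split[OF \<phi> g] in \<open>auto elim!: eventually_mono\<close>)
qed

lemma smooth_form_eq:
  assumes "test_function \<phi>" "test_function g"
  shows "smooth_form K \<phi> g = 1 / 2 * sym_form \<phi> g + 1 / 2 * skew_form \<phi> g"
  unfolding smooth_form_def by (rule tendsto_Lim[OF _ truncated_form_tendsto[OF assms]]) simp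

lemma smooth_form_linear_left:
  assumes "test_function \<phi>" "test_function \<psi>" "test_function g"
  shows "smooth_form K (\<lambda>v. a * \<phi> v + b * \<psi> v) g = a * smooth_form K \<phi> g + b * smooth_form K \<psi> g"
proof -
  have t: "test_function (\<lambda>v. a * \<phi> v + b * \<psi> v)"
    using assms by (intro test_function_add test_function_cmult)
  have "sym_form (\<lambda>v. a * \<phi> v + b * \<psi> v) g = a * sym_form \<phi> g + b * sym_form \<psi> g"
    unfolding sym_form_def
    by (rule integral_linear_combination[OF sym_form_bound(1)[OF assms(1,3)] sym_form_bound(1)[OF assms(2,3)]])
       (simp add: algebra_simps)
  then show ?thesis
    using assms t by (simp add: smooth_form_eq skew_form_linear_left algebra_simps)
qed

lemma smooth_form_linear_right:
  assumes "test_function \<phi>" "test_function g" "test_function h"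
  shows "smooth_form K \<phi> (\<lambda>v. a * g v + b * h v) = a * smooth_form K \<phi> g + b * smooth_form K \<phi> h"
proof -
  have t: "test_function (\<lambda>v. a * g v + b * h v)"
    using assms by (intro test_function_add test_function_cmult)
  have "sym_form \<phi> (\<lambda>v. a * g v + b * h v) = a * sym_form \<phi> g + b * sym_form \<phi> h"
    unfolding sym_form_def
    by (rule integral_linear_combination[OF sym_form_bound(1)[OF assms(1,2)] sym_form_bound(1)[OF assms(1,3)]])
       (simp add: algebra_simps)
  then show ?thesis
    using assms t by (simp add: smooth_form_eq skew_form_linear_right algebra_simps)
qed

end

section \<open>Extension by density\<close>

lemma gagliardo_integrand_eq:
  "gagliardo_integrand s f z = sqdiff f z * gkernel s z"
  unfolding gagliardo_integrand_def sqdiff_def gkernel_def gap_def powr_minus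
  by (cases z) (simp add: divide_inverse)

lemma Hs_norm_representative:
  fixes f h :: "'a::euclidean_space \<Rightarrow> real"
  assumes [measurable]: "h \<in> borel_measurable borel" and ae: "AE v in lborel. f v = h v"
  shows "Hs_norm s f = sqrt (hs2 s h)" "f \<in> Hs s \<longleftrightarrow> borel_Hs s h"
proof -
  have ae2: "AE v in lborel. \<bar>f v\<bar>\<^sup>2 = (h v)\<^sup>2" using ae by eventually_elim simp
  have ae3: "AE z in lborel. gagliardo_integrand s f z = sqdiff h z * gkernel s z"
    using AE_lborel_fst_snd[OF ae] by eventually_elim (simp add: gagliardo_integrand_eq sqdiff_def)
  have m2: "(\<lambda>v. (h v)\<^sup>2) \<in> borel_measurable borel" by measurable
  have m3: "(\<lambda>z. sqdiff h z * gkernel s z) \<in> borel_measurable borel" by measurable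
  show "Hs_norm s f = sqrt (hs2 s h)"
    unfolding Hs_norm_def hs2_def l2sq_def gag_def
    by (simp only: lebesgue_integral_eq_lborel(2)[OF m2 ae2] lebesgue_integral_eq_lborel(2)[OF m3 ae3])
  show "f \<in> Hs s \<longleftrightarrow> borel_Hs s h"
    unfolding Hs_def borel_Hs_def
    using lebesgue_integral_eq_lborel(1)[OF assms] lebesgue_integral_eq_lborel(3)[OF m2 ae2] lebesgue_integral_eq_lborel(3)[OF m3 ae3]
    by simp
qed

lemma Hs_representative:
  assumes "f \<in> Hs s"
  obtains h where "borel_Hs s h" "AE v in lborel. f v = h v"
proof -
  have "f \<in> borel_measurable (completion lborel)" using assms by (simp add: Hs_def)
  then obtain h where h: "h \<in> borel_measurable lborel" "AE v in lborel. f v = h v"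
    using completion_ex_borel_measurable_real by blast
  then have "borel_Hs s h" using Hs_norm_representative(2)[of h f s] assms by simp
  with h show ?thesis using that by blast
qed

lemma Hs_norm_diff_representative:
  assumes h: "borel_Hs s h" "AE v in lborel. f v = h v" and \<phi>: "test_function \<phi>"
  shows "Hs_norm s (\<lambda>v. \<phi> v - f v) = sqrt (hs2 s (\<lambda>v. \<phi> v - h v))"
proof (rule Hs_norm_representative)
  have [measurable]: "h \<in> borel_measurable borel" "\<phi> \<in> borel_measurable borel"
    using borel_Hs_measurable[OF h(1)] test_function_measurable[OF \<phi>] by auto
  show "(\<lambda>v. \<phi> v - h v) \<in> borel_measurable borel" by measurable
qed (use h(2) in \<open>auto elim: eventually_mono\<close>)

definition hnorm :: "real \<Rightarrow> ('a::euclidean_space \<Rightarrow> real) \<Rightarrow> real" where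
  "hnorm s f = sqrt (hs2 s f)"

lemma hnorm_nonneg [simp]: "hnorm s f \<ge> 0"
  by (simp add: hnorm_def)

text \<open>The factor 2 is not sharp; it accompanies every later use of the triangle inequality and
  ends up in the final constant.\<close>

lemma sqrt_quasi_triangle:
  fixes x y z :: real
  assumes "x \<le> 2 * y + 2 * z" "y \<ge> 0" "z \<ge> 0"
  shows "sqrt x \<le> 2 * (sqrt y + sqrt z)"
proof (rule real_le_lsqrt)
  show "2 * (sqrt y + sqrt z) \<ge> 0" using assms by simp
  have "2 * y + 2 * z \<le> 4 * (y + 2 * (sqrt y * sqrt z) + z)" using assms by simp
  also have "\<dots> = (2 * (sqrt y + sqrt z))\<^sup>2"
    using assms by (simp add: power_mult_distrib power2_sum mult.assoc)
  finally show "x \<le> (2 * (sqrt y + sqrt z))\<^sup>2" using assms(1) by linarith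
qed

lemma hnorm_add:
  "borel_Hs s f \<Longrightarrow> borel_Hs s g \<Longrightarrow> hnorm s (\<lambda>v. f v + g v) \<le> 2 * (hnorm s f + hnorm s g)"
  unfolding hnorm_def by (intro sqrt_quasi_triangle hs2_add) auto

lemma hnorm_diff:
  "borel_Hs s f \<Longrightarrow> borel_Hs s g \<Longrightarrow> hnorm s (\<lambda>v. f v - g v) \<le> 2 * (hnorm s f + hnorm s g)"
  unfolding hnorm_def by (intro sqrt_quasi_triangle hs2_diff) auto

lemma hs2_cmult: "hs2 s (\<lambda>v. a * f v) = a\<^sup>2 * hs2 s f"
proof -
  have "sqdiff (\<lambda>v. a * f v) z = a\<^sup>2 * sqdiff f z" for z
    by (simp add: sqdiff_def power_mult_distrib flip: right_diff_distrib)
  then show ?thesis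
    by (simp add: hs2_def l2sq_def gag_def power_mult_distrib distrib_left mult.assoc)
qed

text \<open>The two terms balance at \<open>t = sqrt Y / sqrt X\<close>, where both equal
  \<open>sqrt X * sqrt Y\<close>.\<close>

lemma scaling_product_bound:
  fixes x C X Y :: real
  assumes bound: "\<And>t. t > 0 \<Longrightarrow> x \<le> C * (t * X + Y / t)" and C: "C \<ge> 0" and X: "X \<ge> 0" and Y: "Y \<ge> 0"
  shows "x \<le> 2 * C * (sqrt X * sqrt Y)"
proof (cases "X = 0 \<or> Y = 0")
  case False
  then have XY: "X > 0" "Y > 0" using X Y by auto
  have "x \<le> C * (sqrt Y / sqrt X * X + Y / (sqrt Y / sqrt X))"
    using XY by (intro bound) simp
  also have "sqrt Y / sqrt X * X = sqrt X * sqrt Y"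
    using XY real_sqrt_mult_self[of X] by (simp add: field_simps)
  also have "Y / (sqrt Y / sqrt X) = sqrt X * sqrt Y"
    using XY real_sqrt_mult_self[of Y] by (simp add: field_simps)
  finally show ?thesis by simp
next
  case True
  \<comment> \<open>There is no optimal \<open>t\<close> in the degenerate case. The bound at small
    \<open>t\<close> settles \<open>Y = 0\<close>, and the bound at \<open>1 / t\<close> settles
    \<open>X = 0\<close>.\<close>
  have "x \<le> 0"
  proof (rule tendsto_lowerbound)
    show "((\<lambda>t. C * (t * (X + Y))) \<longlongrightarrow> 0) (at_right 0)"
      by (auto intro!: tendsto_eq_intros)
    show "\<forall>\<^sub>F t in at_right 0. x \<le> C * (t * (X + Y))"
      using eventually_at_right_less[of 0]
    proof eventually_elim
      case (elim t)
      then show ?case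
        using bound[of t] bound[of "1 / t"] True by (auto simp: mult.commute)
    qed
  qed simp
  then show ?thesis using True by auto
qed

section \<open>Continuity on test functions and passage to the limit\<close>

context pv_kernel
begin

definition cont_const :: "real \<Rightarrow> bool" where
  "cont_const C \<longleftrightarrow> C \<ge> 0 \<and> (\<forall>\<phi> g. test_function \<phi> \<longrightarrow> test_function g \<longrightarrow>
     \<bar>smooth_form K \<phi> g\<bar> \<le> C * (hs2 s \<phi> + hs2 s g))"

text \<open>Replacing \<open>\<phi>\<close> by \<open>sqrt t * \<phi>\<close> and \<open>g\<close>
  by \<open>g / sqrt t\<close> leaves the bilinear form unchanged but weights the two squared norms
  by \<open>t\<close> and \<open>1 / t\<close>; optimising in \<open>t\<close> yields the
  product.\<close>

lemma smooth_form_le: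
  assumes C: "cont_const C" and \<phi>: "test_function \<phi>" and g: "test_function g"
  shows "\<bar>smooth_form K \<phi> g\<bar> \<le> 2 * C * (hnorm s \<phi> * hnorm s g)"
  unfolding hnorm_def
proof (rule scaling_product_bound)
  show "C \<ge> 0" using C by (simp add: cont_const_def)
  fix t :: real assume t: "t > 0"
  have 1: "smooth_form K (\<lambda>v. sqrt t * \<phi> v) (\<lambda>v. 1 / sqrt t * g v) = smooth_form K \<phi> g"
  proof -
    have "smooth_form K (\<lambda>v. sqrt t * \<phi> v) (\<lambda>v. 1 / sqrt t * g v) = sqrt t * smooth_form K \<phi> (\<lambda>v. 1 / sqrt t * g v)"
      using smooth_form_linear_left[OF \<phi> test_function_zero test_function_cmult[OF g], of "sqrt t" 0 "1 / sqrt t"] by simp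
    also have "smooth_form K \<phi> (\<lambda>v. 1 / sqrt t * g v) = 1 / sqrt t * smooth_form K \<phi> g"
      using smooth_form_linear_right[OF \<phi> g test_function_zero, of "1 / sqrt t" 0] by simp
    finally show ?thesis using t by simp
  qed
  have "\<bar>smooth_form K (\<lambda>v. sqrt t * \<phi> v) (\<lambda>v. 1 / sqrt t * g v)\<bar>
      \<le> C * (hs2 s (\<lambda>v. sqrt t * \<phi> v) + hs2 s (\<lambda>v. 1 / sqrt t * g v))"
    using C unfolding cont_const_def by (auto intro!: test_function_cmult \<phi> g simp del: times_divide_eq_left)
  then show "\<bar>smooth_form K \<phi> g\<bar> \<le> C * (t * hs2 s \<phi> + hs2 s g / t)"
    unfolding 1 hs2_cmult using t by (simp add: power_divide)
qed auto

text \<open>The difference is split bilinearly. Two approximations of the same function differ by at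
  most \<open>2 (\<delta> + \<delta>)\<close>, and one approximation has norm at most
  \<open>2 (1 + |f|)\<close>; with the factor \<open>2 * C\<close> of \<open>smooth_form_le\<close>
  this makes 16.\<close>

lemma smooth_form_perturb:
  assumes C: "cont_const C" and t: "test_function \<phi>" "test_function \<gamma>" "test_function \<phi>'" "test_function \<gamma>'"
    and H: "borel_Hs s f" "borel_Hs s g" and \<delta>: "0 \<le> \<delta>" "\<delta> \<le> 1"
    and close: "hnorm s (\<lambda>v. \<phi> v - f v) \<le> \<delta>" "hnorm s (\<lambda>v. \<gamma> v - g v) \<le> \<delta>"
      "hnorm s (\<lambda>v. \<phi>' v - f v) \<le> \<delta>" "hnorm s (\<lambda>v. \<gamma>' v - g v) \<le> \<delta>"
  shows "\<bar>smooth_form K \<phi> \<gamma> - smooth_form K \<phi>' \<gamma>'\<bar> \<le> 16 * C * \<delta> * (2 + hnorm s f + hnorm s g)"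
proof -
  have C0: "C \<ge> 0" using C by (simp add: cont_const_def)
  note tH = borel_Hs_test[OF t(1) s] borel_Hs_test[OF t(2) s] borel_Hs_test[OF t(3) s] borel_Hs_test[OF t(4) s]
  have d1: "hnorm s (\<lambda>v. \<phi> v - \<phi>' v) \<le> 4 * \<delta>"
    using hnorm_diff[OF hs2_diff(1)[OF tH(1) H(1)] hs2_diff(1)[OF tH(3) H(1)]] close by simp
  have d2: "hnorm s (\<lambda>v. \<gamma> v - \<gamma>' v) \<le> 4 * \<delta>"
    using hnorm_diff[OF hs2_diff(1)[OF tH(2) H(2)] hs2_diff(1)[OF tH(4) H(2)]] close by simp
  have b1: "hnorm s \<gamma> \<le> 2 * (1 + hnorm s g)"
    using hnorm_add[OF hs2_diff(1)[OF tH(2) H(2)] H(2)] close \<delta> by simp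
  have b2: "hnorm s \<phi>' \<le> 2 * (1 + hnorm s f)"
    using hnorm_add[OF hs2_diff(1)[OF tH(3) H(1)] H(1)] close \<delta> by simp
  have e: "smooth_form K \<phi> \<gamma> - smooth_form K \<phi>' \<gamma>' = smooth_form K (\<lambda>v. \<phi> v - \<phi>' v) \<gamma> + smooth_form K \<phi>' (\<lambda>v. \<gamma> v - \<gamma>' v)"
    using smooth_form_linear_left[OF t(1,3,2), of 1 "-1"] smooth_form_linear_right[OF t(3,2,4), of 1 "-1"] by simp
  have "\<bar>smooth_form K (\<lambda>v. \<phi> v - \<phi>' v) \<gamma>\<bar> \<le> 2 * C * (hnorm s (\<lambda>v. \<phi> v - \<phi>' v) * hnorm s \<gamma>)"
    by (intro smooth_form_le[OF C] test_function_diff t)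
  also have "\<dots> \<le> 2 * C * (4 * \<delta> * (2 * (1 + hnorm s g)))"
    using C0 \<delta> by (intro mult_left_mono mult_mono d1 b1) auto
  finally have 1: "\<bar>smooth_form K (\<lambda>v. \<phi> v - \<phi>' v) \<gamma>\<bar> \<le> 2 * C * (4 * \<delta> * (2 * (1 + hnorm s g)))" .
  have "\<bar>smooth_form K \<phi>' (\<lambda>v. \<gamma> v - \<gamma>' v)\<bar> \<le> 2 * C * (hnorm s \<phi>' * hnorm s (\<lambda>v. \<gamma> v - \<gamma>' v))"
    by (intro smooth_form_le[OF C] test_function_diff t)
  also have "\<dots> \<le> 2 * C * (2 * (1 + hnorm s f) * (4 * \<delta>))"
    using C0 \<delta> by (intro mult_left_mono mult_mono d2 b2) (auto intro: add_nonneg_nonneg)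
  finally have 2: "\<bar>smooth_form K \<phi>' (\<lambda>v. \<gamma> v - \<gamma>' v)\<bar> \<le> 2 * C * (2 * (1 + hnorm s f) * (4 * \<delta>))" .
  have "2 * C * (4 * \<delta> * (2 * (1 + hnorm s g))) + 2 * C * (2 * (1 + hnorm s f) * (4 * \<delta>))
      = 16 * C * \<delta> * (2 + hnorm s f + hnorm s g)"
    by (simp add: algebra_simps)
  then show ?thesis unfolding e using 1 2 by linarith
qed

lemma Hs_approx_iff:
  assumes "borel_Hs s h" "AE v in lborel. f v = h v"
  shows "Hs_approx s \<phi> f \<longleftrightarrow> (\<forall>n. test_function (\<phi> n)) \<and> (\<lambda>n. hnorm s (\<lambda>v. \<phi> n v - h v)) \<longlonglongrightarrow> 0"
  using Hs_norm_diff_representative[OF assms] by (auto simp: Hs_approx_def hnorm_def)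

lemma ex_Hs_approx:
  assumes h: "borel_Hs s h" "AE v in lborel. f v = h v"
  shows "\<exists>\<phi>. Hs_approx s \<phi> f"
proof -
  have "\<exists>\<phi>. test_function \<phi> \<and> hs2 s (\<lambda>v. \<phi> v - h v) < 1 / real (Suc n)" for n
    by (rule test_function_approx[OF h(1) s, of "1 / real (Suc n)"]) auto
  then obtain \<phi> where \<phi>: "\<And>n. test_function (\<phi> n)" "\<And>n. hs2 s (\<lambda>v. \<phi> n v - h v) < 1 / real (Suc n)"
    by metis
  have "(\<lambda>n. 1 / real (Suc n)) \<longlonglongrightarrow> 0" by (rule lim_1_over_n[THEN LIMSEQ_Suc])
  then have "(\<lambda>n. hs2 s (\<lambda>v. \<phi> n v - h v)) \<longlonglongrightarrow> 0"
    by (rule tendsto_sandwich[OF _ _ tendsto_const, rotated 2])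
       (use \<phi>(2) in \<open>auto intro!: always_eventually less_imp_le\<close>)
  then have "(\<lambda>n. hnorm s (\<lambda>v. \<phi> n v - h v)) \<longlonglongrightarrow> sqrt 0"
    unfolding hnorm_def by (rule tendsto_real_sqrt)
  then show ?thesis using \<phi>(1) Hs_approx_iff[OF h] by auto
qed

text \<open>Density guarantees that approximating sequences exist, without which
  \<open>form_value\<close> would hold vacuously for every number. The factor 8 is
  \<open>2 * C\<close> from \<open>smooth_form_le\<close> times a quasi-triangle factor 2 for each
  argument.\<close>

lemma form_value_bound:
  assumes C: "cont_const C" and fg: "f \<in> Hs s" "g \<in> Hs s"
  shows "\<exists>!e. form_value s K f g e" "form s K f g \<le> 8 * C * Hs_norm s f * Hs_norm s g"
proof -
  obtain h where h: "borel_Hs s h" "AE v in lborel. f v = h v" by (rule Hs_representative[OF fg(1)])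
  obtain j where j: "borel_Hs s j" "AE v in lborel. g v = j v" by (rule Hs_representative[OF fg(2)])
  have C0: "C \<ge> 0" using C by (simp add: cont_const_def)
  let ?D = "16 * C * (2 + hnorm s h + hnorm s j)"
  have D: "?D \<ge> 0" using C0 by (intro mult_nonneg_nonneg add_nonneg_nonneg) auto
  \<comment> \<open>Used twice: with the same sequences on both sides it gives the Cauchy property,
    with different ones the independence of the limit.\<close>
  have close: "\<exists>N. \<forall>n\<ge>N. \<forall>m\<ge>N. \<bar>smooth_form K (\<phi> n) (\<gamma> n) - smooth_form K (\<phi>' m) (\<gamma>' m)\<bar> < \<eta>"
    if A: "Hs_approx s \<phi> f" "Hs_approx s \<gamma> g" "Hs_approx s \<phi>' f" "Hs_approx s \<gamma>' g" and \<eta>: "\<eta> > 0"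
    for \<phi> \<gamma> \<phi>' \<gamma>' \<eta>
  proof -
    note A' = A(1,3)[unfolded Hs_approx_iff[OF h]] A(2,4)[unfolded Hs_approx_iff[OF j]]
    define \<delta> where "\<delta> = min 1 (\<eta> / (?D + 1))"
    have \<delta>: "\<delta> > 0" "\<delta> \<le> 1" using \<eta> D by (auto simp: \<delta>_def)
    have "\<forall>\<^sub>F n in sequentially. hnorm s (\<lambda>v. \<phi> n v - h v) < \<delta> \<and> hnorm s (\<lambda>v. \<gamma> n v - j v) < \<delta>
        \<and> hnorm s (\<lambda>v. \<phi>' n v - h v) < \<delta> \<and> hnorm s (\<lambda>v. \<gamma>' n v - j v) < \<delta>"
      using A' \<delta>(1) by (intro eventually_conj order_tendstoD(2)) auto
    then obtain N where N: "\<And>n. n \<ge> N \<Longrightarrow> hnorm s (\<lambda>v. \<phi> n v - h v) < \<delta> \<and> hnorm s (\<lambda>v. \<gamma> n v - j v) < \<delta>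
        \<and> hnorm s (\<lambda>v. \<phi>' n v - h v) < \<delta> \<and> hnorm s (\<lambda>v. \<gamma>' n v - j v) < \<delta>"
      by (auto simp: eventually_sequentially)
    have "\<bar>smooth_form K (\<phi> n) (\<gamma> n) - smooth_form K (\<phi>' m) (\<gamma>' m)\<bar> < \<eta>" if "n \<ge> N" "m \<ge> N" for n m
    proof -
      have "\<bar>smooth_form K (\<phi> n) (\<gamma> n) - smooth_form K (\<phi>' m) (\<gamma>' m)\<bar> \<le> 16 * C * \<delta> * (2 + hnorm s h + hnorm s j)"
        using N[OF that(1)] N[OF that(2)] \<delta> A'
        by (intro smooth_form_perturb[OF C _ _ _ _ h(1) j(1)]) auto
      also have "\<dots> = ?D * \<delta>" by simp
      also have "\<dots> \<le> ?D * (\<eta> / (?D + 1))" using D by (intro mult_left_mono) (auto simp: \<delta>_def)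
      also have "\<dots> = (?D / (?D + 1)) * \<eta>" by simp
      also have "\<dots> < 1 * \<eta>" using D \<eta> by (intro mult_strict_right_mono) (auto simp: divide_less_eq)
      finally show ?thesis by simp
    qed
    then show ?thesis by blast
  qed
  obtain \<phi>0 where \<phi>0: "Hs_approx s \<phi>0 f" using ex_Hs_approx[OF h] by blast
  obtain \<gamma>0 where \<gamma>0: "Hs_approx s \<gamma>0 g" using ex_Hs_approx[OF j] by blast
  have "Cauchy (\<lambda>n. smooth_form K (\<phi>0 n) (\<gamma>0 n))"
    unfolding Cauchy_def dist_real_def using close[OF \<phi>0 \<gamma>0 \<phi>0 \<gamma>0] by blast
  then obtain e where e: "(\<lambda>n. smooth_form K (\<phi>0 n) (\<gamma>0 n)) \<longlonglongrightarrow> e"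
    using Cauchy_convergent convergent_def by blast
  have val: "form_value s K f g e"
    unfolding form_value_def
  proof (intro allI impI, elim conjE)
    fix \<phi> \<gamma> assume A: "Hs_approx s \<phi> f" "Hs_approx s \<gamma> g"
    have "(\<lambda>n. smooth_form K (\<phi> n) (\<gamma> n) - smooth_form K (\<phi>0 n) (\<gamma>0 n)) \<longlonglongrightarrow> 0"
      by (rule LIMSEQ_I) (use close[OF A \<phi>0 \<gamma>0] in fastforce)
    from tendsto_add[OF this e] show "(\<lambda>n. smooth_form K (\<phi> n) (\<gamma> n)) \<longlonglongrightarrow> e" by simp
  qed
  have uniq: "e' = e" if "form_value s K f g e'" for e'
    using that \<phi>0 \<gamma>0 e LIMSEQ_unique unfolding form_value_def by blast
  show "\<exists>!e. form_value s K f g e" using val uniq by blast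
  have "form s K f g = e" unfolding form_def by (rule the_equality, rule val, erule uniq)
  moreover have "e \<le> 8 * C * (hnorm s h * hnorm s j)"
  proof (rule LIMSEQ_le[OF e])
    note B = \<phi>0[unfolded Hs_approx_iff[OF h]] \<gamma>0[unfolded Hs_approx_iff[OF j]]
    let ?a = "\<lambda>n. hnorm s (\<lambda>v. \<phi>0 n v - h v)" and ?b = "\<lambda>n. hnorm s (\<lambda>v. \<gamma>0 n v - j v)"
    have "(\<lambda>n. 2 * C * ((2 * (?a n + hnorm s h)) * (2 * (?b n + hnorm s j)))) \<longlonglongrightarrow>
        2 * C * ((2 * (0 + hnorm s h)) * (2 * (0 + hnorm s j)))"
      by (intro tendsto_mult tendsto_add tendsto_const conjunct2[OF B(1)] conjunct2[OF B(2)])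
    moreover have "2 * C * ((2 * (0 + hnorm s h)) * (2 * (0 + hnorm s j))) = 8 * C * (hnorm s h * hnorm s j)"
      by algebra
    ultimately show "(\<lambda>n. 2 * C * ((2 * (?a n + hnorm s h)) * (2 * (?b n + hnorm s j)))) \<longlonglongrightarrow> 8 * C * (hnorm s h * hnorm s j)"
      by (simp only:)
    have "smooth_form K (\<phi>0 n) (\<gamma>0 n) \<le> 2 * C * ((2 * (?a n + hnorm s h)) * (2 * (?b n + hnorm s j)))" for n
    proof -
      have t: "test_function (\<phi>0 n)" "test_function (\<gamma>0 n)" using B by auto
      have "hnorm s (\<phi>0 n) \<le> 2 * (?a n + hnorm s h)"
        using hnorm_add[OF hs2_diff(1)[OF borel_Hs_test[OF t(1) s] h(1)] h(1)] by simp
      moreover have "hnorm s (\<gamma>0 n) \<le> 2 * (?b n + hnorm s j)"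
        using hnorm_add[OF hs2_diff(1)[OF borel_Hs_test[OF t(2) s] j(1)] j(1)] by simp
      ultimately have "2 * C * (hnorm s (\<phi>0 n) * hnorm s (\<gamma>0 n)) \<le> 2 * C * ((2 * (?a n + hnorm s h)) * (2 * (?b n + hnorm s j)))"
        using C0 by (intro mult_left_mono mult_mono) auto
      then show ?thesis using smooth_form_le[OF C t] by linarith
    qed
    then show "\<exists>N. \<forall>n\<ge>N. smooth_form K (\<phi>0 n) (\<gamma>0 n) \<le> 2 * C * ((2 * (?a n + hnorm s h)) * (2 * (?b n + hnorm s j)))" by blast
  qed
  moreover have "Hs_norm s f = hnorm s h" "Hs_norm s g = hnorm s j"
    using Hs_norm_representative(1)[OF borel_Hs_measurable[OF h(1)] h(2)]
      Hs_norm_representative(1)[OF borel_Hs_measurable[OF j(1)] j(2)] by (auto simp: hnorm_def)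
  ultimately show "form s K f g \<le> 8 * C * Hs_norm s f * Hs_norm s g" by (simp add: mult.assoc)
qed

end

context pv_kernel
begin

text \<open>The constant is written out in terms of \<open>s\<close>, \<open>\<Lambda>\<close> and
  the dimension so that it can be chosen before the kernel. The absolute value of \<open>T\<close>
  makes its nonnegativity immediate.\<close>

lemma cont_const_of_skew:
  assumes T: "\<And>f g. test_function f \<Longrightarrow> test_function g \<Longrightarrow> \<bar>skew_form f g\<bar> \<le> T * skew_bound * (hs2 s f + hs2 s g)"
  shows "cont_const (sym_const TYPE('a) s * \<Lambda> + \<bar>T\<bar> * (\<Lambda> * (4 + 2 * \<bar>moment_const s 1\<bar>)))"
  unfolding cont_const_def skew_bound_def[symmetric]
proof (intro conjI allI impI)
  let ?c = "sym_const TYPE('a) s * \<Lambda>"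
  have c: "?c \<ge> 0" using sym_const_pos[OF s(1), where 'a='a] Lambda_nonneg by simp
  have b: "\<bar>T\<bar> * skew_bound \<ge> 0" using skew_bound_ge by simp
  show "?c + \<bar>T\<bar> * skew_bound \<ge> 0" using c b by simp
  fix \<phi> g :: "'a \<Rightarrow> real" assume t: "test_function \<phi>" "test_function g"
  let ?N = "hs2 s \<phi> + hs2 s g"
  have N: "?N \<ge> 0" by simp
  have "\<bar>skew_form \<phi> g\<bar> \<le> T * skew_bound * ?N" by (rule T[OF t])
  also have "\<dots> \<le> \<bar>T\<bar> * skew_bound * ?N"
    using skew_bound_ge by (intro mult_right_mono N) auto
  finally have "\<bar>skew_form \<phi> g\<bar> \<le> \<bar>T\<bar> * skew_bound * ?N" .
  moreover have "\<bar>sym_form \<phi> g\<bar> \<le> ?c * ?N" by (rule sym_form_bound(2)[OF t])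
  ultimately have "\<bar>smooth_form K \<phi> g\<bar> \<le> ?c * ?N + \<bar>T\<bar> * skew_bound * ?N"
    unfolding smooth_form_eq[OF t] by linarith
  then show "\<bar>smooth_form K \<phi> g\<bar> \<le> (?c + \<bar>T\<bar> * skew_bound) * ?N"
    by (simp add: distrib_right)
qed

end

text \<open>The order of choices matters: the mollifier and its constant are fixed first, from the
  space alone, so one constant serves all kernels with the given \<open>s\<close> and
  \<open>\<Lambda>\<close>.\<close>

lemma ex_cont_const:
  assumes s: "0 < s" "s < 1"
  shows "\<exists>C. \<forall>K k. pv_kernel (K :: 'a::euclidean_space \<Rightarrow> 'a \<Rightarrow> real) k s \<Lambda> \<longrightarrow> pv_kernel.cont_const K s C"
proof -
  obtain \<rho> :: "'a \<Rightarrow> real" where \<rho>: "mollifier \<rho>"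
    using ex_mollifier[where 'a='a] by (auto simp: mollifier_def)
  obtain c where c: "mollify_const \<rho> c" using mollifier.ex_mollify_const[OF \<rho>] by blast
  show ?thesis
  proof (intro exI allI impI)
    fix K :: "'a \<Rightarrow> 'a \<Rightarrow> real" and k
    assume "pv_kernel K k s \<Lambda>"
    then interpret pv_kernel K k s \<Lambda> .
    have "mollified_skew skew s skew_bound \<rho> c"
      by (intro mollified_skew.intro mollified_skew_axioms.intro skew_kernel_axioms \<rho> c)
    then interpret M: mollified_skew skew s skew_bound \<rho> c .
    show "cont_const (sym_const TYPE('a) s * \<Lambda> + \<bar>mollified_skew.total TYPE('a) s c\<bar> * (\<Lambda> * (4 + 2 * \<bar>moment_const s 1\<bar>)))"
      by (rule cont_const_of_skew) (rule M.skew_form_le)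
  qed
qed

theorem theorem4p1:
  fixes s \<Lambda> :: real
  assumes "0 < s" and "s < 1"
  shows "\<exists>C::real. \<forall>K :: real ^ 'd \<Rightarrow> real ^ 'd \<Rightarrow> real.
    (\<lambda>(v, v'). K v v') \<in> borel_measurable lebesgue \<longrightarrow>
    tail_bound s \<Lambda> K \<longrightarrow>
    tail_bound s \<Lambda> (\<lambda>v v'. K v' v) \<longrightarrow>
    (\<exists>P. has_principal_value (\<lambda>v. UNIV) (\<lambda>v v'. K v v' - K v' v) P \<and> (\<forall>v. \<bar>P v\<bar> \<le> \<Lambda>)) \<longrightarrow>
    (s \<ge> 1 / 2 \<longrightarrow>
      (\<forall>R>0. \<exists>P. has_principal_value (\<lambda>v. ball v R) (\<lambda>v v'. (K v v' - K v' v) *\<^sub>R (v - v')) P \<and>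
                 (\<forall>v. norm (P v) \<le> \<Lambda> * (1 + R powr (1 - 2 * s))))) \<longrightarrow>
    (\<forall>\<phi> g. test_function \<phi> \<longrightarrow> test_function g \<longrightarrow>
       (\<exists>l. ((\<lambda>\<epsilon>. truncated_form K \<epsilon> \<phi> g) \<longlongrightarrow> l) (at_right 0))) \<and>
    (\<forall>f \<in> Hs s. \<forall>g \<in> Hs s.
       (\<exists>!e. form_value s K f g e) \<and>
       form s K f g \<le> C * Hs_norm s f * Hs_norm s g)"
proof -
  obtain C where C: "\<And>(K :: real ^ 'd \<Rightarrow> real ^ 'd \<Rightarrow> real) k. pv_kernel K k s \<Lambda> \<Longrightarrow> pv_kernel.cont_const K s C"
    using ex_cont_const[OF assms, of \<Lambda>] by blast
  show ?thesis
  proof (intro exI[of _ "8 * C"] allI impI)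
    fix K :: "real ^ 'd \<Rightarrow> real ^ 'd \<Rightarrow> real"
    assume meas: "(\<lambda>(v, v'). K v v') \<in> borel_measurable lebesgue"
      and hyps: "tail_bound s \<Lambda> K" "tail_bound s \<Lambda> (\<lambda>v v'. K v' v)"
        "\<exists>P. has_principal_value (\<lambda>v. UNIV) (\<lambda>v v'. K v v' - K v' v) P \<and> (\<forall>v. \<bar>P v\<bar> \<le> \<Lambda>)"
        "s \<ge> 1 / 2 \<longrightarrow> (\<forall>R>0. \<exists>P. has_principal_value (\<lambda>v. ball v R) (\<lambda>v v'. (K v v' - K v' v) *\<^sub>R (v - v')) P \<and>
                 (\<forall>v. norm (P v) \<le> \<Lambda> * (1 + R powr (1 - 2 * s))))"
    \<comment> \<open>A Lebesgue measurable kernel agrees almost everywhere on pairs with a Borel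
      one; the form is unaffected, being an integral over pairs.\<close>
    obtain k where k: "k \<in> borel_measurable lborel" "AE z in lborel. (case z of (v, v') \<Rightarrow> K v v') = k z"
      using completion_ex_borel_measurable_real[OF meas] by blast
    have "pv_kernel K k s \<Lambda>"
      by unfold_locales (use k assms hyps in \<open>auto simp: case_prod_beta\<close>)
    then interpret pv_kernel K k s \<Lambda> .
    have cc: "cont_const C" by (rule C) unfold_locales
    show "(\<forall>\<phi> g. test_function \<phi> \<longrightarrow> test_function g \<longrightarrow>
       (\<exists>l. ((\<lambda>\<epsilon>. truncated_form K \<epsilon> \<phi> g) \<longlongrightarrow> l) (at_right 0))) \<and>
      (\<forall>f \<in> Hs s. \<forall>g \<in> Hs s. (\<exists>!e. form_value s K f g e) \<and>
         form s K f g \<le> 8 * C * Hs_norm s f * Hs_norm s g)"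
      using truncated_form_tendsto form_value_bound[OF cc] by blast
  qed
qed

end
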